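(* Let $R\in\mathbb R_{>0}$ and let $C_R$ be the full vertex algebra defined in the context. If $R^2\in\mathbb R\setminus\mathbb Q$, then $\ker\bar D\otimes\ker D$ is isomorphic to the affine Heisenberg full vertex algebra $M_{H,p_R}$. If $R^2=\frac pq$ with $p,q\in\mathbb Z_{>0}$ coprime, then $\ker\bar D\otimes\ker D$ is isomorphic to the lattice full vertex algebra $V_{\sqrt{2pq}\mathbb Z}\otimes\overline{V}_{\sqrt{2pq}\mathbb Z}$, and (for a suitable such identification) the irreducible decomposition of $C_{\sqrt{p/q}}$ as a module over it is $$C_{\sqrt{\frac pq}}=\bigoplus_{i\in\mathbb Z/2pq\mathbb Z}V_{\sqrt{2pq}\mathbb Z+\frac{i}{\sqrt{2pq}}}\otimes\overline{V}_{\sqrt{2pq}\mathbb Z+\frac{n_{p,q}i}{\sqrt{2pq}}}.$$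
   Context: $z,\bar z$ are formal variables with real exponents allowed, $\underline z=(z,\bar z)$. **The lattice.** $L=\mathbb Zx\oplus\mathbb Zy$ is the even unimodular lattice of signature $(1,1)$ with $(x,x)=(y,y)=0$, $(x,y)=-1$; $H=L\otimes_{\mathbb Z}\mathbb R$. For $R>0$, $v_R=\frac1{\sqrt2}(Rx-R^{-1}y)$ satisfies $(v_R,v_R)=1$, and $p_R$ is the orthogonal projection of $H$ onto $\mathbb Rv_R$ (so $\ker p_R$ is the negative-definite line orthogonal to $v_R$); $\bar p_R=1-p_R$. Put $(h,h')_{p_R}=(p_Rh,p_Rh')-(\bar p_Rh,\bar p_Rh')$. **The algebra $C_R$.** Let $h(n)$ ($h\in H,n\in\mathbb Z$) generate the Heisenberg algebra $[h(m),h'(n)]=m(h,h')_{p_R}\delta_{m+n,0}$; for $\alpha\in H$ let $M_{H,p_R}(\alpha)$ be the complex Fock module generated by $e_\alpha$ with $h(n)e_\alpha=0$ ($n\ge1$), $h(0)e_\alpha=(h,\alpha)_{p_R}e_\alpha$. On $G=\bigoplus_{\alpha\in H}M_{H,p_R}(\alpha)$ define $\hat Y(e_\alpha,\underline z)=E^-E^+l_{e_\alpha}z^{p_R\alpha}\bar z^{\bar p_R\alpha}$, where $E^\pm=\exp\bigl(\mp\sum_{n\ge1}\frac{(p_R\alpha)(\pm n)}nz^{\mp n}+\frac{(\bar p_R\alpha)(\pm n)}n\bar z^{\mp n}\bigr)$, $l_{e_\alpha}(we_\beta)=we_{\alpha+\beta}$ ($w$ a polynomial in the $h(-n)$, $n\ge1$),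 and $z^{p_R\alpha}\bar z^{\bar p_R\alpha}$ acts on $M_{H,p_R}(\beta)$ by $z^{(p_R\alpha,p_R\beta)_{p_R}}\bar z^{(\bar p_R\alpha,\bar p_R\beta)_{p_R}}$; inductively, for $h\in\ker\bar p_R$, $n\ge0$, $\hat Y(h(-n-1)v,\underline z)=(\frac1{n!}\partial_z^n\sum_{k\ge0}h(-k-1)z^k)\hat Y(v,\underline z)+\hat Y(v,\underline z)(\frac1{n!}\partial_z^n\sum_{k\ge0}h(k)z^{-k-1})$, and the same with $\bar z$ for $h\in\ker p_R$. Let $\mathbb C[\hat L]=\bigoplus_{\alpha\in L}\mathbb C\,\mathsf e_\alpha$ be the twisted group algebra with $\mathsf e_\alpha\mathsf e_\beta=\epsilon(\alpha,\beta)\mathsf e_{\alpha+\beta}$, where $\epsilon\in Z^2(L,\mathbb C^\times)$ satisfies $\epsilon(\alpha,0)=\epsilon(0,\alpha)=1$, $\epsilon(\alpha,\beta)=(-1)^{(\alpha,\beta)}\epsilon(\beta,\alpha)$ (unique up to isomorphism of algebras over $L$). Then $C_R=\bigoplus_{\alpha\in L}M_{H,p_R}(\alpha)\otimes\mathbb C\mathsf e_\alpha$ with $Y(a\otimes\mathsf e_\alpha,\underline z)=\hat Y(a,\underline z)\otimes(\text{left multiplication by }\mathsf e_\alpha)$ and vacuum $\mathbf 1=e_0\otimes\mathsf e_0$. Write $Y(a,\underline z)=\sum_{r,s\in\mathbb R}a(r,s)z^{-r-1}\bar z^{-s-1}$, $Da=a(-2,-1)\mathbf 1$, $\bar Da=a(-1,-2)\mathbf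 1$; $\ker\bar D$ (chiral vectors) and $\ker D$ (anti-chiral vectors) are subalgebras, a vertex algebra in $z$ and one in $\bar z$ respectively. $M_{H,p_R}=M_{H,p_R}(0)$ is the tensor product of the rank one Heisenberg vertex algebra in $z$ and the rank one Heisenberg vertex algebra in $\bar z$. **Other notation.** On a tensor product $Y(a\otimes b,\underline z)=Y(a,\underline z)\otimes Y(b,\underline z)$, and isomorphisms are linear bijections preserving $\mathbf 1$ and $Y$; $\ker\bar D\otimes\ker D$ maps to $C_R$ by $a\otimes b\mapsto a(-1,-1)b$, which makes $C_R$ a module over it. For $N\in\mathbb Z_{>0}$, $V_{\sqrt{2N}\mathbb Z}$ is the lattice vertex algebra of the rank one lattice generated by $\alpha$ with $(\alpha,\alpha)=2N$; its irreducible modules are $V_{\sqrt{2N}\mathbb Z+\frac i{\sqrt{2N}}}$, $i\in\mathbb Z/2N\mathbb Z$. $\overline V$ denotes the conjugate (anti-chiral: $z$ replaced by $\bar z$) of a vertex algebra or module $V$. For coprime $p,q\in\mathbb Z_{>0}$, $n_{p,q}\in(\mathbb Z/2pq\mathbb Z)^\times$ is the class of $ap+bq$ for any $(a,b)\in\mathbb Z^2$ with $ap-bq=1$ (independent of the choice). *)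

theory Defs
  imports "HOL-Analysis.Product_Vector" "HOL-Library.Poly_Mapping" "HOL-Library.FuncSet"
    "HOL-Number_Theory.Cong"
begin

section \<open>Complex vector spaces with a distinguished basis\<close>

text \<open>
  The vectors with basis \<^typ>\<open>'i\<close> are the finitely supported functions
  \<^typ>\<open>'i \<Rightarrow>\<^sub>0 complex\<close>; other complex vector spaces occur as subspaces of these.
\<close>

definition scale :: "complex \<Rightarrow> ('i \<Rightarrow>\<^sub>0 complex) \<Rightarrow> ('i \<Rightarrow>\<^sub>0 complex)" where
  "scale c v = Poly_Mapping.map ((*) c) v"

lemma lookup_scale [simp]: "Poly_Mapping.lookup (scale c v) i = c * Poly_Mapping.lookup v i"
  unfolding scale_def by (simp add: Poly_Mapping.map.rep_eq when_def)

global_interpretation cvs: vector_space "scale :: complex \<Rightarrow> ('i \<Rightarrow>\<^sub>0 complex) \<Rightarrow> _"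
  by unfold_locales
    (auto intro!: poly_mapping_eqI simp: Poly_Mapping.lookup_add algebra_simps)

abbreviation clinear :: "(('i \<Rightarrow>\<^sub>0 complex) \<Rightarrow> ('j \<Rightarrow>\<^sub>0 complex)) \<Rightarrow> bool" where
  "clinear \<equiv> Vector_Spaces.linear scale scale"

abbreviation bas :: "'i \<Rightarrow> ('i \<Rightarrow>\<^sub>0 complex)" where
  "bas i \<equiv> Poly_Mapping.single i 1"

text \<open>The linear map with prescribed values on the basis.\<close>

definition lin :: "('i \<Rightarrow> ('j \<Rightarrow>\<^sub>0 complex)) \<Rightarrow> ('i \<Rightarrow>\<^sub>0 complex) \<Rightarrow> ('j \<Rightarrow>\<^sub>0 complex)" where
  "lin f v = (\<Sum>i\<in>Poly_Mapping.keys v. scale (Poly_Mapping.lookup v i) (f i))"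

definition tens :: "('i \<Rightarrow>\<^sub>0 complex) \<Rightarrow> ('j \<Rightarrow>\<^sub>0 complex) \<Rightarrow> (('i \<times> 'j) \<Rightarrow>\<^sub>0 complex)" where
  "tens u v = lin (\<lambda>i. lin (\<lambda>j. bas (i, j)) v) u"

text \<open>For subspaces \<^term>\<open>S\<close>, \<^term>\<open>T\<close> this is (a copy of) the tensor product of \<^term>\<open>S\<close> and \<^term>\<open>T\<close>.\<close>

definition tens_space ::
  "('i \<Rightarrow>\<^sub>0 complex) set \<Rightarrow> ('j \<Rightarrow>\<^sub>0 complex) set \<Rightarrow> (('i \<times> 'j) \<Rightarrow>\<^sub>0 complex) set" where
  "tens_space S T = cvs.span {tens u v | u v. u \<in> S \<and> v \<in> T}"


section \<open>Formal series with operator coefficients and real exponents\<close>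

text \<open>\<^term>\<open>F r s\<close> is the coefficient of $z^r \bar z^s$ in \<^term>\<open>F\<close>.\<close>

type_synonym ('v, 'w) series = "real \<Rightarrow> real \<Rightarrow> 'v \<Rightarrow> 'w"

text \<open>
  Products and exponentials of series.  All series below are such that, applied to any
  given vector, only finitely many terms contribute to a given coefficient, as
  \<^const>\<open>Sum_any\<close> requires.
\<close>

definition sprod :: "('v, 'w::comm_monoid_add) series \<Rightarrow> ('u, 'v::zero) series \<Rightarrow> ('u, 'w) series"
    (infixr \<open>\<star>\<close> 70) where
  "(F \<star> G) r s u = Sum_any (\<lambda>(r', s'). F (r - r') (s - s') (G r' s' u))"

definition sconst :: "('v \<Rightarrow> 'w::zero) \<Rightarrow> ('v, 'w) series" where
  "sconst f r s v = (if r = 0 \<and> s = 0 then f v else 0)"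

fun spow :: "('v, 'v::comm_monoid_add) series \<Rightarrow> nat \<Rightarrow> ('v, 'v) series" where
  "spow F 0 = sconst (\<lambda>v. v)"
| "spow F (Suc k) = F \<star> spow F k"

definition sexp :: "('i \<Rightarrow>\<^sub>0 complex, 'i \<Rightarrow>\<^sub>0 complex) series \<Rightarrow> ('i \<Rightarrow>\<^sub>0 complex, 'i \<Rightarrow>\<^sub>0 complex) series" where
  "sexp F r s v = Sum_any (\<lambda>k::nat. scale (1 / fact k) (spow F k r s v))"

definition sadd :: "('v, 'w::plus) series \<Rightarrow> ('v, 'w) series \<Rightarrow> ('v, 'w) series" where
  "sadd F G r s v = F r s v + G r s v"

definition sscale :: "complex \<Rightarrow> ('v, 'j \<Rightarrow>\<^sub>0 complex) series \<Rightarrow> ('v, 'j \<Rightarrow>\<^sub>0 complex) series" where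
  "sscale c F r s v = scale c (F r s v)"

text \<open>$\sum_{m\in\mathbb Z} c_m z^m$, and the substitution exchanging $z$ and $\bar z$.\<close>

definition zser :: "(int \<Rightarrow> 'v \<Rightarrow> 'w::zero) \<Rightarrow> ('v, 'w) series" where
  "zser c r s v = (if r \<in> \<int> \<and> s = 0 then c \<lfloor>r\<rfloor> v else 0)"

definition sconj :: "('v, 'w) series \<Rightarrow> ('v, 'w) series" where
  "sconj F r s v = F s r v"

text \<open>$\partial_z$\<close>

definition dz :: "('v, 'j \<Rightarrow>\<^sub>0 complex) series \<Rightarrow> ('v, 'j \<Rightarrow>\<^sub>0 complex) series" where
  "dz F r s v = scale (of_real (r + 1)) (F (r + 1) s v)"

definition dz_div :: "nat \<Rightarrow> ('v, 'j \<Rightarrow>\<^sub>0 complex) series \<Rightarrow> ('v, 'j \<Rightarrow>\<^sub>0 complex) series" where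
  "dz_div n F = sscale (1 / fact n) ((dz ^^ n) F)"


section \<open>Fock modules and vertex operators\<close>

text \<open>
  \<^typ>\<open>'h\<close> is a finite-dimensional real space with the symmetric bilinear form \<^term>\<open>ip\<close> and an
  orthogonal projection \<^term>\<open>p\<close> such that the form is positive definite on the image of
  \<^term>\<open>p\<close> and negative definite on its kernel.  \<^term>\<open>B\<close> is a basis of \<^typ>\<open>'h\<close> contained
  in the union of these two subspaces and orthonormal for the positive definite form \<open>ipp\<close>.

  The polynomials in the $h(-n)$, $n \ge 1$, are the polynomials in variables indexed by pairs
  \<^term>\<open>(k, n)\<close>, where \<^term>\<open>(k, n)\<close> stands for $(B_k)(-n-1)$.  A basis of
  $G = \bigoplus_\alpha M(\alpha)$ is given by pairs \<^term>\<open>(\<alpha>, \<mu>)\<close> of a vector and a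
  monomial, where \<^term>\<open>(\<alpha>, \<mu>)\<close> stands for $\mu e_\alpha$.  As an algebra, $G$ is the
  (untwisted) group algebra of \<^typ>\<open>'h\<close> over the polynomial ring.
\<close>

type_synonym 'k monomial = "('k \<times> nat) \<Rightarrow>\<^sub>0 nat"
type_synonym ('h, 'k) state = "('h \<times> 'k monomial) \<Rightarrow>\<^sub>0 complex"

locale fock =
  fixes ip :: "'h::real_vector \<Rightarrow> 'h \<Rightarrow> real"
    and p :: "'h \<Rightarrow> 'h"
    and B :: "'k::finite \<Rightarrow> 'h"
begin

definition pbar :: "'h \<Rightarrow> 'h" where
  "pbar h = h - p h"

definition ipp :: "'h \<Rightarrow> 'h \<Rightarrow> real" where
  "ipp h h' = ip (p h) (p h') - ip (pbar h) (pbar h')"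

definition ev :: "'h \<Rightarrow> ('h, 'k) state" where
  "ev \<alpha> = bas (\<alpha>, 0)"

definition var :: "'k \<Rightarrow> nat \<Rightarrow> ('h, 'k) state" where
  "var k n = bas (0, Poly_Mapping.single (k, n) 1)"

definition pderiv :: "'k \<Rightarrow> nat \<Rightarrow> ('h, 'k) state \<Rightarrow> ('h, 'k) state" where
  "pderiv k n = lin (\<lambda>(\<alpha>, \<mu>). scale (of_nat (Poly_Mapping.lookup \<mu> (k, n)))
                               (bas (\<alpha>, \<mu> - Poly_Mapping.single (k, n) 1)))"

text \<open>The operator $h(m)$ on $G$.\<close>

definition osc :: "'h \<Rightarrow> int \<Rightarrow> ('h, 'k) state \<Rightarrow> ('h, 'k) state" where
  "osc h m v =
    (if m < 0 then \<Sum>k\<in>UNIV. scale (of_real (ipp h (B k))) (var k (nat (- m - 1)) * v)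
     else if m = 0 then lin (\<lambda>(\<alpha>, \<mu>). scale (of_real (ipp h \<alpha>)) (bas (\<alpha>, \<mu>))) v
     else \<Sum>k\<in>UNIV. scale (of_int m * of_real (ipp h (B k))) (pderiv k (nat (m - 1)) v))"

text \<open>
  For $\sigma = \pm 1$ this is $E^\pm$; in the coefficient of $z^m$ the summation index is
  $n = -\sigma m \ge 1$.
\<close>

definition Eser :: "int \<Rightarrow> 'h \<Rightarrow> (('h, 'k) state, ('h, 'k) state) series" where
  "Eser \<sigma> \<alpha> =
    (let c = (\<lambda>h m v. let n = - \<sigma> * m in
                if n \<ge> 1 then scale (- of_int \<sigma> / of_int n) (osc h (\<sigma> * n) v) else 0)
     in sexp (sadd (zser (c (p \<alpha>))) (sconj (zser (c (pbar \<alpha>))))))"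

text \<open>$z^{p\alpha} \bar z^{\bar p\alpha}$\<close>

definition zpow :: "'h \<Rightarrow> (('h, 'k) state, ('h, 'k) state) series" where
  "zpow \<alpha> r s = lin (\<lambda>(\<beta>, \<mu>). if ipp (p \<alpha>) (p \<beta>) = r \<and> ipp (pbar \<alpha>) (pbar \<beta>) = s
                               then bas (\<beta>, \<mu>) else 0)"

text \<open>$\sum_{k\ge 0} h(-k-1) z^k$ and $\sum_{k\ge 0} h(k) z^{-k-1}$\<close>

definition cur_creation :: "'h \<Rightarrow> (('h, 'k) state, ('h, 'k) state) series" where
  "cur_creation h = zser (\<lambda>m v. if m \<ge> 0 then osc h (- m - 1) v else 0)"

definition cur_annihilation :: "'h \<Rightarrow> (('h, 'k) state, ('h, 'k) state) series" where
  "cur_annihilation h = zser (\<lambda>m v. if m < 0 then osc h (- m - 1) v else 0)"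

text \<open>
  \<^term>\<open>vop a F\<close> expresses that $\hat Y(a, \underline z) =$ \<^term>\<open>F\<close>.  As
  \<^term>\<open>B\<close> is adapted to \<^term>\<open>p\<close>, the rules reach every \<^term>\<open>a\<close>; the normal
  ordered products with different currents commute, so \<^term>\<open>F\<close> is determined by
  \<^term>\<open>a\<close>.
\<close>

inductive vop :: "('h, 'k) state \<Rightarrow> (('h, 'k) state, ('h, 'k) state) series \<Rightarrow> bool" where
  vop_ev: "vop (ev \<alpha>) (Eser (-1) \<alpha> \<star> Eser 1 \<alpha> \<star> sconst ((*) (ev \<alpha>)) \<star> zpow \<alpha>)"
| vop_chiral: "pbar h = 0 \<Longrightarrow> vop v F \<Longrightarrow>
    vop (osc h (- int n - 1) v)
      (sadd (dz_div n (cur_creation h) \<star> F) (F \<star> dz_div n (cur_annihilation h)))"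
| vop_antichiral: "p h = 0 \<Longrightarrow> vop v F \<Longrightarrow>
    vop (osc h (- int n - 1) v)
      (sadd (sconj (dz_div n (cur_creation h)) \<star> F) (F \<star> sconj (dz_div n (cur_annihilation h))))"
| vop_add: "vop v F \<Longrightarrow> vop w G \<Longrightarrow> vop (v + w) (sadd F G)"
| vop_scale: "vop v F \<Longrightarrow> vop (scale c v) (sscale c F)"

definition Yhat :: "('h, 'k) state \<Rightarrow> (('h, 'k) state, ('h, 'k) state) series" where
  "Yhat a = (THE F. vop a F)"

text \<open>The sum of the $M(\alpha)$ over $\alpha \in S$, and the projection to $M(\alpha)$.\<close>

definition fock_sum :: "'h set \<Rightarrow> ('h, 'k) state set" where
  "fock_sum S = {v. fst ` Poly_Mapping.keys v \<subseteq> S}"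

definition fock_proj :: "'h \<Rightarrow> ('h, 'k) state \<Rightarrow> ('h, 'k) state" where
  "fock_proj \<alpha> = lin (\<lambda>(\<beta>, \<mu>). if \<beta> = \<alpha> then bas (\<beta>, \<mu>) else 0)"

text \<open>
  The operators $\hat Y(a, \underline z) \otimes \mathsf e_\alpha$ on
  $\bigoplus_\beta M(\beta) \otimes \mathbb C \mathsf e_\beta$.  Here $w \otimes \mathsf e_\beta$ is
  represented by $w \in M(\beta)$, so that left multiplication by $\mathsf e_\alpha$ in the twisted
  group algebra contributes the factor $\epsilon(\alpha, \beta)$.
\<close>

definition Ytwist :: "('h \<Rightarrow> 'h \<Rightarrow> complex) \<Rightarrow>
    ('h, 'k) state \<Rightarrow> (('h, 'k) state, ('h, 'k) state) series" where
  "Ytwist \<epsilon> a r s w =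
    Sum_any (\<lambda>(\<alpha>, \<beta>). scale (\<epsilon> \<alpha> \<beta>) (Yhat (fock_proj \<alpha> a) r s (fock_proj \<beta> w)))"

end


section \<open>Full vertex algebras and modules\<close>

text \<open>
  The data of a full vertex algebra: a subspace, the vacuum, and the vertex operator.  The vertex
  operators are bilinear on the whole ambient space.  Modules are given by a subspace and an
  action of the same kind as \<open>Y\<close>.
\<close>

record 'i fva =
  carr :: "('i \<Rightarrow>\<^sub>0 complex) set"
  vac :: "'i \<Rightarrow>\<^sub>0 complex"
  Y :: "('i \<Rightarrow>\<^sub>0 complex) \<Rightarrow> ('i \<Rightarrow>\<^sub>0 complex, 'i \<Rightarrow>\<^sub>0 complex) series"

text \<open>$a(r,s)b$, where $Y(a,\underline z) = \sum_{r,s} a(r,s) z^{-r-1} \bar z^{-s-1}$.\<close>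

definition fmode :: "'i fva \<Rightarrow> ('i \<Rightarrow>\<^sub>0 complex) \<Rightarrow> real \<Rightarrow> real \<Rightarrow> ('i \<Rightarrow>\<^sub>0 complex) \<Rightarrow> ('i \<Rightarrow>\<^sub>0 complex)" where
  "fmode A a r s b = Y A a (- r - 1) (- s - 1) b"

definition Dop :: "'i fva \<Rightarrow> ('i \<Rightarrow>\<^sub>0 complex) \<Rightarrow> ('i \<Rightarrow>\<^sub>0 complex)" where
  "Dop A a = fmode A a (-2) (-1) (vac A)"

definition Dbar :: "'i fva \<Rightarrow> ('i \<Rightarrow>\<^sub>0 complex) \<Rightarrow> ('i \<Rightarrow>\<^sub>0 complex)" where
  "Dbar A a = fmode A a (-1) (-2) (vac A)"

definition ker_Dbar :: "'i fva \<Rightarrow> 'i fva" where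
  "ker_Dbar A = A\<lparr>carr := {a \<in> carr A. Dbar A a = 0}\<rparr>"

definition ker_D :: "'i fva \<Rightarrow> 'i fva" where
  "ker_D A = A\<lparr>carr := {a \<in> carr A. Dop A a = 0}\<rparr>"

definition conj_action :: "('u \<Rightarrow> ('v, 'w) series) \<Rightarrow> 'u \<Rightarrow> ('v, 'w) series" where
  "conj_action Y1 u = sconj (Y1 u)"

definition conj_fva :: "'i fva \<Rightarrow> 'i fva" where
  "conj_fva A = A\<lparr>Y := conj_action (Y A)\<rparr>"

text \<open>$Y(a \otimes b, \underline z) = Y(a, \underline z) \otimes Y(b, \underline z)$, extended bilinearly.\<close>

definition tens_action ::
  "(('i \<Rightarrow>\<^sub>0 complex) \<Rightarrow> ('m \<Rightarrow>\<^sub>0 complex, 'm \<Rightarrow>\<^sub>0 complex) series) \<Rightarrow>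
   (('j \<Rightarrow>\<^sub>0 complex) \<Rightarrow> ('n \<Rightarrow>\<^sub>0 complex, 'n \<Rightarrow>\<^sub>0 complex) series) \<Rightarrow>
   (('i \<times> 'j) \<Rightarrow>\<^sub>0 complex) \<Rightarrow> (('m \<times> 'n) \<Rightarrow>\<^sub>0 complex, ('m \<times> 'n) \<Rightarrow>\<^sub>0 complex) series" where
  "tens_action Y1 Y2 u r s w =
     lin (\<lambda>(i, j). lin (\<lambda>(m, n).
       Sum_any (\<lambda>(r', s'). tens (Y1 (bas i) r' s' (bas m)) (Y2 (bas j) (r - r') (s - s') (bas n)))) w) u"

definition tens_fva :: "'i fva \<Rightarrow> 'j fva \<Rightarrow> ('i \<times> 'j) fva" where
  "tens_fva A A' = \<lparr>carr = tens_space (carr A) (carr A'), vac = tens (vac A) (vac A'),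
                    Y = tens_action (Y A) (Y A')\<rparr>"

definition closed_under :: "'u set \<Rightarrow> ('u \<Rightarrow> ('w, 'w) series) \<Rightarrow> 'w set \<Rightarrow> bool" where
  "closed_under U act W \<longleftrightarrow> (\<forall>u\<in>U. \<forall>w\<in>W. \<forall>r s. act u r s w \<in> W)"

text \<open>
  A linear map between subspaces is given as the restriction of a linear map between the ambient
  spaces (every linear map extends).
\<close>

definition fva_iso :: "(('i \<Rightarrow>\<^sub>0 complex) \<Rightarrow> ('j \<Rightarrow>\<^sub>0 complex)) \<Rightarrow> 'i fva \<Rightarrow> 'j fva \<Rightarrow> bool" where
  "fva_iso f A A' \<longleftrightarrow> clinear f \<and> bij_betw f (carr A) (carr A') \<and> f (vac A) = vac A' \<and>
     closed_under (carr A) (Y A) (carr A) \<and> closed_under (carr A') (Y A') (carr A') \<and>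
     (\<forall>a\<in>carr A. \<forall>b\<in>carr A. \<forall>r s. f (Y A a r s b) = Y A' (f a) r s (f b))"

definition isomorphic_fva :: "'i fva \<Rightarrow> 'j fva \<Rightarrow> bool" where
  "isomorphic_fva A A' \<longleftrightarrow> (\<exists>f. fva_iso f A A')"

definition submodule_of ::
  "'u set \<Rightarrow> ('u \<Rightarrow> ('i \<Rightarrow>\<^sub>0 complex, 'i \<Rightarrow>\<^sub>0 complex) series) \<Rightarrow> ('i \<Rightarrow>\<^sub>0 complex) set \<Rightarrow> ('i \<Rightarrow>\<^sub>0 complex) set \<Rightarrow> bool" where
  "submodule_of U act W' W \<longleftrightarrow> cvs.subspace W' \<and> W' \<subseteq> W \<and> closed_under U act W'"

definition irreducible_module ::
  "'u set \<Rightarrow> ('u \<Rightarrow> ('i \<Rightarrow>\<^sub>0 complex, 'i \<Rightarrow>\<^sub>0 complex) series) \<Rightarrow> ('i \<Rightarrow>\<^sub>0 complex) set \<Rightarrow> bool" where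
  "irreducible_module U act W \<longleftrightarrow> submodule_of U act W W \<and> W \<noteq> {0} \<and>
     (\<forall>W'. submodule_of U act W' W \<longrightarrow> W' = {0} \<or> W' = W)"

text \<open>
  Isomorphism \<^term>\<open>f\<close> of the module \<^term>\<open>W\<close> over (the algebra with underlying space)
  \<^term>\<open>U\<close> with the module \<^term>\<open>W'\<close>, on which \<^term>\<open>U\<close> acts through \<^term>\<open>\<phi>\<close>.
\<close>

definition module_iso ::
  "(('i \<Rightarrow>\<^sub>0 complex) \<Rightarrow> ('j \<Rightarrow>\<^sub>0 complex)) \<Rightarrow> 'u set \<Rightarrow> ('u \<Rightarrow> 'v) \<Rightarrow>
   ('u \<Rightarrow> ('i \<Rightarrow>\<^sub>0 complex, 'i \<Rightarrow>\<^sub>0 complex) series) \<Rightarrow> ('i \<Rightarrow>\<^sub>0 complex) set \<Rightarrow>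
   ('v \<Rightarrow> ('j \<Rightarrow>\<^sub>0 complex, 'j \<Rightarrow>\<^sub>0 complex) series) \<Rightarrow> ('j \<Rightarrow>\<^sub>0 complex) set \<Rightarrow> bool" where
  "module_iso f U \<phi> act W act' W' \<longleftrightarrow> clinear f \<and> bij_betw f W W' \<and>
     closed_under U act W \<and> closed_under (\<phi> ` U) act' W' \<and>
     (\<forall>u\<in>U. \<forall>w\<in>W. \<forall>r s. f (act u r s w) = act' (\<phi> u) r s (f w))"

definition direct_sum_decomp ::
  "('i \<Rightarrow>\<^sub>0 complex) set \<Rightarrow> 'a set \<Rightarrow> ('a \<Rightarrow> ('i \<Rightarrow>\<^sub>0 complex) set) \<Rightarrow> bool" where
  "direct_sum_decomp V I W \<longleftrightarrow> (\<forall>i\<in>I. cvs.subspace (W i)) \<and>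
     bij_betw (\<lambda>w. \<Sum>i\<in>I. w i) (Pi\<^sub>E I W) V"

text \<open>
  The map $\ker\bar D \otimes \ker D \to A$, $a \otimes b \mapsto a(-1,-1)b$, and the action of
  $\ker\bar D \otimes \ker D$ on $A$ that it induces.
\<close>

definition ker_tens :: "'i fva \<Rightarrow> ('i \<times> 'i) fva" where
  "ker_tens A = tens_fva (ker_Dbar A) (ker_D A)"

definition ker_tens_map :: "'i fva \<Rightarrow> (('i \<times> 'i) \<Rightarrow>\<^sub>0 complex) \<Rightarrow> ('i \<Rightarrow>\<^sub>0 complex)" where
  "ker_tens_map A = lin (\<lambda>(i, j). fmode A (bas i) (-1) (-1) (bas j))"

definition ker_tens_action ::
  "'i fva \<Rightarrow> (('i \<times> 'i) \<Rightarrow>\<^sub>0 complex) \<Rightarrow> ('i \<Rightarrow>\<^sub>0 complex, 'i \<Rightarrow>\<^sub>0 complex) series" where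
  "ker_tens_action A u = Y A (ker_tens_map A u)"


section \<open>The full vertex algebra $C_R$ and the affine Heisenberg full vertex algebra\<close>

text \<open>\<^term>\<open>(a, b)\<close> stands for $ax + by$.\<close>

type_synonym H = "real \<times> real"

definition ipH :: "H \<Rightarrow> H \<Rightarrow> real" where
  "ipH h h' = - (fst h * snd h' + snd h * fst h')"

definition L :: "H set" where
  "L = \<int> \<times> \<int>"

definition vR :: "real \<Rightarrow> H" where
  "vR R = (1 / sqrt 2) *\<^sub>R (R, - inverse R)"

definition pR :: "real \<Rightarrow> H \<Rightarrow> H" where
  "pR R h = ipH h (vR R) *\<^sub>R vR R"

definition vbarR :: "real \<Rightarrow> H" where
  "vbarR R = (1 / sqrt 2) *\<^sub>R (R, inverse R)"

definition BR :: "real \<Rightarrow> bool \<Rightarrow> H" where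
  "BR R k = (if k then vR R else vbarR R)"

definition lattice_cocycle :: "(H \<Rightarrow> H \<Rightarrow> complex) \<Rightarrow> bool" where
  "lattice_cocycle \<epsilon> \<longleftrightarrow>
     (\<forall>\<alpha>\<in>L. \<forall>\<beta>\<in>L. \<epsilon> \<alpha> \<beta> \<noteq> 0) \<and>
     (\<forall>\<alpha>\<in>L. \<forall>\<beta>\<in>L. \<forall>\<gamma>\<in>L. \<epsilon> \<alpha> \<beta> * \<epsilon> (\<alpha> + \<beta>) \<gamma> = \<epsilon> \<alpha> (\<beta> + \<gamma>) * \<epsilon> \<beta> \<gamma>) \<and>
     (\<forall>\<alpha>\<in>L. \<epsilon> \<alpha> 0 = 1 \<and> \<epsilon> 0 \<alpha> = 1) \<and>
     (\<forall>\<alpha>\<in>L. \<forall>\<beta>\<in>L. \<epsilon> \<alpha> \<beta> = (-1) powi \<lfloor>ipH \<alpha> \<beta>\<rfloor> * \<epsilon> \<beta> \<alpha>)"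

definition C_fva :: "real \<Rightarrow> (H \<Rightarrow> H \<Rightarrow> complex) \<Rightarrow> (H \<times> bool monomial) fva" where
  "C_fva R \<epsilon> = \<lparr>carr = fock.fock_sum L, vac = fock.ev 0, Y = fock.Ytwist ipH (pR R) (BR R) \<epsilon>\<rparr>"

definition Heis_fva :: "real \<Rightarrow> (H \<times> bool monomial) fva" where
  "Heis_fva R = \<lparr>carr = fock.fock_sum {0}, vac = fock.ev 0, Y = fock.Yhat ipH (pR R) (BR R)\<rparr>"


lemma ipH_vR:
  assumes "R > 0"
  shows "ipH (vR R) (vR R) = 1" "ipH (vR R) (vbarR R) = 0" "ipH (vbarR R) (vR R) = 0"
    "ipH (vbarR R) (vbarR R) = -1"
  using assms by (simp_all add: ipH_def vR_def vbarR_def field_simps)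

lemma pR_vR:
  assumes "R > 0"
  shows "pR R (vR R) = vR R" "pR R (vbarR R) = 0"
  using ipH_vR[OF assms] by (simp_all add: pR_def)

lemma BR_orthonormal:
  assumes "R > 0"
  shows "fock.ipp ipH (pR R) (BR R k) (BR R l) = (if k = l then 1 else 0)"
  using ipH_vR[OF assms] pR_vR[OF assms]
  by (auto simp: BR_def fock.ipp_def fock.pbar_def) (simp_all add: ipH_def)


section \<open>Rank one lattice vertex algebras\<close>

text \<open>
  Here \<^typ>\<open>'h\<close> is \<^typ>\<open>real\<close> with the form $(s,t) = st$ and the projection is the identity.
  The form on $\sqrt{2N}\mathbb Z$ is even and the rank is one, so the two-cocycle of the lattice
  vertex algebra may be taken to be trivial, and $e_\alpha$ acts on the modules by
  $e_\beta \mapsto e_{\alpha+\beta}$ as well.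
\<close>

definition Y1 :: "(real, unit) state \<Rightarrow> ((real, unit) state, (real, unit) state) series" where
  "Y1 = fock.Yhat (*) (\<lambda>h. h) (\<lambda>_. 1)"

text \<open>$V_{\sqrt{2N}\mathbb Z + i/\sqrt{2N}}$\<close>

definition V_mod :: "nat \<Rightarrow> int \<Rightarrow> (real, unit) state set" where
  "V_mod N i = fock.fock_sum (range (\<lambda>k::int. sqrt (2 * N) * k + i / sqrt (2 * N)))"

definition V_fva :: "nat \<Rightarrow> (real \<times> unit monomial) fva" where
  "V_fva N = \<lparr>carr = fock.fock_sum (range (\<lambda>k::int. sqrt (2 * N) * k)), vac = fock.ev 0, Y = Y1\<rparr>"

text \<open>The representative in $\{0,\dots,2pq-1\}$ of $n_{p,q}$.\<close>

definition n_pq :: "nat \<Rightarrow> nat \<Rightarrow> int" where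
  "n_pq p q = (THE n. 0 \<le> n \<and> n < 2 * p * q \<and>
     (\<exists>a b::int. a * p - b * q = 1 \<and> [n = a * p + b * q] (mod (2 * p * q))))"

end

theory Submission
  imports Defs "HOL-Library.Disjoint_Sets" "HOL-Library.Multiset"
begin

text \<open>
  Over the reals, $H$ is the orthogonal sum of the lines $\mathbb R v_R$ and $\mathbb R \bar v_R$,
  where $\bar v_R$ spans the kernel of $p_R$.  Hence the Fock space of $H$ is the tensor product of two
  rank one Fock spaces, and $\hat Y(a \otimes b, \underline z) = Y(a, z) \otimes Y(b, \bar z)$ with
  rank one vertex operators on the right (\<open>Yhat_J2\<close>).  This reduces the analysis of the vertex
  operators to rank one.

  \<open>Yhat\<close> is specified through the inductive relation \<open>vop\<close>, which builds up a state in many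
  ways, so it must be shown that all of them give the same series.  In rank one the normal ordered
  products with the derivatives of the current commute (\<open>current_prod_commute\<close>), hence the
  series of $h(-n_1-1) \cdots h(-n_k-1) e_\alpha$ can be read off from the multiset of the $n_i$;
  the result, \<open>Yfold\<close>, obeys all the rules.  For $H$ the tensor products of the rank one
  operators (\<open>Ybox\<close>) obey all the rules.  For the operators of $e_\alpha$ this is the
  factorization of the exponential of a sum (\<open>h_Eser\<close>).

  For the kernels, let $D$ be the translation operator in rank one, on the sum of all the Fock
  modules.  From $[h(n+1), D] = (n+1) h(n)$ one sees by descending induction on $n$ that a vector
  killed by $D$ is killed by all $h(n)$ with $n \ge 0$, so $\ker D$ is spanned by the vacuum
  (\<open>D1_kernel\<close>).  In $C_R$ it follows that $\ker \bar D$ is the sum of the spaces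
  $M(s) \otimes \mathbf 1$ with $s v_R \in L$, and similarly $\ker D$ of the
  $\mathbf 1 \otimes M(t)$ with $t \bar v_R \in L$.  If $R^2$ is irrational then both lines
  meet $L$ in $0$ only and nothing but the Heisenberg algebra remains.  If $R^2 = p/q$ then both lines
  meet $L$ in a copy of $\sqrt{2pq}\,\mathbb Z$.

  What remains is the cocycle.  On the sublattice $L'$ generated by the two intersections it is a
  coboundary: on each axis by a recursion (\<open>rank_one_trivialization\<close>), and on $L'$ because
  orthogonal vectors commute in the twisted group algebra (\<open>eps_exchange\<close>).  Rescaling
  the $e_\alpha$ by the cochain \<open>eta\<close> identifies the tensor product of the kernels with the
  tensor product of the two rank one lattice algebras (\<open>fva_iso_phi\<close>).  As a module over it,
  $C_R$ is the sum of its parts with charges in the cosets of $L'$ in $L$.  Each of these is a tensor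
  product of irreducible modules, after another rescaling (\<open>coset_module\<close>).  Irreducibility
  holds because $h(0)$ and the $h(-n) h(n)$ are diagonal and separate the monomials, so that a
  nonzero submodule contains a monomial, and from a monomial every other one is reached by
  annihilating all oscillators, applying the $e_\alpha$ and creating oscillators
  (\<open>irreducible_bifock\<close>).  There are $2pq$ cosets of $L'$; the congruences that define
  $n_{p,q}$ say that the points $(i, n_{p,q} i) / \sqrt{2pq}$ represent them
  (\<open>base_in_L\<close>, \<open>L_decomposition\<close>).

  On the second line the coordinate is taken with respect to $-\bar v_R$, since with $\bar v_R$
  the second index would be $-n_{p,q} i$.  This is the origin of the signs \<open>sgn_deg\<close>.
\<close>

section \<open>Vectors with a basis and linear maps\<close>

abbreviation coef :: "('a \<Rightarrow>\<^sub>0 'b::zero) \<Rightarrow> 'a \<Rightarrow> 'b" where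
  "coef \<equiv> Poly_Mapping.lookup"

abbreviation supp :: "('a \<Rightarrow>\<^sub>0 'b::zero) \<Rightarrow> 'a set" where
  "supp \<equiv> Poly_Mapping.keys"

abbreviation single :: "'a \<Rightarrow> 'b \<Rightarrow> ('a \<Rightarrow>\<^sub>0 'b::zero)" where
  "single \<equiv> Poly_Mapping.single"

lemma clinear_iff:
  "clinear f \<longleftrightarrow> (\<forall>u v. f (u + v) = f u + f v) \<and> (\<forall>c u. f (scale c u) = scale c (f u))"
  by (simp add: Vector_Spaces.linear_iff cvs.vector_space_axioms)

lemma clinearI:
  "(\<And>u v. f (u + v) = f u + f v) \<Longrightarrow> (\<And>c u. f (scale c u) = scale c (f u)) \<Longrightarrow> clinear f"
  by (simp add: clinear_iff)

lemma clinear_add: "clinear f \<Longrightarrow> f (u + v) = f u + f v"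
  and clinear_scale: "clinear f \<Longrightarrow> f (scale c u) = scale c (f u)"
  by (auto simp: clinear_iff)

lemma clinear_zero: "clinear f \<Longrightarrow> f 0 = 0"
  using clinear_scale[of f 0 0] by simp

lemma clinear_sum: "clinear f \<Longrightarrow> f (\<Sum>a\<in>A. g a) = (\<Sum>a\<in>A. f (g a))"
  by (induction A rule: infinite_finite_induct) (auto simp: clinear_zero clinear_add)

lemma clinear_Sum_any:
  assumes "clinear f" "finite {a. g a \<noteq> 0}"
  shows "f (Sum_any g) = Sum_any (\<lambda>a. f (g a))"
proof -
  have "{a. f (g a) \<noteq> 0} \<subseteq> {a. g a \<noteq> 0}"
    using assms(1) by (auto simp: clinear_zero)
  then show ?thesis
    by (simp add: Sum_any.expand_superset[OF assms(2)] clinear_sum[OF assms(1)])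
qed

lemma clinear_id: "clinear (\<lambda>v. v)"
  and clinear_zero_fun: "clinear (\<lambda>v. 0)"
  and clinear_compose: "clinear f \<Longrightarrow> clinear g \<Longrightarrow> clinear (\<lambda>v. f (g v))"
  and clinear_plus: "clinear f \<Longrightarrow> clinear f' \<Longrightarrow> clinear (\<lambda>v. f v + f' v)"
  and clinear_scaled: "clinear f \<Longrightarrow> clinear (\<lambda>v. scale c (f v))"
  by (auto simp: clinear_iff cvs.scale_right_distrib ac_simps)

lemma clinear_sum_fun: "(\<And>a. a \<in> A \<Longrightarrow> clinear (f a)) \<Longrightarrow> clinear (\<lambda>v. \<Sum>a\<in>A. f a v)"
  by (induction A rule: infinite_finite_induct) (auto simp: clinear_zero_fun clinear_plus)

lemma clinear_Sum_any_fun: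
  assumes "\<And>a. clinear (f a)" "\<And>v. finite {a. f a v \<noteq> 0}"
  shows "clinear (\<lambda>v. Sum_any (\<lambda>a. f a v))"
  by (rule clinearI)
    (simp_all add: clinear_add[OF assms(1)] clinear_scale[OF assms(1)] Sum_any.distrib assms(2)
      clinear_Sum_any[OF clinear_scaled[OF clinear_id] assms(2), symmetric])

lemma scale_eq_single_times: "scale c v = single 0 c * v"
  for v :: "'a::monoid_add \<Rightarrow>\<^sub>0 complex"
  by (simp add: scale_def mult_map_scale_conv_mult)

lemma clinear_times: "clinear (\<lambda>v. a * v)" for a :: "'a::comm_monoid_add \<Rightarrow>\<^sub>0 complex"
  by (rule clinearI) (simp_all add: distrib_left scale_eq_single_times mult.left_commute)

lemma lin_superset:
  assumes "finite A" "supp v \<subseteq> A"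
  shows "lin f v = (\<Sum>i\<in>A. scale (coef v i) (f i))"
  unfolding lin_def using assms
  by (intro sum.mono_neutral_left) (auto simp: in_keys_iff)

lemma clinear_lin: "clinear (lin f)"
proof (rule clinearI)
  fix u v :: "'a \<Rightarrow>\<^sub>0 complex" and c
  let ?A = "supp u \<union> supp v"
  have "supp (u + v) \<subseteq> ?A" by (rule keys_add)
  then show "lin f (u + v) = lin f u + lin f v"
    by (simp add: lin_superset[of ?A] lookup_add cvs.scale_left_distrib sum.distrib)
  have "supp (scale c u) \<subseteq> supp u"
    by (auto simp: in_keys_iff)
  then show "lin f (scale c u) = scale c (lin f u)"
    by (simp add: lin_superset[of "supp u"] cvs.scale_sum_right)
qed

lemmas lin_scale = clinear_scale[OF clinear_lin]
  and lin_zero [simp] = clinear_zero[OF clinear_lin]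

lemma lin_bas [simp]: "lin f (bas i) = f i"
  by (simp add: lin_def)

lemma lin_cong: "(\<And>i. i \<in> supp v \<Longrightarrow> f i = g i) \<Longrightarrow> lin f v = lin g v"
  by (simp add: lin_def)

lemma lookup_lin:
  "coef (lin f v) x = (\<Sum>i\<in>supp v. coef v i * coef (f i) x)"
  by (simp add: lin_def lookup_sum)

lemma sum_keys_delta:
  "(\<Sum>i\<in>supp v. coef v i * (if i = k then c else 0)) =
    (coef v k * c :: complex)"
proof -
  have "(\<Sum>i\<in>supp v. coef v i * (if i = k then c else 0)) =
      (\<Sum>i\<in>supp v. if i = k then coef v i * c else 0)"
    by (intro sum.cong) auto
  also have "\<dots> = coef v k * c"
    by (simp add: sum.delta in_keys_iff)
  finally show ?thesis .
qed

lemma lin_bas_id: "lin bas v = v"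
  by (rule poly_mapping_eqI) (simp add: lookup_lin lookup_single when_def sum_keys_delta)

lemma lookup_lin_diagonal:
  "coef (lin (\<lambda>x. scale (c x) (bas x)) v) z = c z * coef v z"
proof -
  have "coef (lin (\<lambda>x. scale (c x) (bas x)) v) z =
      (\<Sum>i\<in>supp v. coef v i * (if i = z then c z else 0))"
    unfolding lookup_lin by (intro sum.cong) (auto simp: lookup_single when_def)
  then show ?thesis by (simp add: sum_keys_delta)
qed

lemma clinear_eq_lin:
  assumes "clinear f"
  shows "f v = lin (\<lambda>i. f (bas i)) v"
proof -
  have "f v = f (lin bas v)" by (simp add: lin_bas_id)
  then show ?thesis
    by (simp add: lin_def clinear_sum[OF assms] clinear_scale[OF assms])
qed

lemma clinear_eqI:
  assumes "clinear f" "clinear g" "\<And>i. i \<in> supp v \<Longrightarrow> f (bas i) = g (bas i)"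
  shows "f v = g v"
  unfolding clinear_eq_lin[OF assms(1), of v] clinear_eq_lin[OF assms(2), of v]
  using assms(3) by (rule lin_cong)

lemma vec_induct [case_names zero add bas]:
  assumes "P 0" "\<And>u v. P u \<Longrightarrow> P v \<Longrightarrow> P (u + v)" "\<And>c i. P (scale c (bas i))"
  shows "P v"
proof -
  have "P (\<Sum>i\<in>A. scale (coef v i) (bas i))" if "finite A" for A
    using that by induction (auto intro: assms)
  from this[OF finite_keys[of v]] show ?thesis
    by (simp flip: lin_def add: lin_bas_id)
qed

text \<open>
  All the spaces of states below (Fock sums, kernels, modules) are spanned by basis vectors, so they are
  of the form \<open>supp_on S\<close> and statements about them become statements about index sets.
\<close>

definition supp_on :: "'i set \<Rightarrow> ('i \<Rightarrow>\<^sub>0 complex) set" where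
  "supp_on S = {v. supp v \<subseteq> S}"

lemma supp_on_iff: "v \<in> supp_on S \<longleftrightarrow> (\<forall>x. x \<notin> S \<longrightarrow> coef v x = 0)"
  by (auto simp: supp_on_def in_keys_iff)

lemma bas_in_supp_on [simp]: "bas x \<in> supp_on S \<longleftrightarrow> x \<in> S"
  by (simp add: supp_on_def)

lemma subspace_supp_on: "cvs.subspace (supp_on S)"
  by (rule cvs.subspaceI) (auto simp: supp_on_iff lookup_add)

lemma subspace_Sum_any: "cvs.subspace V \<Longrightarrow> (\<And>a. f a \<in> V) \<Longrightarrow> Sum_any f \<in> V"
  by (simp add: Sum_any.expand_set cvs.subspace_sum)

lemma clinear_image_supp_on:
  assumes "clinear f" "cvs.subspace V" "v \<in> supp_on S" "\<And>x. x \<in> S \<Longrightarrow> f (bas x) \<in> V"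
  shows "f v \<in> V"
  unfolding clinear_eq_lin[OF assms(1), of v] lin_def
  using assms(2-4) by (auto intro!: cvs.subspace_sum cvs.subspace_scale simp: supp_on_def)

lemma supp_on_subset_subspace:
  assumes "cvs.subspace V" "\<And>x. x \<in> S \<Longrightarrow> bas x \<in> V"
  shows "supp_on S \<subseteq> V"
  using clinear_image_supp_on[OF clinear_id assms(1) _ assms(2)] by auto

lemma lookup_tens: "coef (tens u v) (i, j) = coef u i * coef v j"
proof -
  have 1: "coef (lin (\<lambda>j. bas (i', j)) v) (i, j) = (if i' = i then coef v j else 0)" for i'
    by (cases "i' = i") (simp_all add: lookup_lin lookup_single when_def sum_keys_delta)
  show ?thesis
    unfolding tens_def lookup_lin[of _ u] 1 by (rule sum_keys_delta)
qed

lemma tens_add_left: "tens (u + u') v = tens u v + tens u' v"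
  and tens_add_right: "tens u (v + v') = tens u v + tens u v'"
  and tens_scale_left: "tens (scale c u) v = scale c (tens u v)"
  and tens_scale_right: "tens u (scale c v) = scale c (tens u v)"
  and tens_zero_left [simp]: "tens 0 v = 0"
  and tens_zero_right [simp]: "tens u 0 = 0"
  and tens_bas [simp]: "tens (bas i) (bas j) = bas (i, j)"
  by (auto intro!: poly_mapping_eqI simp: lookup_tens lookup_add algebra_simps lookup_single when_def)

lemma clinear_tens_left: "clinear (\<lambda>u. tens u v)"
  and clinear_tens_right: "clinear (\<lambda>v. tens u v)"
  by (auto intro!: clinearI simp: tens_add_left tens_add_right tens_scale_left tens_scale_right)

lemma tens_in_supp_on: "u \<in> supp_on A \<Longrightarrow> v \<in> supp_on B \<Longrightarrow> tens u v \<in> supp_on (A \<times> B)"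
  by (auto simp: supp_on_iff lookup_tens)

lemma tens_space_supp_on: "tens_space (supp_on A) (supp_on B) = supp_on (A \<times> B)"
proof
  show "tens_space (supp_on A) (supp_on B) \<subseteq> supp_on (A \<times> B)"
    unfolding tens_space_def by (rule cvs.span_minimal) (auto simp: tens_in_supp_on subspace_supp_on)
  show "supp_on (A \<times> B) \<subseteq> tens_space (supp_on A) (supp_on B)"
    unfolding tens_space_def
  proof (rule supp_on_subset_subspace[OF cvs.subspace_span])
    fix x assume "x \<in> A \<times> B"
    then obtain i j where "x = (i, j)" "i \<in> A" "j \<in> B" by auto
    then have "bas x = tens (bas i) (bas j)" "bas i \<in> supp_on A" "bas j \<in> supp_on B" by auto
    then show "bas x \<in> cvs.span {tens u v |u v. u \<in> supp_on A \<and> v \<in> supp_on B}"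
      by (intro cvs.span_base) blast
  qed
qed

lemma bilin_eqI:
  assumes "\<And>v. clinear (\<lambda>u. f u v)" "\<And>u. clinear (f u)" "\<And>v. clinear (\<lambda>u. g u v)" "\<And>u. clinear (g u)"
    and "\<And>i j. i \<in> supp u \<Longrightarrow> j \<in> supp v \<Longrightarrow> f (bas i) (bas j) = g (bas i) (bas j)"
  shows "f u v = g u v"
  by (rule clinear_eqI[OF assms(1,3)]) (rule clinear_eqI[OF assms(2,4)], simp add: assms(5))

text \<open>
  Every isomorphism constructed below is of this kind: it matches two bases up to scalars, which come
  from the cocycle and from the choice of signs.
\<close>

definition monomial_map :: "('i \<Rightarrow> complex) \<Rightarrow> ('i \<Rightarrow> 'j) \<Rightarrow> ('i \<Rightarrow>\<^sub>0 complex) \<Rightarrow> ('j \<Rightarrow>\<^sub>0 complex)" where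
  "monomial_map c h = lin (\<lambda>x. scale (c x) (bas (h x)))"

lemma clinear_monomial_map: "clinear (monomial_map c h)"
  by (simp add: monomial_map_def clinear_lin)

lemma monomial_map_bas [simp]: "monomial_map c h (bas x) = scale (c x) (bas (h x))"
  by (simp add: monomial_map_def)

lemma bij_betw_monomial_map:
  assumes "inj_on h S" "\<And>x. x \<in> S \<Longrightarrow> c x \<noteq> 0"
  shows "bij_betw (monomial_map c h) (supp_on S) (supp_on (h ` S))"
proof -
  let ?g = "monomial_map (\<lambda>y. 1 / c (inv_into S h y)) (inv_into S h)"
  have 1: "?g (monomial_map c h v) = v" if "v \<in> supp_on S" for v
    by (rule clinear_eqI[OF clinear_compose[OF clinear_monomial_map clinear_monomial_map] clinear_id])
      (use that in \<open>auto simp: supp_on_def clinear_scale[OF clinear_monomial_map] inv_into_f_f[OF assms(1)] assms(2) subset_iff\<close>)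
  have 2: "monomial_map c h (?g w) = w" if "w \<in> supp_on (h ` S)" for w
  proof (rule clinear_eqI[OF clinear_compose[OF clinear_monomial_map clinear_monomial_map] clinear_id])
    fix i assume "i \<in> supp w"
    then have "i \<in> h ` S" using that by (auto simp: supp_on_def)
    then obtain x where "i = h x" "x \<in> S" by blast
    then show "monomial_map c h (?g (bas i)) = bas i"
      using assms(2)[of x] by (simp add: clinear_scale[OF clinear_monomial_map] inv_into_f_f[OF assms(1)])
  qed
  show ?thesis
  proof (rule bij_betw_byWitness[where f' = ?g])
    show "monomial_map c h ` supp_on S \<subseteq> supp_on (h ` S)"
      by (rule image_subsetI, rule clinear_image_supp_on[OF clinear_monomial_map subspace_supp_on])
        (auto intro: cvs.subspace_scale[OF subspace_supp_on])
    show "?g ` supp_on (h ` S) \<subseteq> supp_on S"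
      by (rule image_subsetI, rule clinear_image_supp_on[OF clinear_monomial_map subspace_supp_on])
        (auto intro!: cvs.subspace_scale[OF subspace_supp_on] simp: inv_into_f_f[OF assms(1)])
  qed (use 1 2 in blast)+
qed

text \<open>
  A subspace stable under diagonal operators with jointly distinct eigenvalues contains the
  basis vectors occurring in its elements: subtracting an eigenvalue from such an operator removes another
  basis vector from \<open>v\<close> without removing \<open>x\<close>.
\<close>

lemma supp_on_diagonal:
  assumes W: "cvs.subspace W"
    and lin: "\<And>a. clinear (D a)" and inv: "\<And>a w. w \<in> W \<Longrightarrow> D a w \<in> W"
    and diag: "\<And>a x. D a (bas x) = scale (ew a x) (bas x)"
    and sep: "\<And>x y. x \<noteq> y \<Longrightarrow> \<exists>a. ew a x \<noteq> ew a y"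
    and "v \<in> W" "x \<in> supp v"
  shows "bas x \<in> W"
  using assms(6,7)
proof (induction "card (supp v)" arbitrary: v rule: less_induct)
  case less
  have lookup_D: "coef (D a w) z = ew a z * coef w z" for a w z
    unfolding clinear_eq_lin[OF lin, of a w] diag by (rule lookup_lin_diagonal)
  show ?case
  proof (cases "\<exists>y\<in>supp v. y \<noteq> x")
    case True
    then obtain y where y: "y \<in> supp v" "y \<noteq> x" by blast
    then obtain a where a: "ew a x \<noteq> ew a y" using sep by metis
    define w where "w = D a v - scale (ew a y) v"
    have lw: "coef w z = (ew a z - ew a y) * coef v z" for z
      by (simp add: w_def lookup_minus lookup_D algebra_simps)
    have "supp w \<subset> supp v"
      using y by (auto simp: in_keys_iff lw)
    then have "card (supp w) < card (supp v)"
      by (intro psubset_card_mono) auto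
    moreover have "w \<in> W" unfolding w_def
      using less.prems by (intro cvs.subspace_diff[OF W] cvs.subspace_scale[OF W] inv)
    moreover have "x \<in> supp w"
      using less.prems a by (auto simp: in_keys_iff lw)
    ultimately show ?thesis by (rule less.hyps)
  next
    case False
    then have "v = scale (coef v x) (bas x)"
      by (auto intro!: poly_mapping_eqI simp: lookup_single when_def in_keys_iff)
    then have "bas x = scale (1 / coef v x) v"
      using less.prems by (metis cvs.scale_one cvs.scale_scale in_keys_iff nonzero_eq_divide_eq)
    then show ?thesis using less.prems cvs.subspace_scale[OF W] by metis
  qed
qed

lemma direct_sum_decomp_supp_on:
  fixes S :: "'a \<Rightarrow> 'b set"
  assumes "finite I" "disjoint_family_on S I"
  shows "direct_sum_decomp (supp_on (\<Union>i\<in>I. S i)) I (\<lambda>i. supp_on (S i))"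
proof -
  define rest where "rest A = lin (\<lambda>x. if x \<in> A then bas x else 0)" for A :: "'b set"
  have rest: "coef (rest A v) x = (if x \<in> A then coef v x else 0)" for A v x
    unfolding rest_def
      using lookup_lin_diagonal[of "\<lambda>x. if x \<in> A then 1 else 0" v x]
    by (simp add: if_distrib[of "\<lambda>c. scale c _"] cong: if_cong)
  have disj: "x \<in> S i \<Longrightarrow> x \<in> S j \<Longrightarrow> i \<in> I \<Longrightarrow> j \<in> I \<Longrightarrow> i = j" for x i j
    using assms(2) by (auto simp: disjoint_family_on_def)
  have "bij_betw (\<lambda>w. \<Sum>i\<in>I. w i) (Pi\<^sub>E I (\<lambda>i. supp_on (S i))) (supp_on (\<Union>i\<in>I. S i))"
  proof (rule bij_betw_byWitness[where f' = "\<lambda>v. \<lambda>i\<in>I. rest (S i) v"], safe)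
    fix w assume w: "w \<in> Pi\<^sub>E I (\<lambda>i. supp_on (S i))"
    then have wz: "coef (w i) x = 0" if "i \<in> I" "x \<notin> S i" for i x
      using that by (auto simp: PiE_iff supp_on_iff)
    show "(\<lambda>i\<in>I. rest (S i) (\<Sum>j\<in>I. w j)) = w"
    proof (rule PiE_ext[OF _ w])
      show "(\<lambda>i\<in>I. rest (S i) (\<Sum>j\<in>I. w j)) \<in> Pi\<^sub>E I (\<lambda>i. supp_on (S i))"
        by (auto simp: supp_on_iff rest)
      fix i assume i: "i \<in> I"
      have "coef (rest (S i) (\<Sum>j\<in>I. w j)) x = coef (w i) x" for x
      proof (cases "x \<in> S i")
        case True
        then have "(\<Sum>j\<in>I. coef (w j) x) = (\<Sum>j\<in>I. if j = i then coef (w j) x else 0)"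
        proof (intro sum.cong refl)
          fix j assume j: "j \<in> I"
          show "coef (w j) x = (if j = i then coef (w j) x else 0)"
            using wz[OF j, of x] disj[OF True _ i j] by auto
        qed
        then show ?thesis using True i assms(1) by (simp add: rest lookup_sum sum.delta)
      qed (simp add: rest wz[OF i])
      then show "(\<lambda>i\<in>I. rest (S i) (\<Sum>j\<in>I. w j)) i = w i"
        using i by (auto intro!: poly_mapping_eqI)
    qed
  next
    fix v assume v: "v \<in> supp_on (\<Union>i\<in>I. S i)"
    have "(\<Sum>i\<in>I. coef (rest (S i) v) x) = coef v x" for x
    proof (cases "\<exists>i\<in>I. x \<in> S i")
      case True
      then obtain i where i: "i \<in> I" "x \<in> S i" by blast
      then have "(\<Sum>j\<in>I. coef (rest (S j) v) x) = (\<Sum>j\<in>I. if j = i then coef v x else 0)"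
      proof (intro sum.cong refl)
        fix j assume j: "j \<in> I"
        show "coef (rest (S j) v) x = (if j = i then coef v x else 0)"
        proof (cases "j = i")
          case False
          then have "x \<notin> S j" using disj i j by blast
          then show ?thesis using False by (simp add: rest)
        qed (simp add: rest i)
      qed
      then show ?thesis using i assms(1) by (simp add: sum.delta)
    qed (use v in \<open>auto simp: rest supp_on_iff\<close>)
    then show "(\<Sum>i\<in>I. (\<lambda>i\<in>I. rest (S i) v) i) = v"
      by (auto intro!: poly_mapping_eqI simp: lookup_sum)
  next
    fix w assume "w \<in> Pi\<^sub>E I (\<lambda>i. supp_on (S i))"
    then show "(\<Sum>i\<in>I. w i) \<in> supp_on (\<Union>i\<in>I. S i)"
      by (intro cvs.subspace_sum[OF subspace_supp_on]) (auto simp: PiE_iff supp_on_iff)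
  qed (auto simp: supp_on_iff rest)
  then show ?thesis by (simp add: direct_sum_decomp_def subspace_supp_on)
qed

section \<open>Transport of isomorphisms and irreducibility\<close>

lemma fva_isoI:
  assumes "clinear f" "bij_betw f (carr A) (carr A')" "f (vac A) = vac A'"
    and cl: "closed_under (carr A) (Y A) (carr A)"
    and Y: "\<And>a b r s. a \<in> carr A \<Longrightarrow> b \<in> carr A \<Longrightarrow> f (Y A a r s b) = Y A' (f a) r s (f b)"
  shows "fva_iso f A A'"
proof -
  have "carr A' = f ` carr A" using assms(2) by (simp add: bij_betw_def)
  then have "closed_under (carr A') (Y A') (carr A')"
    using cl by (auto simp: closed_under_def Y[symmetric])
  then show ?thesis using assms by (simp add: fva_iso_def)
qed

text \<open>
  An isomorphism has to be given by a linear map of the ambient spaces, so the inverse of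
  \<open>f\<close> on \<open>carr A'\<close> must be extended linearly.
\<close>

lemma isomorphic_fva_sym:
  assumes "isomorphic_fva A A'" "cvs.subspace (carr A)" "vac A \<in> carr A"
  shows "isomorphic_fva A' A"
proof -
  interpret pair: vector_space_pair "scale :: complex \<Rightarrow> ('a \<Rightarrow>\<^sub>0 complex) \<Rightarrow> _"
      "scale :: complex \<Rightarrow> ('b \<Rightarrow>\<^sub>0 complex) \<Rightarrow> _" ..
  obtain f where f: "fva_iso f A A'" using assms(1) by (auto simp: isomorphic_fva_def)
  then have lin: "clinear f" and bij: "bij_betw f (carr A) (carr A')" by (auto simp: fva_iso_def)
  then obtain g where g: "clinear g" "\<And>v. v \<in> carr A \<Longrightarrow> g (f v) = v"
    using pair.linear_exists_left_inverse_on[OF lin assms(2)] by (auto simp: bij_betw_def)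
  have img: "carr A' = f ` carr A" using bij by (simp add: bij_betw_def)
  have "bij_betw g (carr A') (carr A)"
    by (rule bij_betw_byWitness[where f' = f]) (auto simp: img g)
  moreover have "g (Y A' (f a) r s (f b)) = Y A a r s b" if "a \<in> carr A" "b \<in> carr A" for a b r s
    using f that g(2) by (metis closed_under_def fva_iso_def)
  moreover have "g (vac A') = vac A" using f g(2)[OF assms(3)] by (simp add: fva_iso_def)
  ultimately have "fva_iso g A' A"
    using f g by (auto simp: fva_iso_def img)
  then show ?thesis by (auto simp: isomorphic_fva_def)
qed

lemma isomorphic_fva_trans:
  assumes "isomorphic_fva A A'" "isomorphic_fva A' A''"
  shows "isomorphic_fva A A''"
proof -
  obtain f g where f: "fva_iso f A A'" and g: "fva_iso g A' A''"
    using assms by (auto simp: isomorphic_fva_def)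
  have "fva_iso (\<lambda>v. g (f v)) A A''"
  proof (rule fva_isoI)
    show "bij_betw (\<lambda>v. g (f v)) (carr A) (carr A'')"
      using bij_betw_trans[of f "carr A" "carr A'" g "carr A''"] f g by (simp add: fva_iso_def comp_def)
    fix a b r s assume "a \<in> carr A" "b \<in> carr A"
    then show "g (f (Y A a r s b)) = Y A'' (g (f a)) r s (g (f b))"
      using f g bij_betwE[of f "carr A" "carr A'"] by (simp add: fva_iso_def)
  qed (use f g in \<open>auto simp: fva_iso_def intro: clinear_compose\<close>)
  then show ?thesis by (auto simp: isomorphic_fva_def)
qed

lemma module_isoI:
  assumes "clinear f" "bij_betw f W W'" and cl: "closed_under U act W"
    and Y: "\<And>u w r s. u \<in> U \<Longrightarrow> w \<in> W \<Longrightarrow> f (act u r s w) = act' (\<phi> u) r s (f w)"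
  shows "module_iso f U \<phi> act W act' W'"
proof -
  have "W' = f ` W" using assms(2) by (simp add: bij_betw_def)
  then have "closed_under (\<phi> ` U) act' W'"
    using cl by (auto simp: closed_under_def Y[symmetric])
  then show ?thesis using assms by (simp add: module_iso_def)
qed

text \<open>
  The preimage of a submodule under the isomorphism is a submodule of the irreducible module.
\<close>

lemma irreducible_module_transport:
  assumes iso: "module_iso f U \<phi> act W act' W'" and irr: "irreducible_module U act W"
  shows "irreducible_module (\<phi> ` U) act' W'"
proof -
  have lin: "clinear f" and bij: "bij_betw f W W'"
    and Y: "\<And>u w r s. u \<in> U \<Longrightarrow> w \<in> W \<Longrightarrow> f (act u r s w) = act' (\<phi> u) r s (f w)"
    and cl: "closed_under U act W" "closed_under (\<phi> ` U) act' W'"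
    using iso by (auto simp: module_iso_def)
  have W: "cvs.subspace W" "W \<noteq> {0}" using irr by (auto simp: irreducible_module_def submodule_of_def)
  have img: "W' = f ` W" and inj: "inj_on f W" using bij by (auto simp: bij_betw_def)
  have "cvs.subspace W'"
  proof (rule cvs.subspaceI)
    show "0 \<in> W'" using cvs.subspace_0[OF W(1)] clinear_zero[OF lin] by (force simp: img)
  next
    fix x y assume "x \<in> W'" "y \<in> W'"
    then show "x + y \<in> W'"
      unfolding img using cvs.subspace_add[OF W(1)] by (force simp flip: clinear_add[OF lin])
  next
    fix c x assume "x \<in> W'"
    then show "scale c x \<in> W'"
      unfolding img using cvs.subspace_scale[OF W(1)] by (force simp flip: clinear_scale[OF lin])
  qed
  then have sub: "submodule_of (\<phi> ` U) act' W' W'" using cl by (simp add: submodule_of_def)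
  have "W' \<noteq> {0}"
  proof
    assume "W' = {0}"
    then have "\<forall>w\<in>W. f w = f 0" unfolding img using clinear_zero[OF lin] by auto
    then have "\<forall>w\<in>W. w = 0" using inj cvs.subspace_0[OF W(1)] by (auto dest: inj_onD)
    then show False using W by (auto dest: cvs.subspace_0)
  qed
  moreover have "V' = {0} \<or> V' = W'" if V': "submodule_of (\<phi> ` U) act' V' W'" for V'
  proof -
    define V where "V = {w \<in> W. f w \<in> V'}"
    have sV': "cvs.subspace V'" and V'W': "V' \<subseteq> W'" and clV': "closed_under (\<phi> ` U) act' V'"
      using V' by (auto simp: submodule_of_def)
    have "cvs.subspace V"
      unfolding V_def using W(1) sV'
      by (intro cvs.subspaceI)
        (auto simp: cvs.subspace_0 cvs.subspace_add cvs.subspace_scale clinear_zero[OF lin]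
          clinear_add[OF lin] clinear_scale[OF lin])
    moreover have "closed_under U act V"
      using cl(1) clV' Y by (auto simp: closed_under_def V_def)
    ultimately have "V = {0} \<or> V = W"
      using irr by (auto simp: irreducible_module_def submodule_of_def V_def)
    moreover have "V' = f ` V" using V'W' by (auto simp: V_def img)
    ultimately show ?thesis by (auto simp: img clinear_zero[OF lin])
  qed
  ultimately show ?thesis using sub by (auto simp: irreducible_module_def)
qed

section \<open>Classes of formal series\<close>
lemma Sum_any_reindex_inj:
  assumes "inj h" "\<And>x. g x \<noteq> 0 \<Longrightarrow> x \<in> range h"
  shows "Sum_any g = Sum_any (\<lambda>m. g (h m))"
proof -
  have "{x. g x \<noteq> 0} = h ` {m. g (h m) \<noteq> 0}" using assms(2) by auto
  then show ?thesis
    using inj_on_subset[OF assms(1) subset_UNIV]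
    by (simp add: Sum_any.expand_set sum.reindex)
qed

lemma Sum_any_finite:
  fixes f :: "nat \<Rightarrow> 'a::comm_monoid_add"
  assumes "\<And>m. m > n \<Longrightarrow> f m = 0"
  shows "Sum_any f = (\<Sum>m\<le>n. f m)"
  by (rule Sum_any.expand_superset) (use assms not_le in auto)

text \<open>
  A product \<open>F \<star> G\<close> is meaningful if each of its coefficients is a finite sum.
  Creation operators give \<open>pos_ser\<close>, annihilation operators and the powers
  $z^{p\alpha} \bar z^{\bar p\alpha}$ give \<open>fin_ser\<close>, and vertex operators give
  \<open>field_ser\<close> (on each vector, the exponents are bounded below in finitely many classes modulo
  $\mathbb Z^2$).  These classes suffice, since creation operators are multiplied to a field from the left and
  annihilation operators from the right.
\<close>

definition lin_ser :: "('i \<Rightarrow>\<^sub>0 complex, 'j \<Rightarrow>\<^sub>0 complex) series \<Rightarrow> bool" where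
  "lin_ser F \<longleftrightarrow> (\<forall>r s. clinear (F r s))"

definition pos_ser :: "('v, 'w::zero) series \<Rightarrow> bool" where
  "pos_ser F \<longleftrightarrow> (\<forall>r s v. F r s v \<noteq> 0 \<longrightarrow> r \<in> \<nat> \<and> s \<in> \<nat>)"

definition fin_ser :: "('v, 'w::zero) series \<Rightarrow> bool" where
  "fin_ser F \<longleftrightarrow> (\<forall>v. finite {(r, s). F r s v \<noteq> 0})"

definition field_ser :: "('v, 'w::zero) series \<Rightarrow> bool" where
  "field_ser F \<longleftrightarrow> (\<forall>v. \<exists>S. finite S \<and>
     (\<forall>r s. F r s v \<noteq> 0 \<longrightarrow> (\<exists>(r0, s0)\<in>S. r - r0 \<in> \<nat> \<and> s - s0 \<in> \<nat>)))"

definition hol_ser :: "('v, 'w::zero) series \<Rightarrow> bool" where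
  "hol_ser F \<longleftrightarrow> (\<forall>r s v. F r s v \<noteq> 0 \<longrightarrow> s = 0)"

text \<open>
  \<open>Sum_any\<close> is $0$ on sums with infinitely many nonzero terms; hence the algebraic laws for
  products are proved under this assumption.
\<close>

definition sprod_fin :: "('v, 'w::zero) series \<Rightarrow> ('u, 'v) series \<Rightarrow> bool" where
  "sprod_fin F G \<longleftrightarrow> (\<forall>r s v. finite {(r', s'). F (r - r') (s - s') (G r' s' v) \<noteq> 0})"

lemma sprod_fin_iff:
  "sprod_fin F G \<longleftrightarrow> (\<forall>r s v. finite {a. (case a of (r', s') \<Rightarrow> F (r - r') (s - s') (G r' s' v)) \<noteq> 0})"
proof -
  have "{a. (case a of (r', s') \<Rightarrow> F (r - r') (s - s') (G r' s' v)) \<noteq> 0} =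
      {(r', s'). F (r - r') (s - s') (G r' s' v) \<noteq> 0}" for r s v
    by auto
  then show ?thesis by (simp add: sprod_fin_def)
qed

lemma lin_serD: "lin_ser F \<Longrightarrow> clinear (F r s)"
  by (simp add: lin_ser_def)

lemma lin_ser_zero [simp]: "lin_ser F \<Longrightarrow> F r s 0 = 0"
  using clinear_zero[OF lin_serD] .

lemma sprod_nonzeroE:
  assumes "(F \<star> G) r s v \<noteq> 0"
  obtains r' s' where "F (r - r') (s - s') (G r' s' v) \<noteq> 0"
proof -
  from assms obtain a where "(case a of (r', s') \<Rightarrow> F (r - r') (s - s') (G r' s' v)) \<noteq> 0"
    unfolding sprod_def by (rule Sum_any.not_neutral_obtains_not_neutral)
  then show ?thesis using that by (cases a) auto
qed

lemma finite_nat_steps_between: "finite {x::real. x - a \<in> \<nat> \<and> b - x \<in> \<nat>}"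
proof (rule finite_subset)
  show "{x. x - a \<in> \<nat> \<and> b - x \<in> \<nat>} \<subseteq> (\<lambda>n::nat. a + n) ` {..nat \<lfloor>b - a\<rfloor>}"
  proof safe
    fix x assume "x - a \<in> \<nat>" "b - x \<in> \<nat>"
    then obtain m n :: nat where "x = a + m" "b - x = n" by (auto elim!: Nats_cases simp: algebra_simps)
    then show "x \<in> (\<lambda>n::nat. a + n) ` {..nat \<lfloor>b - a\<rfloor>}"
      by (intro image_eqI[of _ _ m]) (auto simp: le_nat_floor)
  qed
qed simp

lemma pos_imp_field: "pos_ser F \<Longrightarrow> field_ser F"
  unfolding pos_ser_def field_ser_def by (intro allI exI[of _ "{(0, 0)}"]) auto

lemma fin_imp_field: "fin_ser F \<Longrightarrow> field_ser F"
  unfolding fin_ser_def field_ser_def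
  by (intro allI) (rule_tac x = "{(r, s). F r s v \<noteq> 0}" in exI, force)

lemma sprod_fin_fin: "lin_ser F \<Longrightarrow> fin_ser G \<Longrightarrow> sprod_fin F G"
  unfolding sprod_fin_def
proof (intro allI)
  fix r s v assume "lin_ser F" "fin_ser G"
  then have "{(r', s'). F (r - r') (s - s') (G r' s' v) \<noteq> 0} \<subseteq> {(r', s'). G r' s' v \<noteq> 0}"
    by auto
  then show "finite {(r', s'). F (r - r') (s - s') (G r' s' v) \<noteq> 0}"
    by (rule finite_subset) (use \<open>fin_ser G\<close> in \<open>simp add: fin_ser_def\<close>)
qed

lemma sprod_fin_pos_field:
  assumes "lin_ser F" "pos_ser F" "field_ser G" shows "sprod_fin F G"
  unfolding sprod_fin_def
proof (intro allI)
  fix r s v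
  obtain S where S: "finite S" "\<And>r s. G r s v \<noteq> 0 \<Longrightarrow> \<exists>(r0, s0)\<in>S. r - r0 \<in> \<nat> \<and> s - s0 \<in> \<nat>"
    using assms(3) unfolding field_ser_def by meson
  have "{(r', s'). F (r - r') (s - s') (G r' s' v) \<noteq> 0} \<subseteq>
      (\<Union>(r0, s0)\<in>S. {x. x - r0 \<in> \<nat> \<and> r - x \<in> \<nat>} \<times> {x. x - s0 \<in> \<nat> \<and> s - x \<in> \<nat>})"
  proof safe
    fix r' s' assume nz: "F (r - r') (s - s') (G r' s' v) \<noteq> 0"
    then have "r - r' \<in> \<nat>" "s - s' \<in> \<nat>" using assms(2) by (auto simp: pos_ser_def)
    moreover have "G r' s' v \<noteq> 0" using nz assms(1) by auto
    ultimately show "(r', s') \<in> (\<Union>(r0, s0)\<in>S. {x. x - r0 \<in> \<nat> \<and> r - x \<in> \<nat>} \<times> {x. x - s0 \<in> \<nat> \<and> s - x \<in> \<nat>})"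
      using S(2)[of r' s'] by fastforce
  qed
  then show "finite {(r', s'). F (r - r') (s - s') (G r' s' v) \<noteq> 0}"
    by (rule finite_subset) (use S(1) in \<open>auto intro!: finite_cartesian_product finite_nat_steps_between\<close>)
qed

lemma lin_ser_sprod:
  assumes "lin_ser F" "lin_ser G" "sprod_fin F G"
  shows "lin_ser (F \<star> G)"
  unfolding lin_ser_def sprod_def
proof (intro allI clinear_Sum_any_fun)
  fix r s a v
  show "clinear (\<lambda>v. case a of (r', s') \<Rightarrow> F (r - r') (s - s') (G r' s' v))"
    using clinear_compose[OF lin_serD[OF assms(1)] lin_serD[OF assms(2)]] by (simp add: split_def)
  show "finite {a. (case a of (r', s') \<Rightarrow> F (r - r') (s - s') (G r' s' v)) \<noteq> 0}"
    using assms(3) by (simp add: sprod_fin_iff)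
qed

lemma sprod_sadd_left:
  assumes "sprod_fin F G" "sprod_fin F' G"
  shows "sadd F F' \<star> G = sadd (F \<star> G) (F' \<star> G)"
  using assms unfolding sprod_fin_iff
  by (intro ext) (simp add: sprod_def sadd_def split_def Sum_any.distrib)

lemma sprod_sadd_right:
  assumes "lin_ser F" "sprod_fin F G" "sprod_fin F G'"
  shows "F \<star> sadd G G' = sadd (F \<star> G) (F \<star> G')"
  using assms(2,3) unfolding sprod_fin_iff
  by (intro ext) (simp add: sprod_def sadd_def split_def Sum_any.distrib clinear_add[OF lin_serD[OF assms(1)]])

lemma sprod_sscale_left:
  assumes "sprod_fin F G"
  shows "sscale c F \<star> G = sscale c (F \<star> G)"
  using assms unfolding sprod_fin_iff
  by (intro ext) (simp add: sprod_def sscale_def split_def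
      clinear_Sum_any[OF clinear_scaled[OF clinear_id]])

lemma sprod_sscale_right:
  assumes "lin_ser F" "sprod_fin F G"
  shows "F \<star> sscale c G = sscale c (F \<star> G)"
  using assms(2) unfolding sprod_fin_iff
  by (intro ext) (simp add: sprod_def sscale_def split_def clinear_scale[OF lin_serD[OF assms(1)]]
      clinear_Sum_any[OF clinear_scaled[OF clinear_id]])

lemma pos_ser_sprod:
  assumes "lin_ser F" "pos_ser F" "pos_ser G" shows "pos_ser (F \<star> G)"
  unfolding pos_ser_def
proof (intro allI impI)
  fix r s v assume "(F \<star> G) r s v \<noteq> 0"
  then obtain r' s' where nz: "F (r - r') (s - s') (G r' s' v) \<noteq> 0" by (rule sprod_nonzeroE)
  then have "G r' s' v \<noteq> 0" using assms(1) by auto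
  then have "r - r' \<in> \<nat>" "s - s' \<in> \<nat>" "r' \<in> \<nat>" "s' \<in> \<nat>"
    using nz assms(2,3) unfolding pos_ser_def by blast+
  from Nats_add[OF this(1,3)] Nats_add[OF this(2,4)] show "r \<in> \<nat> \<and> s \<in> \<nat>" by simp
qed

lemma fin_ser_sprod:
  assumes "lin_ser F" "fin_ser F" "fin_ser G" shows "fin_ser (F \<star> G)"
  unfolding fin_ser_def
proof
  fix v
  have "{(r, s). (F \<star> G) r s v \<noteq> 0} \<subseteq> (\<Union>(r', s')\<in>{(r, s). G r s v \<noteq> 0}.
      (\<lambda>(a, b). (a + r', b + s')) ` {(r, s). F r s (G r' s' v) \<noteq> 0})"
  proof safe
    fix r s assume "(F \<star> G) r s v \<noteq> 0"
    then obtain r' s' where nz: "F (r - r') (s - s') (G r' s' v) \<noteq> 0" by (rule sprod_nonzeroE)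
    then have "G r' s' v \<noteq> 0" using assms(1) by auto
    with nz show "(r, s) \<in> (\<Union>(r', s')\<in>{(r, s). G r s v \<noteq> 0}.
        (\<lambda>(a, b). (a + r', b + s')) ` {(r, s). F r s (G r' s' v) \<noteq> 0})"
      by (intro UN_I[of "(r', s')"]) (auto intro!: image_eqI[of _ _ "(r - r', s - s')"])
  qed
  then show "finite {(r, s). (F \<star> G) r s v \<noteq> 0}"
    by (rule finite_subset) (use assms in \<open>auto simp: fin_ser_def\<close>)
qed

lemma field_ser_sprod_pos:
  assumes "lin_ser F" "pos_ser F" "field_ser G" shows "field_ser (F \<star> G)"
  unfolding field_ser_def
proof
  fix v
  obtain S where S: "finite S" "\<And>r s. G r s v \<noteq> 0 \<Longrightarrow> \<exists>(r0, s0)\<in>S. r - r0 \<in> \<nat> \<and> s - s0 \<in> \<nat>"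
    using assms(3) unfolding field_ser_def by meson
  have "\<exists>(r0, s0)\<in>S. r - r0 \<in> \<nat> \<and> s - s0 \<in> \<nat>" if "(F \<star> G) r s v \<noteq> 0" for r s
  proof -
    from that obtain r' s' where nz: "F (r - r') (s - s') (G r' s' v) \<noteq> 0" by (rule sprod_nonzeroE)
    then have "G r' s' v \<noteq> 0" using assms(1) by auto
    then obtain r0 s0 where 0: "(r0, s0) \<in> S" "r' - r0 \<in> \<nat>" "s' - s0 \<in> \<nat>" using S(2) by blast
    have "r - r' \<in> \<nat>" "s - s' \<in> \<nat>" using nz assms by (auto simp: pos_ser_def)
    from Nats_add[OF this(1) 0(2)] Nats_add[OF this(2) 0(3)] 0(1) show ?thesis by auto
  qed
  with S(1) show "\<exists>S. finite S \<and> (\<forall>r s. (F \<star> G) r s v \<noteq> 0 \<longrightarrow> (\<exists>(r0, s0)\<in>S. r - r0 \<in> \<nat> \<and> s - s0 \<in> \<nat>))"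
    by blast
qed

lemma field_ser_sprod_fin:
  assumes "lin_ser F" "field_ser F" "fin_ser G" shows "field_ser (F \<star> G)"
  unfolding field_ser_def
proof
  fix v
  obtain S where S: "\<And>w. finite (S w)"
    "\<And>w r s. F r s w \<noteq> 0 \<Longrightarrow> \<exists>(r0, s0)\<in>S w. r - r0 \<in> \<nat> \<and> s - s0 \<in> \<nat>"
    using assms(2) unfolding field_ser_def by metis
  define T where "T = (\<Union>(r', s')\<in>{(r, s). G r s v \<noteq> 0}. (\<lambda>(a, b). (a + r', b + s')) ` S (G r' s' v))"
  have "finite T" using assms(3) S(1) by (auto simp: T_def fin_ser_def)
  moreover have "\<exists>(r0, s0)\<in>T. r - r0 \<in> \<nat> \<and> s - s0 \<in> \<nat>" if "(F \<star> G) r s v \<noteq> 0" for r s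
  proof -
    from that obtain r' s' where nz: "F (r - r') (s - s') (G r' s' v) \<noteq> 0" by (rule sprod_nonzeroE)
    then have "G r' s' v \<noteq> 0" using assms(1) by auto
    moreover obtain r0 s0 where 0: "(r0, s0) \<in> S (G r' s' v)" "r - r' - r0 \<in> \<nat>" "s - s' - s0 \<in> \<nat>"
      using S(2)[OF nz] by blast
    ultimately have "(r0 + r', s0 + s') \<in> T"
      unfolding T_def by (intro UN_I[of "(r', s')"]) (auto intro!: image_eqI[of _ _ "(r0, s0)"])
    with 0 show ?thesis by (intro bexI[of _ "(r0 + r', s0 + s')"]) (auto simp: algebra_simps)
  qed
  ultimately show "\<exists>S. finite S \<and> (\<forall>r s. (F \<star> G) r s v \<noteq> 0 \<longrightarrow> (\<exists>(r0, s0)\<in>S. r - r0 \<in> \<nat> \<and> s - s0 \<in> \<nat>))"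
    by blast
qed

lemma hol_ser_sprod:
  assumes "lin_ser F" "hol_ser F" "hol_ser G" shows "hol_ser (F \<star> G)"
  unfolding hol_ser_def
proof (intro allI impI)
  fix r s v assume "(F \<star> G) r s v \<noteq> 0"
  then obtain r' s' where nz: "F (r - r') (s - s') (G r' s' v) \<noteq> 0" by (rule sprod_nonzeroE)
  then have "G r' s' v \<noteq> 0" using assms(1) by auto
  then have "s - s' = 0" "s' = 0" using nz assms(2,3) unfolding hol_ser_def by blast+
  then show "s = 0" by simp
qed

lemma lin_ser_sadd: "lin_ser F \<Longrightarrow> lin_ser G \<Longrightarrow> lin_ser (sadd F G)"
  and lin_ser_sscale: "lin_ser F \<Longrightarrow> lin_ser (sscale c F)"
  and lin_ser_sconst: "clinear f \<Longrightarrow> lin_ser (sconst f)"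
  and lin_ser_sconj: "lin_ser F \<Longrightarrow> lin_ser (sconj F)"
  and lin_ser_zser: "(\<And>m. clinear (c' m)) \<Longrightarrow> lin_ser (zser c')"
proof -
  show "lin_ser F \<Longrightarrow> lin_ser G \<Longrightarrow> lin_ser (sadd F G)"
    by (auto simp: lin_ser_def clinear_iff sadd_def cvs.scale_right_distrib ac_simps)
  show "lin_ser F \<Longrightarrow> lin_ser (sscale c F)"
    by (auto simp: lin_ser_def clinear_iff sscale_def cvs.scale_right_distrib ac_simps)
  show "clinear f \<Longrightarrow> lin_ser (sconst f)"
    by (auto simp: lin_ser_def clinear_iff sconst_def)
  show "lin_ser F \<Longrightarrow> lin_ser (sconj F)"
    by (auto simp: lin_ser_def clinear_iff sconj_def)
  show "(\<And>m. clinear (c' m)) \<Longrightarrow> lin_ser (zser c')"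
    by (auto simp: lin_ser_def clinear_iff zser_def)
qed

lemma field_ser_sadd:
  fixes F G :: "('v, 'j \<Rightarrow>\<^sub>0 complex) series"
  assumes "field_ser F" "field_ser G" shows "field_ser (sadd F G)"
  unfolding field_ser_def
proof
  fix v
  obtain S where S: "finite S" "\<And>r s. F r s v \<noteq> 0 \<Longrightarrow> \<exists>(r0, s0)\<in>S. r - r0 \<in> \<nat> \<and> s - s0 \<in> \<nat>"
    using assms(1) unfolding field_ser_def by meson
  obtain T where T: "finite T" "\<And>r s. G r s v \<noteq> 0 \<Longrightarrow> \<exists>(r0, s0)\<in>T. r - r0 \<in> \<nat> \<and> s - s0 \<in> \<nat>"
    using assms(2) unfolding field_ser_def by meson
  have "\<exists>(r0, s0)\<in>S \<union> T. r - r0 \<in> \<nat> \<and> s - s0 \<in> \<nat>" if "sadd F G r s v \<noteq> 0" for r s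
  proof -
    have "F r s v \<noteq> 0 \<or> G r s v \<noteq> 0" using that by (auto simp: sadd_def)
    then show ?thesis using S(2) T(2) by blast
  qed
  with S(1) T(1) show "\<exists>S. finite S \<and> (\<forall>r s. sadd F G r s v \<noteq> 0 \<longrightarrow> (\<exists>(r0, s0)\<in>S. r - r0 \<in> \<nat> \<and> s - s0 \<in> \<nat>))"
    by (intro exI[of _ "S \<union> T"]) blast
qed

lemma field_ser_sscale:
  assumes "field_ser F" shows "field_ser (sscale c F)"
  using assms unfolding field_ser_def sscale_def
  by (metis cvs.scale_zero_right)

lemma hol_ser_sadd: "hol_ser F \<Longrightarrow> hol_ser G \<Longrightarrow> hol_ser (sadd F G)"
  for F G :: "('v, 'j \<Rightarrow>\<^sub>0 complex) series"
  unfolding hol_ser_def sadd_def by (metis add.right_neutral)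

lemma pos_ser_sconst: "pos_ser (sconst f)"
  and fin_ser_sconst: "fin_ser (sconst f)"
  and hol_ser_sconst: "hol_ser (sconst f)"
proof -
  have "{(r, s). sconst f r s v \<noteq> 0} \<subseteq> {(0, 0)}" for v by (auto simp: sconst_def)
  then show "fin_ser (sconst f)" by (auto simp: fin_ser_def intro: finite_subset)
qed (auto simp: pos_ser_def hol_ser_def sconst_def)

lemma sprod_sconst_left: "f 0 = 0 \<Longrightarrow> (sconst f \<star> G) r s v = f (G r s v)"
proof -
  assume f: "f 0 = 0"
  have "(sconst f \<star> G) r s v = Sum_any (\<lambda>a. if a = (r, s) then f (G r s v) else 0)"
    unfolding sprod_def sconst_def by (intro Sum_any.cong) (auto split: prod.splits)
  then show ?thesis by simp
qed

lemma sprod_sconst_right: "lin_ser F \<Longrightarrow> (F \<star> sconst f) r s v = F r s (f v)"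
proof -
  assume f: "lin_ser F"
  have "(F \<star> sconst f) r s v = Sum_any (\<lambda>a. if a = (0::real, 0::real) then F r s (f v) else 0)"
    unfolding sprod_def sconst_def
    by (intro arg_cong[where f = Sum_any] ext) (auto split: prod.splits simp: lin_ser_zero[OF f])
  then show ?thesis by simp
qed

lemma sprod_id_left: "sconst (\<lambda>v. v) \<star> G = G"
  by (intro ext) (simp add: sprod_sconst_left)

lemma sprod_id_right: "lin_ser F \<Longrightarrow> F \<star> sconst (\<lambda>v. v) = F"
  by (intro ext) (simp add: sprod_sconst_right)

lemma lin_pos_spow: "lin_ser F \<Longrightarrow> pos_ser F \<Longrightarrow> lin_ser (spow F k) \<and> pos_ser (spow F k)"
  by (induction k) (auto intro!: lin_ser_sprod lin_ser_sconst clinear_id pos_ser_sconst pos_ser_sprod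
      sprod_fin_pos_field pos_imp_field)

lemma lin_fin_spow: "lin_ser F \<Longrightarrow> fin_ser F \<Longrightarrow> lin_ser (spow F k) \<and> fin_ser (spow F k)"
  by (induction k) (auto intro!: lin_ser_sprod lin_ser_sconst clinear_id fin_ser_sconst fin_ser_sprod
      sprod_fin_fin)

text \<open>
  Lower truncation in the first variable, which turns products with creation operators into finite sums.
\<close>

lemma field_ser_bound:
  assumes "field_ser F" shows "\<exists>N. \<forall>k>N. F (r - real k) s v = 0"
proof -
  obtain S where S: "finite S" "\<And>r s. F r s v \<noteq> 0 \<Longrightarrow> \<exists>(r0, s0)\<in>S. r - r0 \<in> \<nat> \<and> s - s0 \<in> \<nat>"
    using assms unfolding field_ser_def by meson
  define N where "N = (\<Sum>(r0, s0)\<in>S. nat \<lceil>\<bar>r - r0\<bar>\<rceil>)"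
  have "F (r - real k) s v = 0" if k: "k > N" for k
  proof (rule ccontr)
    assume "F (r - real k) s v \<noteq> 0"
    then obtain r0 s0 where 0: "(r0, s0) \<in> S" "r - real k - r0 \<in> \<nat>" using S(2) by blast
    then have "real k \<le> r - r0" by (auto elim!: Nats_cases)
    then have "k \<le> nat \<lceil>\<bar>r - r0\<bar>\<rceil>" by linarith
    also have "nat \<lceil>\<bar>r - r0\<bar>\<rceil> \<le> N"
      unfolding N_def using member_le_sum[of "(r0, s0)" S "\<lambda>(r0, s0). nat \<lceil>\<bar>r - r0\<bar>\<rceil>"] 0 S(1) by simp
    finally show False using k by simp
  qed
  then show ?thesis by blast
qed

section \<open>One-sided series and their exponentials\<close>

text \<open>
  $\sum_{n \ge 0} c_n z^{-\sigma n}$, for a sign $\sigma$.  As in $E^\sigma$, the sign $+1$ stands for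
  annihilation and the sign $-1$ for creation operators, so that both are treated at once.
\<close>

definition gser :: "real \<Rightarrow> (nat \<Rightarrow> 'v \<Rightarrow> 'w::zero) \<Rightarrow> ('v, 'w) series" where
  "gser \<sigma> c r s v = (if s = 0 \<and> - \<sigma> * r \<in> \<nat> then c (nat \<lfloor>- \<sigma> * r\<rfloor>) v else 0)"

lemma sign_mult [simp]: "\<sigma> * (\<sigma> * x) = x" if "\<sigma> = 1 \<or> \<sigma> = - 1" for \<sigma> x :: real
  using that by auto

lemma gser_at:
  assumes "\<sigma> = 1 \<or> \<sigma> = - 1"
  shows "gser \<sigma> c (- \<sigma> * real n) 0 v = c n v"
  using assms by (auto simp: gser_def)

lemma gserE:
  assumes "\<sigma> = 1 \<or> \<sigma> = - 1" "gser \<sigma> c r s v \<noteq> 0"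
  obtains n :: nat where "r = - \<sigma> * real n" "s = 0" "c n v \<noteq> 0"
proof -
  from assms(2) have s: "s = 0" and "- \<sigma> * r \<in> \<nat>" by (auto simp: gser_def split: if_splits)
  then obtain n where n: "- \<sigma> * r = real n" by (auto elim: Nats_cases)
  then have r: "r = - \<sigma> * real n" using assms(1) by auto
  have "c n v \<noteq> 0" using assms(2) unfolding r s gser_at[OF assms(1)] .
  then show ?thesis using that r s by blast
qed

lemma gser_sprod_left:
  assumes "\<sigma> = 1 \<or> \<sigma> = - 1" "\<And>m. c m 0 = 0"
  shows "(gser \<sigma> c \<star> G) r s v = Sum_any (\<lambda>m::nat. c m (G (r + \<sigma> * real m) s v))"
proof -
  let ?h = "\<lambda>m::nat. (r + \<sigma> * real m, s)"
  have "inj ?h" using assms(1) by (intro injI) auto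
  moreover have "x \<in> range ?h"
    if "(case x of (r', s') \<Rightarrow> gser \<sigma> c (r - r') (s - s') (G r' s' v)) \<noteq> 0" for x
  proof -
    obtain r' s' where x: "x = (r', s')" by (cases x)
    then have nz: "gser \<sigma> c (r - r') (s - s') (G r' s' v) \<noteq> 0" using that by simp
    obtain n :: nat where "r - r' = - \<sigma> * real n" "s - s' = 0" using gserE[OF assms(1) nz] .
    then show ?thesis by (auto simp: x intro!: image_eqI[of _ _ n])
  qed
  ultimately have "(gser \<sigma> c \<star> G) r s v = Sum_any (\<lambda>m. case ?h m of (r', s') \<Rightarrow> gser \<sigma> c (r - r') (s - s') (G r' s' v))"
    unfolding sprod_def by (rule Sum_any_reindex_inj)
  also have "\<dots> = Sum_any (\<lambda>m. c m (G (r + \<sigma> * real m) s v))"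
    using gser_at[OF assms(1), of c] by simp
  finally show ?thesis .
qed

lemma gser_sprod_right:
  assumes "\<sigma> = 1 \<or> \<sigma> = - 1" "lin_ser F"
  shows "(F \<star> gser \<sigma> d) r s v = Sum_any (\<lambda>m::nat. F (r + \<sigma> * real m) s (d m v))"
proof -
  let ?h = "\<lambda>m::nat. (- \<sigma> * real m, 0::real)"
  have "inj ?h" using assms(1) by (intro injI) auto
  moreover have "x \<in> range ?h"
    if "(case x of (r', s') \<Rightarrow> F (r - r') (s - s') (gser \<sigma> d r' s' v)) \<noteq> 0" for x
  proof -
    obtain r' s' where x: "x = (r', s')" by (cases x)
    then have nz: "gser \<sigma> d r' s' v \<noteq> 0" using that assms(2) by auto
    obtain n :: nat where "r' = - \<sigma> * real n" "s' = 0" using gserE[OF assms(1) nz] .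
    then show ?thesis by (auto simp: x intro!: image_eqI[of _ _ n])
  qed
  ultimately have "(F \<star> gser \<sigma> d) r s v = Sum_any (\<lambda>m. case ?h m of (r', s') \<Rightarrow> F (r - r') (s - s') (gser \<sigma> d r' s' v))"
    unfolding sprod_def by (rule Sum_any_reindex_inj)
  also have "\<dots> = Sum_any (\<lambda>m. F (r + \<sigma> * real m) s (d m v))"
    using gser_at[OF assms(1), of d] by simp
  finally show ?thesis .
qed

lemma lin_ser_gser: "(\<And>m. clinear (c m)) \<Longrightarrow> lin_ser (gser \<sigma> c)"
  by (auto simp: lin_ser_def clinear_iff gser_def)

lemma hol_ser_gser: "hol_ser (gser \<sigma> c)"
  by (auto simp: hol_ser_def gser_def)

lemma pos_ser_gser: "pos_ser (gser (- 1) c)"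
  by (auto simp: pos_ser_def gser_def split: if_splits)

lemma fin_ser_gser:
  assumes "\<sigma> = 1 \<or> \<sigma> = - 1" "\<And>v. finite {n. c n v \<noteq> 0}" shows "fin_ser (gser \<sigma> c)"
  unfolding fin_ser_def
proof
  fix v
  have "{(r, s). gser \<sigma> c r s v \<noteq> 0} \<subseteq> (\<lambda>n. (- \<sigma> * real n, 0)) ` {n. c n v \<noteq> 0}"
    by (auto elim!: gserE[OF assms(1)])
  then show "finite {(r, s). gser \<sigma> c r s v \<noteq> 0}"
    by (rule finite_subset) (use assms(2) in simp)
qed

text \<open>The coefficient of $t^n$ in the $k$-th power of $\sum_n c_n t^n$.\<close>

fun opow :: "(nat \<Rightarrow> 'v \<Rightarrow> 'v::comm_monoid_add) \<Rightarrow> nat \<Rightarrow> nat \<Rightarrow> 'v \<Rightarrow> 'v" where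
  "opow c 0 n v = (if n = 0 then v else 0)"
| "opow c (Suc k) n v = (\<Sum>j\<le>n. c j (opow c k (n - j) v))"

lemma gser_sprod_gser:
  assumes "\<sigma> = 1 \<or> \<sigma> = - 1" "\<And>m. c m 0 = 0"
  shows "gser \<sigma> c \<star> gser \<sigma> d = gser \<sigma> (\<lambda>n v. \<Sum>j\<le>n. c j (d (n - j) v))"
proof (intro ext)
  fix r s v
  have *: "- \<sigma> * (r + \<sigma> * real m) = - \<sigma> * r - real m" for m
    using assms(1) by (auto simp: algebra_simps)
  have L: "(gser \<sigma> c \<star> gser \<sigma> d) r s v = Sum_any (\<lambda>m. c m (gser \<sigma> d (r + \<sigma> * real m) s v))"
    by (rule gser_sprod_left[of \<sigma> c, OF assms])
  show "(gser \<sigma> c \<star> gser \<sigma> d) r s v = gser \<sigma> (\<lambda>n v. \<Sum>j\<le>n. c j (d (n - j) v)) r s v"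
  proof (cases "s = 0 \<and> - \<sigma> * r \<in> \<nat>")
    case True
    then obtain n where n: "- \<sigma> * r = real n" by (auto elim: Nats_cases)
    have "gser \<sigma> d (r + \<sigma> * real m) s v = (if m \<le> n then d (n - m) v else 0)" for m
    proof (cases "m \<le> n")
      case False
      then have "real n - real m \<notin> \<nat>" by (auto elim!: Nats_cases)
      then show ?thesis using False by (simp only: gser_def * n) simp
    next
      case True
      then have "- \<sigma> * (r + \<sigma> * real m) = real (n - m)" unfolding * n by simp
      then have "gser \<sigma> d (r + \<sigma> * real m) 0 v = d (n - m) v"
        unfolding gser_def by (simp only:) simp
      then show ?thesis using True \<open>s = 0 \<and> _\<close> by simp
    qed
    then have "(gser \<sigma> c \<star> gser \<sigma> d) r s v = Sum_any (\<lambda>m. c m (if m \<le> n then d (n - m) v else 0))"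
      by (simp add: L)
    also have "\<dots> = (\<Sum>j\<le>n. c j (d (n - j) v))"
      by (subst Sum_any_finite[of n]) (auto simp: assms(2))
    finally show ?thesis using True n by (simp add: gser_def)
  next
    case False
    have "gser \<sigma> d (r + \<sigma> * real m) s v = 0" for m
    proof (cases "s = 0 \<and> - \<sigma> * r - real m \<in> \<nat>")
      case True
      then have "- \<sigma> * r - real m + real m \<in> \<nat>" by (intro Nats_add) auto
      then show ?thesis using False True by simp
    qed (auto simp only: gser_def * split: if_splits)
    moreover have "gser \<sigma> (\<lambda>n v. \<Sum>j\<le>n. c j (d (n - j) v)) r s v = 0"
      using False unfolding gser_def by auto
    ultimately show ?thesis by (simp add: L assms(2))
  qed
qed

lemma spow_gser:
  assumes "\<sigma> = 1 \<or> \<sigma> = - 1" "\<And>m. c m 0 = 0"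
  shows "spow (gser \<sigma> c) k = gser \<sigma> (opow c k)"
proof (induction k)
  case 0
  have "(- \<sigma> * r \<in> \<nat> \<and> nat \<lfloor>- \<sigma> * r\<rfloor> = 0) = (r = 0)" for r
  proof
    assume "- \<sigma> * r \<in> \<nat> \<and> nat \<lfloor>- \<sigma> * r\<rfloor> = 0"
    then have "- \<sigma> * r \<in> \<nat>" and z: "nat \<lfloor>- \<sigma> * r\<rfloor> = 0" by blast+
    obtain n where n: "- \<sigma> * r = real n" using \<open>- \<sigma> * r \<in> \<nat>\<close> by (rule Nats_cases)
    have "- \<sigma> * r = 0" using z unfolding n by simp
    then show "r = 0" using assms(1) by auto
  qed simp
  then show ?case
    by (intro ext) (auto simp: sconst_def gser_def)
next
  case (Suc k)
  then show ?case
    by (simp add: gser_sprod_gser[of \<sigma> c, OF assms])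
qed

text \<open>
  Without a constant term the $k$-th power starts in degree $k$; this makes the exponential series
  finite in each degree.
\<close>

lemma opow_zero:
  assumes "\<And>v. c 0 v = 0" "\<And>m. c m 0 = 0" shows "k > n \<Longrightarrow> opow c k n v = 0"
proof (induction k arbitrary: n)
  case (Suc k)
  have "c j (opow c k (n - j) v) = 0" if "j \<le> n" for j
    using that Suc by (cases "j = 0") (auto simp: assms)
  then show ?case by simp
qed simp

text \<open>
  The coefficient of $t^n$ in $\exp(\sum_n c_n t^n)$, for a series without constant term.
\<close>

definition oexp :: "(nat \<Rightarrow> ('i \<Rightarrow>\<^sub>0 complex) \<Rightarrow> ('i \<Rightarrow>\<^sub>0 complex)) \<Rightarrow> nat \<Rightarrow> ('i \<Rightarrow>\<^sub>0 complex) \<Rightarrow> ('i \<Rightarrow>\<^sub>0 complex)" where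
  "oexp c n v = (\<Sum>k\<le>n. scale (1 / fact k) (opow c k n v))"

lemma sexp_gser:
  assumes "\<sigma> = 1 \<or> \<sigma> = - 1" "\<And>v. c 0 v = 0" "\<And>m. c m 0 = 0"
  shows "sexp (gser \<sigma> c) = gser \<sigma> (oexp c)"
proof (intro ext)
  fix r s v
  show "sexp (gser \<sigma> c) r s v = gser \<sigma> (oexp c) r s v"
    using Sum_any_finite[of _ "\<lambda>k. scale (1 / fact k) (opow c k (nat \<lfloor>- \<sigma> * r\<rfloor>) v)"]
    by (auto simp: sexp_def spow_gser[of \<sigma> c, OF assms(1,3)] gser_def oexp_def opow_zero[of c, OF assms(2,3)])
qed

lemma clinear_opow: "(\<And>m. clinear (c m)) \<Longrightarrow> clinear (opow c k n)"
proof (induction k arbitrary: n)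
  case 0
  show ?case by (auto simp: clinear_iff)
next
  case (Suc k)
  have "opow c (Suc k) n = (\<lambda>v. \<Sum>j\<le>n. c j (opow c k (n - j) v))" by (intro ext) simp
  then show ?case
    using clinear_compose[OF Suc.prems Suc.IH[OF Suc.prems]] by (simp only:) (rule clinear_sum_fun)
qed

lemma clinear_oexp: "(\<And>m. clinear (c m)) \<Longrightarrow> clinear (oexp c n)"
  unfolding oexp_def[abs_def] by (intro clinear_sum_fun clinear_scaled clinear_opow)

lemma oexp_0 [simp]: "c 0 = (\<lambda>v. 0) \<Longrightarrow> oexp c 0 v = v"
  by (simp add: oexp_def)

lemma oexp_1 [simp]: "c 0 = (\<lambda>v. 0) \<Longrightarrow> oexp c (Suc 0) v = c (Suc 0) v"
  by (simp add: oexp_def)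

text \<open>
  The factor is the binomial coefficient of $r + n$ over $n$; as a Pochhammer symbol it also makes
  sense, and vanishes where it should, for negative and for non-integral $r$.
\<close>

lemma dz_div_apply:
  "dz_div n F r s v = scale (pochhammer (of_real r + 1) n / fact n) (F (r + real n) s v)"
proof -
  have "(dz ^^ n) F r s v = scale (pochhammer (of_real r + 1) n) (F (r + real n) s v)" for r
  proof (induction n arbitrary: r)
    case (Suc n)
    have "(dz ^^ Suc n) F r s v = scale (of_real (r + 1)) ((dz ^^ n) F (r + 1) s v)"
      by (simp add: dz_def)
    also have "\<dots> = scale (of_real (r + 1) * pochhammer (of_real (r + 1) + 1) n) (F (r + 1 + real n) s v)"
      by (simp only: Suc.IH cvs.scale_scale)
    also have "of_real (r + 1) * pochhammer (of_real (r + 1) + 1) n = pochhammer (of_real r + 1 :: complex) (Suc n)"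
      by (simp only: pochhammer_rec of_real_add of_real_1)
    also have "r + 1 + real n = r + real (Suc n)" by simp
    finally show ?case .
  qed simp
  then show ?thesis by (simp add: dz_div_def sscale_def)
qed

section \<open>The rank one oscillators\<close>
text \<open>
  The Fock space of \<open>Y1\<close>, in which $\mathbb R$ carries the form $(s, t) = st$.
\<close>

interpretation r1: fock "(*)" "\<lambda>h::real. h" "\<lambda>_::unit. 1::real" .

type_synonym state1 = "(real, unit) state"

text \<open>By linearity of $h \mapsto h(m)$ the oscillators of the unit vector suffice.\<close>

definition osc1 :: "int \<Rightarrow> state1 \<Rightarrow> state1" where
  "osc1 = r1.osc 1"

abbreviation X1 :: "nat \<Rightarrow> unit monomial" where
  "X1 n \<equiv> single ((), n) 1"

lemma r1_pbar [simp]: "r1.pbar h = 0"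
  by (simp add: r1.pbar_def)

lemma r1_ipp [simp]: "r1.ipp h h' = h * h'"
  by (simp add: r1.ipp_def)

lemma r1_pderiv_bas:
  "r1.pderiv () n (bas (\<alpha>, \<mu>)) = scale (of_nat (coef \<mu> ((), n))) (bas (\<alpha>, \<mu> - X1 n))"
  by (simp add: r1.pderiv_def)

lemma clinear_r1_pderiv: "clinear (r1.pderiv k n)"
  by (simp add: r1.pderiv_def clinear_lin)

lemma lin_scaled: "lin (\<lambda>x. scale c (f x)) v = scale c (lin f v)"
  by (simp add: lin_def cvs.scale_sum_right mult.commute)

lemma r1_osc_scale: "r1.osc h m v = scale (of_real h) (osc1 m v)"
  by (simp add: osc1_def r1.osc_def lin_scaled[symmetric] split_def mult_ac UNIV_unit)

lemma osc1_neg: "osc1 (- int n - 1) v = r1.var () n * v"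
  by (simp add: osc1_def r1.osc_def UNIV_unit)

lemma osc1_zero: "osc1 0 = lin (\<lambda>(\<alpha>, \<mu>). scale (of_real \<alpha>) (bas (\<alpha>, \<mu>)))"
  by (intro ext) (simp add: osc1_def r1.osc_def)

lemma osc1_pos: "osc1 (int n + 1) v = scale (of_nat (Suc n)) (r1.pderiv () n v)"
  by (simp add: osc1_def r1.osc_def UNIV_unit add.commute)

lemma r1_var_bas: "r1.var () n * bas (\<alpha>, \<mu>) = bas (\<alpha>, X1 n + \<mu>)"
  by (simp add: r1.var_def mult_single)

lemma int_cases3:
  obtains (neg) n where "m = - int n - 1" | (zero) "m = 0" | (pos) n where "m = int n + 1"
proof -
  have "m = - int (nat (- m - 1)) - 1 \<or> m = 0 \<or> m = int (nat (m - 1)) + 1" by linarith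
  then show ?thesis using that by blast
qed

lemma clinear_osc1: "clinear (osc1 m)"
proof (cases m rule: int_cases3)
  case (neg n)
  show ?thesis unfolding neg osc1_neg[abs_def] by (rule clinear_times)
next
  case zero
  then show ?thesis by (simp add: osc1_zero clinear_lin)
next
  case (pos n)
  show ?thesis unfolding pos osc1_pos[abs_def] by (intro clinear_scaled clinear_r1_pderiv)
qed

lemmas osc1_add = clinear_add[OF clinear_osc1]
  and osc1_scale = clinear_scale[OF clinear_osc1]
  and osc1_0 [simp] = clinear_zero[OF clinear_osc1]

lemma osc1_bas:
  "osc1 (- int n - 1) (bas (\<alpha>, \<mu>)) = bas (\<alpha>, X1 n + \<mu>)"
  "osc1 0 (bas (\<alpha>, \<mu>)) = scale (of_real \<alpha>) (bas (\<alpha>, \<mu>))"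
  "osc1 (int n + 1) (bas (\<alpha>, \<mu>)) =
    scale (of_nat (Suc n * coef \<mu> ((), n))) (bas (\<alpha>, \<mu> - X1 n))"
  by (simp_all only: osc1_neg osc1_zero osc1_pos r1_pderiv_bas r1_var_bas lin_bas prod.case
      cvs.scale_scale of_nat_mult)

lemma osc1_creation_commute:
  "osc1 (- int n - 1) (osc1 (- int m - 1) v) = osc1 (- int m - 1) (osc1 (- int n - 1) v)"
  by (simp add: osc1_neg mult.left_commute)

lemma osc1_annihilation_commute:
  assumes "i \<ge> 0" "j \<ge> 0"
  shows "osc1 i (osc1 j v) = osc1 j (osc1 i v)"
proof (rule clinear_eqI[OF clinear_compose[OF clinear_osc1 clinear_osc1] clinear_compose[OF clinear_osc1 clinear_osc1]])
  fix x :: "real \<times> unit monomial"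
  obtain \<alpha> \<mu> where x: "x = (\<alpha>, \<mu>)" by (cases x)
  show "osc1 i (osc1 j (bas x)) = osc1 j (osc1 i (bas x))"
  proof (cases i rule: int_cases3)
    case zero
    then show ?thesis using assms
      by (cases j rule: int_cases3) (auto simp: x osc1_bas osc1_scale mult.commute)
  next
    case (pos n)
    show ?thesis
    proof (cases j rule: int_cases3)
      case zero
      then show ?thesis using pos by (simp add: x osc1_bas osc1_scale mult.commute)
    next
      case pos': (pos m)
      have "\<mu> - X1 m - X1 n = \<mu> - X1 n - X1 m"
        by (rule poly_mapping_eqI) (simp add: lookup_minus)
      then show ?thesis unfolding pos pos' x
        by (cases "m = n") (simp_all add: osc1_bas osc1_scale lookup_minus lookup_single when_def mult_ac
            del: of_nat_mult)
    qed (use assms in auto)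
  qed (use assms in auto)
qed

lemma osc1_eventually_zero: "\<exists>M. \<forall>j>M. osc1 (int j) v = 0"
proof (induction v rule: vec_induct)
  case (add u v)
  then obtain M M' where "\<forall>j>M. osc1 (int j) u = 0" "\<forall>j>M'. osc1 (int j) v = 0" by blast
  then show ?case by (intro exI[of _ "max M M'"]) (simp add: osc1_add)
next
  case (bas c x)
  obtain \<alpha> \<mu> where x: "x = (\<alpha>, \<mu>)" by (cases x)
  have "finite (Suc ` snd ` supp \<mu>)" by simp
  then obtain M where M: "\<forall>n\<in>Suc ` snd ` supp \<mu>. n \<le> M"
    by (meson finite_nat_set_iff_bounded_le)
  have "osc1 (int j) (scale c (bas x)) = 0" if j: "j > M" for j
  proof -
    obtain n where n: "int j = int n + 1" using j by (cases j) auto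
    then have "((), n) \<notin> supp \<mu>" using M j by force
    then show ?thesis unfolding n x by (simp add: osc1_scale osc1_bas in_keys_iff)
  qed
  then show ?case by blast
qed simp

lemma monomial_induct [case_names zero single]:
  fixes \<mu> :: "'x \<Rightarrow>\<^sub>0 nat"
  assumes "P 0" "\<And>k \<mu>. P \<mu> \<Longrightarrow> P (single k 1 + \<mu>)"
  shows "P \<mu>"
proof (induction "\<Sum>k\<in>supp \<mu>. coef \<mu> k" arbitrary: \<mu> rule: less_induct)
  case less
  show ?case
  proof (cases "\<mu> = 0")
    case False
    then obtain k where k: "coef \<mu> k \<noteq> 0" by (metis lookup_zero poly_mapping_eqI)
    define \<mu>' where "\<mu>' = \<mu> - single k 1"
    have \<mu>: "\<mu> = single k 1 + \<mu>'"
      using k by (auto intro!: poly_mapping_eqI simp: \<mu>'_def lookup_add lookup_minus lookup_single when_def)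
    have "supp \<mu>' \<subseteq> supp \<mu>"
      by (auto simp: in_keys_iff \<mu>'_def lookup_minus)
    then have "(\<Sum>k\<in>supp \<mu>'. coef \<mu>' k) = (\<Sum>k\<in>supp \<mu>. coef \<mu>' k)"
      by (intro sum.mono_neutral_left) (auto simp: in_keys_iff)
    also have "\<dots> < (\<Sum>k\<in>supp \<mu>. coef \<mu> k)"
      using k by (intro sum_strict_mono_ex1)
        (auto simp: \<mu>'_def lookup_minus in_keys_iff intro!: bexI[of _ k])
    finally have "P \<mu>'" by (rule less.hyps)
    then show ?thesis unfolding \<mu> by (rule assms(2))
  qed (simp add: assms(1))
qed

text \<open>The weight of $h(-n_1-1) \cdots h(-n_k-1)$, which is $\sum_i (n_i + 1)$.\<close>

definition wt :: "unit monomial \<Rightarrow> nat" where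
  "wt \<mu> = Sum_any (\<lambda>k. coef \<mu> k * Suc (snd k))"

lemma wt_add: "wt (\<mu> + \<nu>) = wt \<mu> + wt \<nu>"
  unfolding wt_def by (subst Sum_any.distrib[symmetric]) (simp_all add: lookup_add algebra_simps)

lemma wt_single: "wt (X1 n) = Suc n"
proof -
  have "wt (X1 n) = Sum_any (\<lambda>k. if k = ((), n) then Suc (snd k) else 0)"
    unfolding wt_def by (intro arg_cong[where f = Sum_any] ext) (auto simp: lookup_single when_def)
  then show ?thesis by simp
qed

lemma wt_diff: "coef \<mu> ((), n) \<noteq> 0 \<Longrightarrow> wt (\<mu> - X1 n) + Suc n = wt \<mu>"
proof -
  assume "coef \<mu> ((), n) \<noteq> 0"
  then have "\<mu> = (\<mu> - X1 n) + X1 n"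
    by (auto intro!: poly_mapping_eqI simp: lookup_add lookup_minus lookup_single when_def)
  then show ?thesis by (metis wt_add wt_single)
qed

text \<open>
  The bound is an integer, so that lowering the weight is a subtraction; for a negative bound the
  space is $0$.
\<close>

definition wt_le :: "int \<Rightarrow> state1 set" where
  "wt_le d = supp_on {x. int (wt (snd x)) \<le> d}"

lemma wt_le_neg: "d < 0 \<Longrightarrow> v \<in> wt_le d \<Longrightarrow> v = 0"
  by (auto simp: wt_le_def supp_on_iff intro!: poly_mapping_eqI)

lemma subspace_wt_le: "cvs.subspace (wt_le d)"
  by (simp add: wt_le_def subspace_supp_on)

lemma osc1_wt_le:
  assumes "v \<in> wt_le d" shows "osc1 (int n) v \<in> wt_le (d - int n)"
proof (rule clinear_image_supp_on[OF clinear_osc1 subspace_wt_le assms[unfolded wt_le_def]])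
  fix x :: "real \<times> unit monomial" assume x: "x \<in> {x. int (wt (snd x)) \<le> d}"
  show "osc1 (int n) (bas x) \<in> wt_le (d - int n)"
  proof (cases n)
    case 0
    then show ?thesis using x
      by (cases x) (auto simp: osc1_bas wt_le_def intro!: cvs.subspace_scale[OF subspace_supp_on])
  next
    case (Suc m)
    then have n: "int n = int m + 1" by simp
    show ?thesis unfolding n using x wt_diff[of "snd x" m]
      by (cases x; cases "coef (snd x) ((), m) = 0")
        (auto simp: osc1_bas wt_le_def intro!: cvs.subspace_scale[OF subspace_supp_on] cvs.subspace_0[OF subspace_supp_on])
  qed
qed

lemma ex_wt_le: "\<exists>d\<ge>0. v \<in> wt_le d"
proof -
  obtain M where M: "\<forall>n\<in>(\<lambda>x. wt (snd x)) ` supp v. n \<le> M"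
    using finite_nat_set_iff_bounded_le by (metis finite_imageI finite_keys)
  then show ?thesis by (intro exI[of _ "int M"]) (auto simp: wt_le_def supp_on_def)
qed

section \<open>The vertex operators of the highest weight vectors in rank one\<close>

text \<open>The coefficients of the series whose exponential is $E^\sigma$.\<close>

definition exp_coeff :: "int \<Rightarrow> real \<Rightarrow> nat \<Rightarrow> state1 \<Rightarrow> state1" where
  "exp_coeff \<sigma> \<alpha> n v = (if n = 0 then 0 else scale (- of_int \<sigma> / of_nat n) (r1.osc \<alpha> (\<sigma> * int n) v))"

lemma clinear_r1_osc: "clinear (r1.osc h m)"
  unfolding r1_osc_scale[abs_def] by (intro clinear_scaled clinear_osc1)

lemma clinear_exp_coeff: "clinear (exp_coeff \<sigma> \<alpha> n)"
proof (cases "n = 0")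
  case False
  then have "exp_coeff \<sigma> \<alpha> n = (\<lambda>v. scale (- of_int \<sigma> / of_nat n) (r1.osc \<alpha> (\<sigma> * int n) v))"
    by (simp add: exp_coeff_def fun_eq_iff)
  then show ?thesis using clinear_scaled[OF clinear_r1_osc] by metis
next
  case True
  then have "exp_coeff \<sigma> \<alpha> n = (\<lambda>v. 0)" by (intro ext) (simp add: exp_coeff_def)
  then show ?thesis using clinear_zero_fun by metis
qed

lemma exp_coeff_0: "exp_coeff \<sigma> \<alpha> 0 = (\<lambda>v. 0)"
  by (auto simp: exp_coeff_def)

lemma exp_coeff_zero [simp]: "exp_coeff \<sigma> \<alpha> n 0 = 0"
  by (rule clinear_zero[OF clinear_exp_coeff])

lemma zser_eq_gser:
  assumes "\<sigma> = 1 \<or> \<sigma> = - 1"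
  shows "zser (\<lambda>m v. let n = - \<sigma> * m in if n \<ge> 1 then scale (- of_int \<sigma> / of_int n) (r1.osc h (\<sigma> * n) v) else 0) =
    gser (of_int \<sigma>) (exp_coeff \<sigma> h)"
proof (intro ext)
  fix r s v
  show "zser (\<lambda>m v. let n = - \<sigma> * m in if n \<ge> 1 then scale (- of_int \<sigma> / of_int n) (r1.osc h (\<sigma> * n) v) else 0) r s v =
    gser (of_int \<sigma>) (exp_coeff \<sigma> h) r s v"
  proof (cases "r \<in> \<int>")
    case True
    then obtain k where k: "r = of_int k" by (auto elim: Ints_cases)
    define n where "n = - \<sigma> * k"
    have r: "- of_int \<sigma> * r = of_int n" by (simp add: n_def k)
    have N: "(of_int n :: real) \<in> \<nat> \<longleftrightarrow> n \<ge> 0"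
    proof
      assume "(of_int n :: real) \<in> \<nat>"
      then obtain m where "(of_int n :: real) = of_nat m" by (rule Nats_cases)
      then have "n = int m" by linarith
      then show "n \<ge> 0" by simp
    next
      assume "n \<ge> 0"
      then obtain m where "n = int m" by (rule nonneg_int_cases)
      then show "(of_int n :: real) \<in> \<nat>" by simp
    qed
    have 1: "zser (\<lambda>m v. let n = - \<sigma> * m in if n \<ge> 1 then scale (- of_int \<sigma> / of_int n) (r1.osc h (\<sigma> * n) v) else 0) r s v =
        (if s = 0 then if n \<ge> 1 then scale (- of_int \<sigma> / of_int n) (r1.osc h (\<sigma> * n) v) else 0 else 0)"
      unfolding zser_def Let_def k floor_of_int n_def[symmetric] by simp
    have 2: "gser (of_int \<sigma>) (exp_coeff \<sigma> h) r s v = (if s = 0 \<and> n \<ge> 0 then exp_coeff \<sigma> h (nat n) v else 0)"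
      unfolding gser_def r N floor_of_int by simp
    show ?thesis
    proof (cases "n \<ge> 1")
      case True
      then have "exp_coeff \<sigma> h (nat n) v = scale (- of_int \<sigma> / of_int n) (r1.osc h (\<sigma> * n) v)"
        by (simp add: exp_coeff_def)
      then show ?thesis unfolding 1 2 using True by simp
    next
      case False
      then show ?thesis unfolding 1 2 by (cases "n = 0") (auto simp: exp_coeff_def)
    qed
  next
    case False
    then have "- of_int \<sigma> * r \<notin> \<nat>"
      using assms Nats_subset_Ints by auto
    then show ?thesis using False by (simp add: zser_def gser_def)
  qed
qed

lemma r1_Eser:
  assumes "\<sigma> = 1 \<or> \<sigma> = - 1"
  shows "r1.Eser \<sigma> \<alpha> = gser (of_int \<sigma>) (oexp (exp_coeff \<sigma> \<alpha>))"
proof -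
  have "exp_coeff \<sigma> 0 = (\<lambda>n v. 0)" by (intro ext) (simp add: exp_coeff_def r1_osc_scale)
  then have "gser (of_int \<sigma>) (exp_coeff \<sigma> 0) = (\<lambda>r s v. 0)" by (simp add: gser_def fun_eq_iff)
  then have "sadd (gser (of_int \<sigma>) (exp_coeff \<sigma> \<alpha>)) (sconj (gser (of_int \<sigma>) (exp_coeff \<sigma> 0))) = gser (of_int \<sigma>) (exp_coeff \<sigma> \<alpha>)"
    by (simp add: sadd_def sconj_def fun_eq_iff)
  moreover have "sexp (gser (of_int \<sigma>) (exp_coeff \<sigma> \<alpha>)) = gser (of_int \<sigma>) (oexp (exp_coeff \<sigma> \<alpha>))"
    using assms by (intro sexp_gser) (auto simp: exp_coeff_0)
  moreover define c where "c h = (\<lambda>m v. let n = - \<sigma> * m in if n \<ge> 1 then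
      scale (- of_int \<sigma> / of_int n) (r1.osc h (\<sigma> * n) v) else 0)" for h
  have "r1.Eser \<sigma> \<alpha> = sexp (sadd (zser (c \<alpha>)) (sconj (zser (c 0))))"
    unfolding r1.Eser_def c_def Let_def r1_pbar ..
  moreover have "zser (c h) = gser (of_int \<sigma>) (exp_coeff \<sigma> h)" for h
    unfolding c_def by (rule zser_eq_gser[OF assms])
  ultimately show ?thesis by simp
qed

text \<open>
  The operator $h(n)$ lowers the weight by $n$, and so does every product of such operators of total
  degree $n$.  As weights are not negative, $E^+$ is a finite sum on each vector.
\<close>

lemma oexp_exp_coeff_wt_le:
  assumes "v \<in> wt_le d" shows "oexp (exp_coeff 1 \<alpha>) n v \<in> wt_le (d - int n)"
proof -
  have q: "exp_coeff 1 \<alpha> j w \<in> wt_le (e - int j)" if "w \<in> wt_le e" for j w e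
    using osc1_wt_le[OF that, of j]
    by (auto simp: exp_coeff_def r1_osc_scale intro!: cvs.subspace_neg[OF subspace_wt_le]
        cvs.subspace_scale[OF subspace_wt_le] cvs.subspace_0[OF subspace_wt_le])
  have "opow (exp_coeff 1 \<alpha>) k n v \<in> wt_le (d - int n)" for k n
  proof (induction k arbitrary: n)
    case 0
    then show ?case using assms cvs.subspace_0[OF subspace_wt_le] by simp
  next
    case (Suc k)
    have "exp_coeff 1 \<alpha> j (opow (exp_coeff 1 \<alpha>) k (n - j) v) \<in> wt_le (d - int n)" if "j \<le> n" for j
      using q[OF Suc[of "n - j"], of j] that by (simp add: of_nat_diff)
    then show ?case by (auto intro!: cvs.subspace_sum[OF subspace_wt_le])
  qed
  then show ?thesis
    unfolding oexp_def by (intro cvs.subspace_sum[OF subspace_wt_le] cvs.subspace_scale[OF subspace_wt_le])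
qed

lemma oexp_exp_coeff_zero:
  assumes "v \<in> wt_le d" "int n > d" shows "oexp (exp_coeff 1 \<alpha>) n v = 0"
  using oexp_exp_coeff_wt_le[OF assms(1)] assms(2) by (intro wt_le_neg[of "d - int n"]) auto

lemma r1_Eser_minus: "lin_ser (r1.Eser (- 1) \<alpha>)" "pos_ser (r1.Eser (- 1) \<alpha>)" "hol_ser (r1.Eser (- 1) \<alpha>)"
  by (simp_all add: r1_Eser lin_ser_gser clinear_oexp clinear_exp_coeff pos_ser_gser hol_ser_gser)

lemma r1_Eser_plus: "lin_ser (r1.Eser 1 \<alpha>)" "fin_ser (r1.Eser 1 \<alpha>)" "hol_ser (r1.Eser 1 \<alpha>)"
proof -
  show "lin_ser (r1.Eser 1 \<alpha>)" "hol_ser (r1.Eser 1 \<alpha>)"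
    by (simp_all add: r1_Eser lin_ser_gser clinear_oexp clinear_exp_coeff hol_ser_gser)
  have "finite {n. oexp (exp_coeff 1 \<alpha>) n v \<noteq> 0}" for v
  proof -
    obtain d where "d \<ge> 0" "v \<in> wt_le d" using ex_wt_le by blast
    have "{n. oexp (exp_coeff 1 \<alpha>) n v \<noteq> 0} \<subseteq> {..nat d}"
    proof
      fix n assume "n \<in> {n. oexp (exp_coeff 1 \<alpha>) n v \<noteq> 0}"
      then have "\<not> int n > d" using oexp_exp_coeff_zero[OF \<open>v \<in> wt_le d\<close>] by blast
      then show "n \<in> {..nat d}" by simp
    qed
    then show ?thesis by (rule finite_subset) simp
  qed
  then show "fin_ser (r1.Eser 1 \<alpha>)" by (simp add: r1_Eser fin_ser_gser)
qed

lemma r1_zpow_bas: "r1.zpow \<alpha> r s (bas (\<beta>, \<mu>)) = (if \<alpha> * \<beta> = r \<and> s = 0 then bas (\<beta>, \<mu>) else 0)"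
  by (auto simp: r1.zpow_def)

lemma r1_zpow: "lin_ser (r1.zpow \<alpha>)" "fin_ser (r1.zpow \<alpha>)" "hol_ser (r1.zpow \<alpha>)"
proof -
  show "lin_ser (r1.zpow \<alpha>)" by (simp add: lin_ser_def r1.zpow_def clinear_lin)
  have nz: "(r, s) \<in> (\<lambda>x. (\<alpha> * fst x, 0)) ` supp v" if nz0: "r1.zpow \<alpha> r s v \<noteq> 0" for r s v
  proof -
    obtain x where x: "x \<in> supp v" and nz: "scale (coef v x)
        (case x of (\<beta>, \<mu>) \<Rightarrow> if r1.ipp \<alpha> \<beta> = r \<and> r1.ipp (r1.pbar \<alpha>) (r1.pbar \<beta>) = s
        then bas (\<beta>, \<mu>) else (0::state1)) \<noteq> 0"
      using nz0 unfolding r1.zpow_def lin_def by (elim sum.not_neutral_contains_not_neutral)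
    obtain \<beta> \<mu> where x': "x = (\<beta>, \<mu>)" by (cases x)
    have "\<alpha> * \<beta> = r \<and> s = 0"
      using nz unfolding x' by (auto split: if_splits)
    then show ?thesis using x unfolding x' by force
  qed
  then show "hol_ser (r1.zpow \<alpha>)" by (fastforce simp: hol_ser_def)
  have "{(r, s). r1.zpow \<alpha> r s v \<noteq> 0} \<subseteq> (\<lambda>x. (\<alpha> * fst x, 0)) ` supp v" for v
    using nz by blast
  then show "fin_ser (r1.zpow \<alpha>)" unfolding fin_ser_def
    by (meson finite_imageI finite_keys finite_subset)
qed

text \<open>$l_{e_\alpha} z^{p\alpha} \bar z^{\bar p\alpha}$\<close>

definition charge_shift :: "real \<Rightarrow> (state1, state1) series" where
  "charge_shift \<alpha> = sconst ((*) (r1.ev \<alpha>)) \<star> r1.zpow \<alpha>"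

text \<open>$\hat Y(e_\alpha, \underline z)$\<close>

definition exp_vop :: "real \<Rightarrow> (state1, state1) series" where
  "exp_vop \<alpha> = r1.Eser (- 1) \<alpha> \<star> r1.Eser 1 \<alpha> \<star> sconst ((*) (r1.ev \<alpha>)) \<star> r1.zpow \<alpha>"

lemma lin_ser_ev: "lin_ser (sconst ((*) (r1.ev \<alpha>)))"
  by (intro lin_ser_sconst clinear_times)

lemma sprod_fin_ev_zpow: "sprod_fin (sconst ((*) (r1.ev \<alpha>))) (r1.zpow \<alpha>)"
  by (intro sprod_fin_fin lin_ser_ev r1_zpow)

lemma charge_shift: "lin_ser (charge_shift \<alpha>)" "fin_ser (charge_shift \<alpha>)" "hol_ser (charge_shift \<alpha>)"
  unfolding charge_shift_def
  by (intro lin_ser_sprod fin_ser_sprod hol_ser_sprod sprod_fin_ev_zpow lin_ser_ev r1_zpow fin_ser_sconst hol_ser_sconst)+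

lemma annihilated_shift: "lin_ser (r1.Eser 1 \<alpha> \<star> charge_shift \<alpha>)" "fin_ser (r1.Eser 1 \<alpha> \<star> charge_shift \<alpha>)" "hol_ser (r1.Eser 1 \<alpha> \<star> charge_shift \<alpha>)"
  "sprod_fin (r1.Eser 1 \<alpha>) (charge_shift \<alpha>)"
  by (intro lin_ser_sprod fin_ser_sprod hol_ser_sprod sprod_fin_fin charge_shift r1_Eser_plus)+

text \<open>
  The vertex operators of rank one are of this form.  On this class the normal ordered products
  with the current are defined, stay in the class and commute.
\<close>

definition hol_field :: "(state1, state1) series \<Rightarrow> bool" where
  "hol_field F \<longleftrightarrow> lin_ser F \<and> field_ser F \<and> hol_ser F"

lemma hol_field_exp_vop: "hol_field (exp_vop \<alpha>)"
  and sprod_fin_annihilated_shift: "sprod_fin (r1.Eser (- 1) \<alpha>) (r1.Eser 1 \<alpha> \<star> charge_shift \<alpha>)"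
  unfolding hol_field_def exp_vop_def charge_shift_def[symmetric]
  by (intro conjI lin_ser_sprod field_ser_sprod_pos hol_ser_sprod sprod_fin_pos_field fin_imp_field
      annihilated_shift r1_Eser_minus)+

lemma charge_shift_bas: "charge_shift \<alpha> r s (bas (\<beta>, \<mu>)) = (if \<alpha> * \<beta> = r \<and> s = 0 then bas (\<alpha> + \<beta>, \<mu>) else 0)"
  by (simp add: charge_shift_def sprod_sconst_left r1_zpow_bas r1.ev_def mult_single)

lemma annihilated_shift_ev: "(r1.Eser 1 \<alpha> \<star> charge_shift \<alpha>) r s (r1.ev \<beta>) = (if \<alpha> * \<beta> = r \<and> s = 0 then r1.ev (\<alpha> + \<beta>) else 0)"
proof -
  have 0: "oexp (exp_coeff 1 \<alpha>) n (r1.ev (\<alpha> + \<beta>)) = (if n = 0 then r1.ev (\<alpha> + \<beta>) else 0)" for n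
  proof (cases "n = 0")
    case False
    have "r1.ev (\<alpha> + \<beta>) \<in> wt_le 0" by (simp add: r1.ev_def wt_le_def) (simp add: wt_def)
    then show ?thesis using False by (simp add: oexp_exp_coeff_zero)
  qed (simp add: exp_coeff_0)
  have "(r1.Eser 1 \<alpha> \<star> charge_shift \<alpha>) r s (r1.ev \<beta>) = Sum_any (\<lambda>m. oexp (exp_coeff 1 \<alpha>) m (charge_shift \<alpha> (r + real m) s (r1.ev \<beta>)))"
    by (simp add: r1_Eser gser_sprod_left clinear_zero[OF clinear_oexp[OF clinear_exp_coeff]])
  also have "\<dots> = Sum_any (\<lambda>m::nat. if m = 0 then (if \<alpha> * \<beta> = r \<and> s = 0 then r1.ev (\<alpha> + \<beta>) else 0) else 0)"
    by (intro arg_cong[where f = Sum_any] ext)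
      (auto simp: 0 charge_shift_bas[of _ _ _ _ 0, folded r1.ev_def] clinear_zero[OF clinear_oexp[OF clinear_exp_coeff]])
  finally show ?thesis by simp
qed

text \<open>On a highest weight vector $E^+$ is the identity.\<close>

lemma exp_vop_ev: "exp_vop \<alpha> r s (r1.ev \<beta>) = r1.Eser (- 1) \<alpha> (r - \<alpha> * \<beta>) s (r1.ev (\<alpha> + \<beta>))"
proof -
  have "exp_vop \<alpha> r s (r1.ev \<beta>) = Sum_any (\<lambda>a. if a = (\<alpha> * \<beta>, 0::real) then r1.Eser (- 1) \<alpha> (r - \<alpha> * \<beta>) s (r1.ev (\<alpha> + \<beta>)) else 0)"
    unfolding exp_vop_def charge_shift_def[symmetric] sprod_def[of "r1.Eser (- 1) \<alpha>"] annihilated_shift_ev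
    by (intro arg_cong[where f = Sum_any] ext) (auto simp: lin_ser_zero[OF r1_Eser_minus(1)] split: if_splits)
  then show ?thesis by simp
qed

lemma exp_vop_ev_leading: "exp_vop \<alpha> (\<alpha> * \<beta>) 0 (r1.ev \<beta>) = r1.ev (\<alpha> + \<beta>)"
  by (simp add: exp_vop_ev r1_Eser gser_def exp_coeff_0)

lemma exp_vop_vac: "exp_vop \<alpha> 0 0 (r1.ev 0) = r1.ev \<alpha>" "exp_vop \<alpha> 1 0 (r1.ev 0) = scale (of_real \<alpha>) (r1.var () 0 * r1.ev \<alpha>)"
  "exp_vop \<alpha> r s (r1.ev 0) \<noteq> 0 \<Longrightarrow> r \<in> \<nat> \<and> s = 0"
proof -
  show "exp_vop \<alpha> r s (r1.ev 0) \<noteq> 0 \<Longrightarrow> r \<in> \<nat> \<and> s = 0"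
    using r1_Eser_minus(2,3) unfolding exp_vop_ev pos_ser_def hol_ser_def by simp blast
qed (simp_all add: exp_vop_ev r1_Eser gser_def exp_coeff_0, simp add: exp_coeff_def r1_osc_scale osc1_neg[of 0, simplified])

lemma exp_vop_zero: "exp_vop 0 = sconst (\<lambda>v. v)"
proof -
  have q: "exp_coeff \<sigma> 0 = (\<lambda>n v. 0)" for \<sigma> by (intro ext) (simp add: exp_coeff_def r1_osc_scale)
  have "opow (\<lambda>n v. 0) k n v = (if k = 0 \<and> n = 0 then v else (0::state1))" for k n v
    by (cases k) auto
  then have "oexp (\<lambda>n v. 0) n v = (if n = 0 then v else (0::state1))" for n v
    by (simp add: oexp_def if_distrib[of "scale _"] cong: if_cong)
  then have "gser \<sigma> (oexp (\<lambda>n v. 0 :: state1)) = spow (gser \<sigma> (\<lambda>n v. 0 :: state1)) 0" if "\<sigma> = 1 \<or> \<sigma> = - 1" for \<sigma>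
    using that by (subst spow_gser) (auto simp: gser_def fun_eq_iff)
  then have E: "r1.Eser 1 0 = sconst (\<lambda>v. v)" "r1.Eser (- 1) 0 = sconst (\<lambda>v. v)"
    by (simp_all add: r1_Eser q)
  have "(r1.ev 0 :: state1) = 1" by (simp add: r1.ev_def flip: zero_prod_def)
  then have "sconst ((*) (r1.ev 0)) = (sconst (\<lambda>v. v) :: (state1, state1) series)" by (simp add: fun_eq_iff sconst_def)
  moreover have "r1.zpow 0 = sconst (\<lambda>v. v)"
  proof (intro ext)
    fix r s v
    show "r1.zpow 0 r s v = sconst (\<lambda>v. v) r s v"
      by (rule clinear_eqI[OF lin_serD[OF r1_zpow(1)] lin_serD[OF lin_ser_sconst[OF clinear_id]]])
        (auto simp: r1_zpow_bas sconst_def)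
  qed
  ultimately show ?thesis unfolding exp_vop_def E by (simp add: sprod_id_left)
qed

section \<open>Normal ordered products with the current\<close>
lemma not_Ints_add_nat: "r \<notin> \<int> \<Longrightarrow> r + real n \<notin> \<int>"
  by (metis Ints_diff Ints_of_nat add_diff_cancel_right')

text \<open>
  $\frac{1}{n!}\partial_z^n$ of the two halves of the current $h(z)$, for the unit vector $h$.
\<close>

definition creation :: "nat \<Rightarrow> (state1, state1) series" where
  "creation n = dz_div n (r1.cur_creation 1)"

definition annihilation :: "nat \<Rightarrow> (state1, state1) series" where
  "annihilation n = dz_div n (r1.cur_annihilation 1)"

text \<open>The coefficients of $z^m$ and of $z^{-m}$ in these series.\<close>

definition creation_coeff :: "nat \<Rightarrow> nat \<Rightarrow> state1 \<Rightarrow> state1" where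
  "creation_coeff n m v = scale (pochhammer (of_nat m + 1) n / fact n) (osc1 (- int (m + n) - 1) v)"

definition annihilation_coeff :: "nat \<Rightarrow> nat \<Rightarrow> state1 \<Rightarrow> state1" where
  "annihilation_coeff n m v = (if m > n then scale (pochhammer (1 - of_nat m) n / fact n) (osc1 (int (m - n - 1)) v) else 0)"

text \<open>
  Differentiation shifts some nonnegative exponents to negative ones, but there the Pochhammer
  symbol has a factor $0$.
\<close>

lemma creation_gser: "creation n = gser (- 1) (creation_coeff n)"
proof (intro ext)
  fix r s v
  show "creation n r s v = gser (- 1) (creation_coeff n) r s v"
  proof (cases "r \<in> \<int>")
    case True
    then obtain k where k: "r = of_int k" by (auto elim: Ints_cases)
    have rn: "r + real n = of_int (k + int n)" by (simp add: k)
    have L: "creation n r s v = scale (pochhammer (of_real r + 1) n / fact n)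
        (if s = 0 then if k + int n \<ge> 0 then osc1 (- (k + int n) - 1) v else 0 else 0)"
      unfolding creation_def dz_div_apply rn r1.cur_creation_def zser_def floor_of_int osc1_def by simp
    show ?thesis
    proof (cases "k \<ge> 0")
      case True
      then obtain m where m: "k = int m" by (rule nonneg_int_cases)
      have "gser (- 1) (creation_coeff n) r s v = (if s = 0 then creation_coeff n m v else 0)"
        by (simp add: gser_def k m)
      then show ?thesis unfolding L by (simp add: creation_coeff_def k m)
    next
      case False
      then have "r \<notin> \<nat>" by (auto simp: k elim!: Nats_cases)
      then have R: "gser (- 1) (creation_coeff n) r s v = 0" by (simp add: gser_def)
      have "pochhammer (of_real r + 1 :: complex) n = 0" if "k + int n \<ge> 0"
        unfolding pochhammer_eq_0_iff
        by (rule exI[of _ "nat (- k - 1)"]) (use that False in \<open>auto simp: k\<close>)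
      then show ?thesis unfolding L R by auto
    qed
  next
    case False
    then have "r \<notin> \<nat>" using Nats_subset_Ints by blast
    then show ?thesis using not_Ints_add_nat[OF False]
      by (simp add: creation_def dz_div_apply r1.cur_creation_def zser_def gser_def)
  qed
qed

lemma annihilation_gser: "annihilation n = gser 1 (annihilation_coeff n)"
proof (intro ext)
  fix r s v
  show "annihilation n r s v = gser 1 (annihilation_coeff n) r s v"
  proof (cases "r \<in> \<int>")
    case True
    then obtain k where k: "r = of_int k" by (auto elim: Ints_cases)
    have rn: "r + real n = of_int (k + int n)" by (simp add: k)
    have L: "annihilation n r s v = scale (pochhammer (of_real r + 1) n / fact n)
        (if s = 0 then if k + int n < 0 then osc1 (- (k + int n) - 1) v else 0 else 0)"
      unfolding annihilation_def dz_div_apply rn r1.cur_annihilation_def zser_def floor_of_int osc1_def by simp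
    show ?thesis
    proof (cases "k \<le> 0")
      case True
      then obtain m where m: "k = - int m" using nonpos_int_cases by blast
      have R: "gser 1 (annihilation_coeff n) r s v = (if s = 0 then annihilation_coeff n m v else 0)"
        by (simp add: gser_def k m)
      show ?thesis
      proof (cases "m > n")
        case True
        then have "- (k + int n) - 1 = int (m - n - 1)" by (simp add: m)
        then show ?thesis unfolding L R using True by (simp add: annihilation_coeff_def k m algebra_simps)
      qed (simp add: L R m annihilation_coeff_def)
    next
      case False
      then have "- r \<notin> \<nat>" by (auto simp: k elim!: Nats_cases)
      then show ?thesis unfolding L using False by (simp add: gser_def)
    qed
  next
    case False
    then have "- r \<notin> \<int>" by (metis Ints_minus minus_minus)
    then have "- r \<notin> \<nat>" using Nats_subset_Ints by blast
    then show ?thesis using not_Ints_add_nat[OF False]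
      by (simp add: annihilation_def dz_div_apply r1.cur_annihilation_def zser_def gser_def)
  qed
qed

lemma clinear_creation_coeff: "clinear (creation_coeff n m)"
  unfolding creation_coeff_def[abs_def] by (intro clinear_scaled clinear_osc1)

lemma clinear_annihilation_coeff: "clinear (annihilation_coeff n m)"
proof (cases "m > n")
  case True
  then have "annihilation_coeff n m = (\<lambda>v. scale (pochhammer (1 - of_nat m) n / fact n) (osc1 (int (m - n - 1)) v))"
    by (simp add: annihilation_coeff_def fun_eq_iff)
  then show ?thesis using clinear_scaled[OF clinear_osc1] by metis
next
  case False
  then have "annihilation_coeff n m = (\<lambda>v. 0)" by (simp add: annihilation_coeff_def fun_eq_iff)
  then show ?thesis using clinear_zero_fun by metis
qed

lemmas creation_coeff_0 [simp] = clinear_zero[OF clinear_creation_coeff]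
  and annihilation_coeff_0 [simp] = clinear_zero[OF clinear_annihilation_coeff]

lemma creation_coeff_commute: "creation_coeff n i (creation_coeff m j v) = creation_coeff m j (creation_coeff n i v)"
  unfolding creation_coeff_def
  by (simp only: osc1_scale cvs.scale_scale osc1_creation_commute[of "i + n" "j + m"]) (simp add: mult.commute)

lemma annihilation_coeff_commute: "annihilation_coeff n i (annihilation_coeff m j v) = annihilation_coeff m j (annihilation_coeff n i v)"
proof -
  have "osc1 (int (i - n - 1)) (osc1 (int (j - m - 1)) v) = osc1 (int (j - m - 1)) (osc1 (int (i - n - 1)) v)"
    by (rule osc1_annihilation_commute) auto
  then show ?thesis by (simp add: annihilation_coeff_def osc1_scale mult.commute del: of_nat_diff)
qed

lemma annihilation_coeff_eventually_zero: "\<exists>M. \<forall>j>M. annihilation_coeff n j v = 0"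
proof -
  obtain M where "\<forall>j>M. osc1 (int j) v = 0" using osc1_eventually_zero by blast
  then show ?thesis by (intro exI[of _ "M + n + 1"]) (simp add: annihilation_coeff_def del: of_nat_diff)
qed

lemma creation: "lin_ser (creation n)" "pos_ser (creation n)" "hol_ser (creation n)"
  unfolding creation_gser by (intro lin_ser_gser clinear_creation_coeff pos_ser_gser hol_ser_gser)+

lemma annihilation: "lin_ser (annihilation n)" "fin_ser (annihilation n)" "hol_ser (annihilation n)"
proof -
  have "finite {j. annihilation_coeff n j v \<noteq> 0}" for v
  proof -
    obtain M where "\<forall>j>M. annihilation_coeff n j v = 0" using annihilation_coeff_eventually_zero by blast
    then have "{j. annihilation_coeff n j v \<noteq> 0} \<subseteq> {..M}" by (auto simp: not_less[symmetric])
    then show ?thesis by (rule finite_subset) simp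
  qed
  then show "fin_ser (annihilation n)" unfolding annihilation_gser by (intro fin_ser_gser) auto
qed (simp_all add: annihilation_gser lin_ser_gser clinear_annihilation_coeff hol_ser_gser)

text \<open>The normal ordered product of $\frac{1}{n!}\partial_z^n h(z)$ with \<open>F\<close>.\<close>

definition current_prod :: "nat \<Rightarrow> (state1, state1) series \<Rightarrow> (state1, state1) series" where
  "current_prod n F = sadd (creation n \<star> F) (F \<star> annihilation n)"

lemma sprod_fin_current_prod: "hol_field F \<Longrightarrow> sprod_fin (creation n) F" "hol_field F \<Longrightarrow> sprod_fin F (annihilation n)"
  unfolding hol_field_def by (auto intro: sprod_fin_pos_field sprod_fin_fin creation annihilation)

lemma hol_field_creation: "hol_field F \<Longrightarrow> hol_field (creation n \<star> F)"
  and hol_field_annihilation: "hol_field F \<Longrightarrow> hol_field (F \<star> annihilation n)"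
proof -
  assume F: "hol_field F"
  then have "lin_ser F" "field_ser F" "hol_ser F" by (auto simp: hol_field_def)
  with sprod_fin_current_prod[OF F, of n] creation[of n] annihilation[of n]
  show "hol_field (creation n \<star> F)" "hol_field (F \<star> annihilation n)"
    unfolding hol_field_def by (blast intro: lin_ser_sprod field_ser_sprod_pos field_ser_sprod_fin hol_ser_sprod)+
qed

lemma hol_field_sadd: "hol_field F \<Longrightarrow> hol_field G \<Longrightarrow> hol_field (sadd F G)"
  by (auto simp: hol_field_def intro: lin_ser_sadd field_ser_sadd hol_ser_sadd)

lemma hol_field_current_prod: "hol_field F \<Longrightarrow> hol_field (current_prod n F)"
  unfolding current_prod_def by (intro hol_field_sadd hol_field_creation hol_field_annihilation)

lemma creation_sprod: "(creation n \<star> F) r s v = Sum_any (\<lambda>m. creation_coeff n m (F (r - real m) s v))"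
  by (simp add: creation_gser gser_sprod_left)

lemma sprod_annihilation: "lin_ser F \<Longrightarrow> (F \<star> annihilation n) r s v = Sum_any (\<lambda>m. F (r + real m) s (annihilation_coeff n m v))"
  by (simp add: annihilation_gser gser_sprod_right)

lemma creation_sprod_finite:
  assumes "\<And>k. k > N \<Longrightarrow> F (r - real k) s v = 0"
  shows "(creation n \<star> F) r s v = (\<Sum>m\<le>N. creation_coeff n m (F (r - real m) s v))"
  unfolding creation_sprod by (rule Sum_any_finite) (simp add: assms)

lemma sprod_annihilation_finite:
  assumes "lin_ser F" "\<And>k. k > M \<Longrightarrow> annihilation_coeff n k v = 0"
  shows "(F \<star> annihilation n) r s v = (\<Sum>m\<le>M. F (r + real m) s (annihilation_coeff n m v))"
  unfolding sprod_annihilation[OF assms(1)] by (rule Sum_any_finite) (simp add: assms)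

lemma creation_creation:
  assumes "hol_field F" shows "creation n \<star> creation m \<star> F = creation m \<star> creation n \<star> F"
proof (intro ext)
  fix r s v
  obtain N where N: "\<forall>k>N. F (r - real k) s v = 0"
    using field_ser_bound[of F r s v] assms by (auto simp: hol_field_def)
  have e: "r - real i - real j = r - real (i + j)" for i j by simp
  have 1: "(creation n \<star> F) (r - real i) s v = (\<Sum>j\<le>N. creation_coeff n j (F (r - real (i + j)) s v))" for n i
    using N by (subst creation_sprod_finite[of N]) (simp_all only: e trans_less_add2)
  have 2: "(creation n \<star> F) (r - real i) s v = 0" if "i > N" for n i
    unfolding 1 using N that by (simp only: trans_less_add1 creation_coeff_0) simp
  have 3: "(creation n \<star> creation m \<star> F) r s v = (\<Sum>i\<le>N. \<Sum>j\<le>N. creation_coeff n i (creation_coeff m j (F (r - real (i + j)) s v)))" for n m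
    using creation_sprod_finite[of N "creation m \<star> F" r s v n, OF 2] by (simp only: 1 clinear_sum[OF clinear_creation_coeff])
  show "(creation n \<star> creation m \<star> F) r s v = (creation m \<star> creation n \<star> F) r s v"
    unfolding 3 by (subst sum.swap) (simp only: creation_coeff_commute[of n] add.commute)
qed

lemma annihilation_annihilation:
  assumes "hol_field F" shows "(F \<star> annihilation m) \<star> annihilation n = (F \<star> annihilation n) \<star> annihilation m"
proof (intro ext)
  fix r s v
  have F: "lin_ser F" using assms by (simp add: hol_field_def)
  have *: "\<exists>M. \<forall>k>M. annihilation_coeff n k v = 0 \<and> annihilation_coeff m k v = 0"
    using annihilation_coeff_eventually_zero[of n v] annihilation_coeff_eventually_zero[of m v] by (metis max_less_iff_conj)
  then obtain M where M: "\<And>k. k > M \<Longrightarrow> annihilation_coeff n k v = 0" "\<And>k. k > M \<Longrightarrow> annihilation_coeff m k v = 0" by blast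
  have 3: "((F \<star> annihilation m) \<star> annihilation n) r s v = (\<Sum>i\<le>M. \<Sum>j\<le>M. F (r + real (i + j)) s (annihilation_coeff m j (annihilation_coeff n i v)))"
    if M: "\<And>k. k > M \<Longrightarrow> annihilation_coeff n k v = 0" "\<And>k. k > M \<Longrightarrow> annihilation_coeff m k v = 0" for n m
  proof -
    have "(F \<star> annihilation m) (r + real i) s (annihilation_coeff n i v) = (\<Sum>j\<le>M. F (r + real (i + j)) s (annihilation_coeff m j (annihilation_coeff n i v)))" for i
    proof -
      have "annihilation_coeff m k (annihilation_coeff n i v) = 0" if "k > M" for k
        using M(2)[OF that] by (simp add: annihilation_coeff_commute[of m k])
      from sprod_annihilation_finite[OF F this, where r = "r + real i" and s = s] show ?thesis by (simp add: add.assoc)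
    qed
    then show ?thesis
      using sprod_annihilation_finite[of "F \<star> annihilation m" M n v r s] hol_field_annihilation[OF assms, of m] M(1) by (simp add: hol_field_def)
  qed
  show "((F \<star> annihilation m) \<star> annihilation n) r s v = ((F \<star> annihilation n) \<star> annihilation m) r s v"
  proof -
    have "((F \<star> annihilation m) \<star> annihilation n) r s v = (\<Sum>i\<le>M. \<Sum>j\<le>M. F (r + real (i + j)) s (annihilation_coeff m j (annihilation_coeff n i v)))"
      by (rule 3[OF M])
    also have "\<dots> = (\<Sum>j\<le>M. \<Sum>i\<le>M. F (r + real (j + i)) s (annihilation_coeff n i (annihilation_coeff m j v)))"
      by (subst sum.swap) (simp only: annihilation_coeff_commute[of n] add.commute)
    also have "\<dots> = ((F \<star> annihilation n) \<star> annihilation m) r s v"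
      by (rule 3[OF M(2,1), symmetric])
    finally show ?thesis .
  qed
qed

lemma creation_annihilation:
  assumes "hol_field F" shows "creation n \<star> (F \<star> annihilation m) = (creation n \<star> F) \<star> annihilation m"
proof (intro ext)
  fix r s v
  have F: "lin_ser F" "lin_ser (creation n \<star> F)" using assms hol_field_creation by (auto simp: hol_field_def)
  obtain M where M: "\<And>k. k > M \<Longrightarrow> annihilation_coeff m k v = 0"
    using annihilation_coeff_eventually_zero by blast
  have "\<exists>N. \<forall>k>N. F (r + real j - real k) s (annihilation_coeff m j v) = 0" for j
    using field_ser_bound[of F "r + real j" s "annihilation_coeff m j v"] assms by (auto simp: hol_field_def)
  then obtain N' where N': "\<And>j k. k > N' j \<Longrightarrow> F (r + real j - real k) s (annihilation_coeff m j v) = 0" by metis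
  define N where "N = (\<Sum>j\<le>M. N' j)"
  have N: "F (r + real j - real k) s (annihilation_coeff m j v) = 0" if "k > N" for j k
  proof (cases "j \<le> M")
    case True
    then have "N' j \<le> N" unfolding N_def by (intro member_le_sum) auto
    then show ?thesis using that by (intro N') simp
  next
    case False
    then show ?thesis using M F(1) by simp
  qed
  have 1: "(F \<star> annihilation m) (r - real i) s v = (\<Sum>j\<le>M. F (r + real j - real i) s (annihilation_coeff m j v))" for i
    using sprod_annihilation_finite[OF F(1) M, where r = "r - real i" and s = s] by (simp add: algebra_simps)
  have "(creation n \<star> (F \<star> annihilation m)) r s v = (\<Sum>i\<le>N. creation_coeff n i (\<Sum>j\<le>M. F (r + real j - real i) s (annihilation_coeff m j v)))"
  proof -
    have "(F \<star> annihilation m) (r - real k) s v = 0" if "k > N" for k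
      using N[OF that] by (simp add: 1)
    from creation_sprod_finite[of N "F \<star> annihilation m" r s v n, OF this] show ?thesis by (simp only: 1)
  qed
  also have "\<dots> = (\<Sum>j\<le>M. \<Sum>i\<le>N. creation_coeff n i (F (r + real j - real i) s (annihilation_coeff m j v)))"
    by (subst sum.swap) (simp only: clinear_sum[OF clinear_creation_coeff])
  also have "\<dots> = (\<Sum>j\<le>M. (creation n \<star> F) (r + real j) s (annihilation_coeff m j v))"
    by (intro sum.cong refl creation_sprod_finite[symmetric] N)
  also have "\<dots> = ((creation n \<star> F) \<star> annihilation m) r s v"
    by (intro sprod_annihilation_finite[OF F(2), symmetric] M)
  finally show "(creation n \<star> (F \<star> annihilation m)) r s v = ((creation n \<star> F) \<star> annihilation m) r s v" .
qed

lemma current_prod_sadd: "hol_field F \<Longrightarrow> hol_field G \<Longrightarrow> current_prod n (sadd F G) = sadd (current_prod n F) (current_prod n G)"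
  using sprod_sadd_right[of "creation n" F G] sprod_sadd_left[of F "annihilation n" G] sprod_fin_current_prod creation(1)[of n]
  by (simp add: current_prod_def) (simp add: sadd_def fun_eq_iff ac_simps)

lemma current_prod_sscale: "hol_field F \<Longrightarrow> current_prod n (sscale c F) = sscale c (current_prod n F)"
  using sprod_sscale_right[of "creation n" F c] sprod_sscale_left[of F "annihilation n" c] sprod_fin_current_prod creation(1)[of n]
  by (simp add: current_prod_def) (simp add: sadd_def sscale_def fun_eq_iff cvs.scale_right_distrib)

text \<open>
  Creation operators commute with each other, and so do annihilation operators.  The former
  are multiplied from the left and the latter from the right, so a creation operator meets an annihilation
  operator only across the field, where associativity of the product is the interchange of two finite sums.
\<close>

lemma current_prod_commute:
  assumes F: "hol_field F" shows "current_prod n (current_prod m F) = current_prod m (current_prod n F)"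
proof -
  have *: "current_prod n (current_prod m F) = sadd (sadd (creation n \<star> creation m \<star> F) ((creation m \<star> F) \<star> annihilation n))
      (sadd ((creation n \<star> F) \<star> annihilation m) ((F \<star> annihilation m) \<star> annihilation n))" for n m
    unfolding current_prod_def[of m] current_prod_sadd[OF hol_field_creation[OF F] hol_field_annihilation[OF F]] unfolding current_prod_def
    by (simp add: creation_annihilation[OF F])
  show ?thesis
    unfolding *[of n m] *[of m n] creation_creation[OF F, of n m] annihilation_annihilation[OF F, of n m]
    by (simp add: sadd_def fun_eq_iff ac_simps)
qed

section \<open>The vertex operators in rank one\<close>

text \<open>
  Folding over a multiset requires commutation on all series.  Outside of the class in which
  \<open>current_prod_commute\<close> holds the identity is taken.
\<close>

definition guarded_prod :: "nat \<Rightarrow> (state1, state1) series \<Rightarrow> (state1, state1) series" where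
  "guarded_prod n F = (if hol_field F then current_prod n F else F)"

interpretation guarded_prod: comp_fun_commute guarded_prod
  by unfold_locales (auto simp: guarded_prod_def hol_field_current_prod current_prod_commute fun_eq_iff)

text \<open>In rank one a monomial is the multiset of the indices of its variables.\<close>

definition mset_of :: "unit monomial \<Rightarrow> nat multiset" where
  "mset_of \<mu> = Abs_multiset (\<lambda>n. coef \<mu> ((), n))"

lemma count_mset_of: "count (mset_of \<mu>) n = coef \<mu> ((), n)"
proof -
  have "{n. 0 < coef \<mu> ((), n)} \<subseteq> snd ` supp \<mu>"
    by (force simp: in_keys_iff)
  then have "finite {n. 0 < coef \<mu> ((), n)}" by (rule finite_subset) simp
  then show ?thesis by (simp add: mset_of_def count_Abs_multiset)
qed

lemma mset_of_0: "mset_of 0 = {#}"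
  by (rule multiset_eqI) (simp add: count_mset_of)

lemma mset_of_X1: "mset_of (X1 n + \<mu>) = add_mset n (mset_of \<mu>)"
  by (rule multiset_eqI) (simp add: count_mset_of lookup_add lookup_single when_def)

definition Yfold_mset :: "real \<Rightarrow> nat multiset \<Rightarrow> (state1, state1) series" where
  "Yfold_mset \<alpha> M = fold_mset guarded_prod (exp_vop \<alpha>) M"

lemma hol_field_Yfold_mset: "hol_field (Yfold_mset \<alpha> M)"
  by (induction M) (simp_all add: Yfold_mset_def hol_field_exp_vop, simp add: guarded_prod_def hol_field_current_prod)

lemma Yfold_mset_add: "Yfold_mset \<alpha> (add_mset n M) = current_prod n (Yfold_mset \<alpha> M)"
  using hol_field_Yfold_mset[of \<alpha> M] by (simp add: Yfold_mset_def) (simp add: guarded_prod_def)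

text \<open>The vertex operator obtained by taking the factors of each monomial in any order.\<close>

definition Yfold :: "state1 \<Rightarrow> (state1, state1) series" where
  "Yfold a r s v = lin (\<lambda>(\<alpha>, \<mu>). Yfold_mset \<alpha> (mset_of \<mu>) r s v) a"

lemma clinear_Yfold: "clinear (\<lambda>a. Yfold a r s v)"
  unfolding Yfold_def by (rule clinear_lin)

lemma Yfold_add: "Yfold (a + b) = sadd (Yfold a) (Yfold b)"
  and Yfold_scale: "Yfold (scale c a) = sscale c (Yfold a)"
  by (simp_all add: fun_eq_iff sadd_def sscale_def clinear_add[OF clinear_Yfold] clinear_scale[OF clinear_Yfold])

lemma Yfold_zero: "Yfold 0 = (\<lambda>r s v. 0)"
  by (simp add: fun_eq_iff clinear_zero[OF clinear_Yfold])

lemma Yfold_bas: "Yfold (bas (\<alpha>, \<mu>)) = Yfold_mset \<alpha> (mset_of \<mu>)"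
  by (simp add: Yfold_def fun_eq_iff)

lemma hol_field_zero: "hol_field (\<lambda>r s v. 0)"
  by (auto simp: hol_field_def lin_ser_def field_ser_def hol_ser_def clinear_zero_fun)

lemma hol_field_sscale: "hol_field F \<Longrightarrow> hol_field (sscale c F)"
  by (auto simp: hol_field_def lin_ser_sscale field_ser_sscale) (auto simp: hol_ser_def sscale_def)

lemma hol_field_Yfold: "hol_field (Yfold a)"
proof (induction a rule: vec_induct)
  case (bas c x)
  then show ?case by (cases x) (simp add: Yfold_scale Yfold_bas hol_field_sscale hol_field_Yfold_mset)
qed (simp_all add: Yfold_zero hol_field_zero Yfold_add hol_field_sadd)

lemma current_prod_zero: "current_prod n (\<lambda>r s v. 0) = (\<lambda>r s v. 0)"
  by (simp add: fun_eq_iff current_prod_def sadd_def sprod_def lin_ser_zero[OF creation(1)])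

lemma var_add: "r1.var () n * (a + b) = r1.var () n * a + r1.var () n * b"
  and var_scale: "r1.var () n * scale c a = scale c (r1.var () n * a)"
  using clinear_add[OF clinear_times] clinear_scale[OF clinear_times] by metis+

lemma Yfold_var: "Yfold (r1.var () n * a) = current_prod n (Yfold a)"
proof (induction a rule: vec_induct)
  case zero
  then show ?case by (simp add: Yfold_zero current_prod_zero)
next
  case (add u v)
  then show ?case by (simp add: var_add Yfold_add current_prod_sadd hol_field_Yfold)
next
  case (bas c x)
  then show ?case
    by (cases x) (simp add: var_scale Yfold_scale current_prod_sscale hol_field_Yfold r1_var_bas Yfold_bas
        mset_of_X1[simplified] Yfold_mset_add hol_field_Yfold_mset)
qed

lemma Yfold_ev: "Yfold (r1.ev \<alpha>) = exp_vop \<alpha>"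
  by (simp add: r1.ev_def Yfold_bas mset_of_0 Yfold_mset_def)

lemma dz_div_sscale: "dz_div n (sscale c F) = sscale c (dz_div n F)"
  by (simp add: fun_eq_iff dz_div_apply sscale_def mult.commute)

lemma creation_scale: "dz_div n (r1.cur_creation h) = sscale (of_real h) (creation n)"
  and annihilation_scale: "dz_div n (r1.cur_annihilation h) = sscale (of_real h) (annihilation n)"
proof -
  have "r1.cur_creation h = sscale (of_real h) (r1.cur_creation 1)"
    "r1.cur_annihilation h = sscale (of_real h) (r1.cur_annihilation 1)"
    by (auto simp: fun_eq_iff r1.cur_creation_def r1.cur_annihilation_def zser_def sscale_def
        r1_osc_scale[of h] osc1_def)
  then show "dz_div n (r1.cur_creation h) = sscale (of_real h) (creation n)"
    "dz_div n (r1.cur_annihilation h) = sscale (of_real h) (annihilation n)"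
    by (simp_all add: creation_def annihilation_def dz_div_sscale)
qed

lemma r1_rule:
  assumes "hol_field F"
  shows "sadd (dz_div n (r1.cur_creation h) \<star> F) (F \<star> dz_div n (r1.cur_annihilation h)) =
    sscale (of_real h) (current_prod n F)"
proof -
  have F: "lin_ser F" using assms by (simp add: hol_field_def)
  show ?thesis
    using sprod_sscale_left[OF sprod_fin_current_prod(1)[OF assms, of n], of "of_real h"]
      sprod_sscale_right[OF F sprod_fin_current_prod(2)[OF assms, of n], of "of_real h"]
    unfolding creation_scale annihilation_scale current_prod_def
    by (simp add: sadd_def sscale_def fun_eq_iff cvs.scale_right_distrib)
qed

text \<open>
  Each rule of the relation is an identity satisfied by \<open>Yfold\<close>.  A vector
  $h$ in the kernel of the projection is $0$ here, so the antichiral rule only yields the zero series.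
\<close>

lemma vop_imp_Yfold: "r1.vop a F \<Longrightarrow> F = Yfold a"
proof (induction rule: r1.vop.induct)
  case (vop_ev \<alpha>)
  show ?case unfolding Yfold_ev exp_vop_def ..
next
  case (vop_chiral h v F n)
  then show ?case
    by (simp add: r1_rule hol_field_Yfold r1_osc_scale osc1_neg Yfold_scale Yfold_var)
next
  case (vop_antichiral h v F n)
  then have "h = 0" by simp
  then have "dz_div n (r1.cur_creation h) = (\<lambda>r s v. 0)" "dz_div n (r1.cur_annihilation h) = (\<lambda>r s v. 0)"
    by (simp_all add: creation_scale annihilation_scale sscale_def fun_eq_iff)
  moreover have "lin_ser F" using vop_antichiral hol_field_Yfold by (simp add: hol_field_def)
  ultimately show ?case using \<open>h = 0\<close>
    by (simp add: r1_osc_scale Yfold_zero fun_eq_iff sadd_def sprod_def sconj_def)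
qed (simp_all add: Yfold_add Yfold_scale)

lemma vop_Yfold: "r1.vop a (Yfold a)"
proof (induction a rule: vec_induct)
  case zero
  have "r1.vop (scale 0 (r1.ev 0)) (sscale 0 (exp_vop 0))"
    unfolding exp_vop_def by (rule r1.vop_scale[OF r1.vop_ev])
  moreover have "sscale 0 (exp_vop 0) = Yfold 0" by (simp add: Yfold_zero fun_eq_iff sscale_def)
  ultimately show ?case by simp
next
  case (add u v)
  then show ?case by (simp add: Yfold_add r1.vop_add)
next
  case (bas c x)
  obtain \<alpha> \<mu> where x: "x = (\<alpha>, \<mu>)" by (cases x)
  have "r1.vop (bas (\<alpha>, \<mu>)) (Yfold (bas (\<alpha>, \<mu>)))"
  proof (induction \<mu> rule: monomial_induct)
    case zero
    show ?case using r1.vop_ev[of \<alpha>] unfolding exp_vop_def[symmetric] by (simp add: Yfold_ev flip: r1.ev_def)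
  next
    case (single k \<mu>)
    obtain n where k: "k = ((), n)" by (cases k) auto
    have "r1.vop (r1.osc 1 (- int n - 1) (bas (\<alpha>, \<mu>))) (sscale (of_real 1) (current_prod n (Yfold (bas (\<alpha>, \<mu>)))))"
      using r1.vop_chiral[OF _ single, of 1 n] unfolding r1_rule[OF hol_field_Yfold] by simp
    moreover have "sscale 1 (current_prod n (Yfold (bas (\<alpha>, \<mu>)))) = Yfold (bas (\<alpha>, X1 n + \<mu>))"
      unfolding r1_var_bas[symmetric] Yfold_var by (simp add: sscale_def fun_eq_iff)
    ultimately show ?case unfolding k
      by (simp only: osc1_def[symmetric] osc1_bas of_real_1)
  qed
  then show ?case unfolding x Yfold_scale by (rule r1.vop_scale)
qed

lemma Y1_eq: "Y1 = Yfold"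
  unfolding Y1_def r1.Yhat_def
  by (intro ext) (metis (mono_tags, lifting) the_equality vop_Yfold vop_imp_Yfold)

lemma Y1_ev: "Y1 (r1.ev \<alpha>) = exp_vop \<alpha>"
  and Y1_var: "Y1 (r1.var () n * a) = current_prod n (Y1 a)"
  and hol_field_Y1: "hol_field (Y1 a)"
  and clinear_Y1_left: "clinear (\<lambda>a. Y1 a r s v)"
  unfolding Y1_eq by (rule Yfold_ev Yfold_var hol_field_Yfold clinear_Yfold)+

lemma lin_ser_Y1: "lin_ser (Y1 a)"
  and hol_ser_Y1: "hol_ser (Y1 a)"
  and field_ser_Y1: "field_ser (Y1 a)"
  using hol_field_Y1 by (auto simp: hol_field_def)

lemma clinear_Y1_right: "clinear (Y1 a r s)"
  by (rule lin_serD[OF lin_ser_Y1])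

lemma Y1_nonhol: "s \<noteq> 0 \<Longrightarrow> Y1 a r s v = 0"
  using hol_ser_Y1 unfolding hol_ser_def by blast

lemma Y1_vac: "Y1 (r1.ev 0) r s v = (if r = 0 \<and> s = 0 then v else 0)"
  by (simp add: Y1_ev exp_vop_zero sconst_def)

lemma Y1_ev_leading: "Y1 (r1.ev \<alpha>) (\<alpha> * \<beta>) 0 (r1.ev \<beta>) = r1.ev (\<alpha> + \<beta>)"
  by (simp add: Y1_ev exp_vop_ev_leading)

lemma current_prod_apply:
  assumes "hol_field F"
  shows "current_prod n F r s v = Sum_any (\<lambda>m. creation_coeff n m (F (r - real m) s v)) + Sum_any (\<lambda>m. F (r + real m) s (annihilation_coeff n m v))"
  using assms by (simp add: current_prod_def sadd_def creation_sprod sprod_annihilation hol_field_def)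

text \<open>
  The modes of the state $h(-1)\mathbf 1$ are the oscillators.  Thus submodules over the rank one
  algebras are stable under the oscillators.
\<close>

lemma Y1_current: "Y1 (r1.var () 0 * r1.ev 0) (of_int (- m - 1)) 0 v = osc1 m v"
proof -
  have Y: "Y1 (r1.var () 0 * r1.ev 0) = sadd (creation 0) (annihilation 0)"
    unfolding Y1_var Y1_ev exp_vop_zero current_prod_def by (simp add: sprod_id_left sprod_id_right creation)
  show ?thesis
  proof (cases "m < 0")
    case True
    then obtain k where k: "- m - 1 = int k" using nonneg_int_cases[of "- m - 1"] by auto
    have m: "m = - int k - 1" using k by simp
    have "gser 1 (annihilation_coeff 0) (real k) 0 v = 0"
      by (auto simp: gser_def annihilation_coeff_def elim!: Nats_cases)
    moreover have "gser (- 1) (creation_coeff 0) (real k) 0 v = osc1 m v"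
      by (simp add: gser_def creation_coeff_def m)
    ultimately show ?thesis unfolding Y sadd_def creation_gser annihilation_gser k by simp
  next
    case False
    then obtain k where k: "m = int k" using nonneg_int_cases[of m] by auto
    have r: "(of_int (- m - 1) :: real) = - real (Suc k)" by (simp add: k)
    have "- real (Suc k) \<notin> \<nat>" by (auto elim!: Nats_cases)
    then have "gser (- 1) (creation_coeff 0) (- real (Suc k)) 0 v = 0"
      by (simp add: gser_def)
    moreover have "gser 1 (annihilation_coeff 0) (- 1 * real (Suc k)) 0 v = annihilation_coeff 0 (Suc k) v"
      by (rule gser_at) simp
    ultimately show ?thesis unfolding Y sadd_def creation_gser annihilation_gser r by (simp add: annihilation_coeff_def k)
  qed
qed

lemma state1_induct [case_names zero add scale ev var]:
  assumes "P 0" "\<And>u v. P u \<Longrightarrow> P v \<Longrightarrow> P (u + v)" "\<And>c u. P u \<Longrightarrow> P (scale c u)"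
    and "\<And>\<alpha>. P (r1.ev \<alpha>)" "\<And>n u. P u \<Longrightarrow> P (r1.var () n * u)"
  shows "P (a :: state1)"
proof (induction a rule: vec_induct)
  case (bas c x)
  obtain \<alpha> \<mu> where x: "x = (\<alpha>, \<mu>)" by (cases x)
  have "P (bas (\<alpha>, \<mu>))"
  proof (induction \<mu> rule: monomial_induct)
    case zero
    show ?case using assms(4)[of \<alpha>] by (simp add: r1.ev_def)
  next
    case (single k \<mu>)
    obtain n where k: "k = ((), n)" by (cases k) auto
    show ?case using assms(5)[OF single, of n] unfolding k r1_var_bas .
  qed
  then show ?case unfolding x by (rule assms(3))
qed (auto intro: assms)

section \<open>Charges in rank one\<close>

lemma fock_sum_eq: "fock.fock_sum S = supp_on (S \<times> UNIV)"
  by (auto simp: fock.fock_sum_def supp_on_def)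

abbreviation charge :: "real \<Rightarrow> state1 set" where
  "charge \<beta> \<equiv> supp_on ({\<beta>} \<times> UNIV)"

definition charged :: "real \<Rightarrow> (state1, state1) series \<Rightarrow> bool" where
  "charged \<gamma> F \<longleftrightarrow> (\<forall>\<beta> r s. \<forall>w\<in>charge \<beta>. F r s w \<in> charge (\<gamma> + \<beta>))"

lemma osc1_charge: "w \<in> charge \<beta> \<Longrightarrow> osc1 m w \<in> charge \<beta>"
proof (erule clinear_image_supp_on[OF clinear_osc1 subspace_supp_on])
  fix x :: "real \<times> unit monomial" assume "x \<in> {\<beta>} \<times> UNIV"
  then obtain \<mu> where x: "x = (\<beta>, \<mu>)" by auto
  show "osc1 m (bas x) \<in> charge \<beta>"
    by (cases m rule: int_cases3)
      (auto simp: x osc1_bas intro!: cvs.subspace_scale[OF subspace_supp_on])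
qed

lemma charged_gser:
  assumes "\<And>n w \<beta>. w \<in> charge \<beta> \<Longrightarrow> c n w \<in> charge \<beta>" shows "charged 0 (gser \<sigma> c)"
  using assms cvs.subspace_0[OF subspace_supp_on] by (auto simp: charged_def gser_def)

lemma charged_sprod:
  assumes "charged \<gamma> F" "charged \<delta> G" shows "charged (\<gamma> + \<delta>) (F \<star> G)"
  unfolding charged_def sprod_def
proof (intro allI ballI subspace_Sum_any[OF subspace_supp_on])
  fix \<beta> r s :: real and w and a :: "real \<times> real" assume w: "w \<in> charge \<beta>"
  obtain r' s' where a: "a = (r', s')" by (cases a)
  have "G r' s' w \<in> charge (\<delta> + \<beta>)" using assms(2) w unfolding charged_def by blast
  then have "F (r - r') (s - s') (G r' s' w) \<in> charge (\<gamma> + (\<delta> + \<beta>))"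
    using assms(1) unfolding charged_def by blast
  then show "(case a of (r', s') \<Rightarrow> F (r - r') (s - s') (G r' s' w)) \<in> charge (\<gamma> + \<delta> + \<beta>)"
    by (simp add: a add.assoc)
qed

lemma charged_sadd: "charged \<gamma> F \<Longrightarrow> charged \<gamma> G \<Longrightarrow> charged \<gamma> (sadd F G)"
  by (auto simp: charged_def sadd_def intro!: cvs.subspace_add[OF subspace_supp_on])

lemma oexp_charge:
  assumes "\<And>n w. w \<in> charge \<beta> \<Longrightarrow> c n w \<in> charge \<beta>" "w \<in> charge \<beta>"
  shows "oexp c n w \<in> charge \<beta>"
proof -
  have "opow c k n w \<in> charge \<beta>" for k n
    by (induction k arbitrary: n)
      (auto simp: assms(2) cvs.subspace_0[OF subspace_supp_on] intro!: cvs.subspace_sum[OF subspace_supp_on] assms(1))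
  then show ?thesis
    by (auto simp: oexp_def intro!: cvs.subspace_sum[OF subspace_supp_on] cvs.subspace_scale[OF subspace_supp_on])
qed

lemma charged_Eser:
  assumes "\<sigma> = 1 \<or> \<sigma> = - 1" shows "charged 0 (r1.Eser \<sigma> \<alpha>)"
proof -
  have "exp_coeff \<sigma> \<alpha> n w \<in> charge \<beta>" if "w \<in> charge \<beta>" for n w \<beta>
    using osc1_charge[OF that]
    by (auto simp: exp_coeff_def r1_osc_scale intro!: cvs.subspace_neg[OF subspace_supp_on]
        cvs.subspace_scale[OF subspace_supp_on] cvs.subspace_0[OF subspace_supp_on])
  then show ?thesis
    unfolding r1_Eser[OF assms] by (intro charged_gser oexp_charge)
qed

lemma charged_charge_shift: "charged \<alpha> (charge_shift \<alpha>)"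
  unfolding charged_def
proof (intro allI ballI)
  fix \<beta> r s w assume "w \<in> charge \<beta>"
  then show "charge_shift \<alpha> r s w \<in> charge (\<alpha> + \<beta>)"
    by (rule clinear_image_supp_on[OF lin_serD[OF charge_shift(1)] subspace_supp_on])
      (auto simp: charge_shift_bas cvs.subspace_0[OF subspace_supp_on])
qed

lemma charged_exp_vop: "charged \<alpha> (exp_vop \<alpha>)"
  using charged_sprod[OF charged_Eser charged_sprod[OF charged_Eser charged_charge_shift], of "- 1" 1 \<alpha> \<alpha> \<alpha>]
  unfolding exp_vop_def charge_shift_def by simp

lemma charged_current_prod:
  assumes "charged \<alpha> F" shows "charged \<alpha> (current_prod n F)"
proof -
  have "charged 0 (creation n)" "charged 0 (annihilation n)"
    unfolding creation_gser annihilation_gser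
    by (auto intro!: charged_gser osc1_charge cvs.subspace_scale[OF subspace_supp_on]
        simp: creation_coeff_def annihilation_coeff_def cvs.subspace_0[OF subspace_supp_on] simp del: of_nat_diff)
  then show ?thesis
    using charged_sprod[OF _ assms, of 0 "creation n"] charged_sprod[OF assms, of 0 "annihilation n"]
    unfolding current_prod_def by (intro charged_sadd) simp_all
qed

lemma charged_Y1: "charged \<alpha> (Y1 (bas (\<alpha>, \<mu>)))"
proof (induction \<mu> rule: monomial_induct)
  case zero
  show ?case using charged_exp_vop by (simp add: Y1_ev flip: r1.ev_def)
next
  case (single k \<mu>)
  obtain n where k: "k = ((), n)" by (cases k) auto
  show ?case unfolding k r1_var_bas[symmetric] Y1_var by (rule charged_current_prod[OF single])
qed

lemma Y1_charge: "a \<in> charge \<alpha> \<Longrightarrow> b \<in> charge \<beta> \<Longrightarrow> Y1 a r s b \<in> charge (\<alpha> + \<beta>)"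
  by (rule clinear_image_supp_on[OF clinear_Y1_left subspace_supp_on])
    (use charged_Y1 in \<open>auto simp: charged_def\<close>)

section \<open>Vacuum and translation in rank one\<close>

lemma annihilation_coeff_vac: "annihilation_coeff n m (r1.ev 0) = 0"
proof -
  have "osc1 (int j) (r1.ev 0) = 0" for j
    by (cases j) (simp_all add: r1.ev_def osc1_bas osc1_bas(3)[of _ 0 0, simplified] osc1_bas(3)[of _ 0 0, simplified add.commute])
  then show ?thesis by (simp add: annihilation_coeff_def del: of_nat_diff)
qed

lemma Y1_var_vac: "Y1 (r1.var () n * a) r s (r1.ev 0) = Sum_any (\<lambda>m. creation_coeff n m (Y1 a (r - real m) s (r1.ev 0)))"
  by (simp add: Y1_var current_prod_apply[OF hol_field_Y1] annihilation_coeff_vac clinear_zero[OF clinear_Y1_right])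

lemma Y1_vac_pos: "Y1 a r s (r1.ev 0) \<noteq> 0 \<Longrightarrow> r \<in> \<nat>"
proof (induction a arbitrary: r rule: state1_induct)
  case (add u v)
  then show ?case by (metis add.right_neutral clinear_add[OF clinear_Y1_left])
next
  case (scale c u)
  then show ?case by (metis cvs.scale_zero_right clinear_scale[OF clinear_Y1_left])
next
  case (ev \<alpha>)
  then show ?case using exp_vop_vac(3) by (simp add: Y1_ev)
next
  case (var n u)
  then obtain m where "creation_coeff n m (Y1 u (r - real m) s (r1.ev 0)) \<noteq> 0"
    unfolding Y1_var_vac by (elim Sum_any.not_neutral_obtains_not_neutral)
  then have "Y1 u (r - real m) s (r1.ev 0) \<noteq> 0" by auto
  then have "r - real m \<in> \<nat>" by (rule var.IH)
  then have "r - real m + real m \<in> \<nat>" by (intro Nats_add) auto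
  then show ?case by simp
qed (simp add: clinear_zero[OF clinear_Y1_left])

lemma Y1_vac_neg: "r < 0 \<Longrightarrow> Y1 a r s (r1.ev 0) = 0"
proof (rule ccontr)
  assume "r < 0" "Y1 a r s (r1.ev 0) \<noteq> 0"
  then have "r \<in> \<nat>" "r < 0" using Y1_vac_pos by auto
  then show False by (auto elim!: Nats_cases)
qed

lemma creation_coeff_0_eq: "creation_coeff n 0 v = r1.var () n * v"
  and creation_coeff_1_eq: "creation_coeff n (Suc 0) v = scale (of_nat (Suc n)) (r1.var () (Suc n) * v)"
proof -
  have "pochhammer (1::complex) n = fact n" by (simp add: pochhammer_fact)
  then show "creation_coeff n 0 v = r1.var () n * v" by (simp add: creation_coeff_def osc1_neg)
  have "pochhammer (1::complex) (Suc n) = fact (Suc n)" by (simp only: pochhammer_fact)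
  then have "pochhammer (2::complex) n = of_nat (Suc n) * fact n" by (simp add: pochhammer_rec)
  then show "creation_coeff n (Suc 0) v = scale (of_nat (Suc n)) (r1.var () (Suc n) * v)"
    using osc1_neg[of "Suc n" v] by (simp add: creation_coeff_def)
qed

text \<open>This is the creation property $a(-1)\mathbf 1 = a$ of a vertex algebra.\<close>

lemma Y1_creation: "Y1 a 0 0 (r1.ev 0) = a"
proof (induction a rule: state1_induct)
  case (var n u)
  have "Y1 (r1.var () n * u) 0 0 (r1.ev 0) = (\<Sum>m\<le>0. creation_coeff n m (Y1 u (0 - real m) 0 (r1.ev 0)))"
    unfolding Y1_var_vac by (rule Sum_any_finite) (simp add: Y1_vac_neg)
  then show ?case by (simp add: var creation_coeff_0_eq)
qed (simp_all add: clinear_zero[OF clinear_Y1_left] clinear_add[OF clinear_Y1_left]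
    clinear_scale[OF clinear_Y1_left] Y1_ev exp_vop_vac)

text \<open>$a(-2)\mathbf 1$, the translation operator in rank one.\<close>

definition D1 :: "state1 \<Rightarrow> state1" where
  "D1 a = Y1 a 1 0 (r1.ev 0)"

lemma clinear_D1: "clinear D1"
  unfolding D1_def[abs_def] by (rule clinear_Y1_left)

lemma D1_ev: "D1 (r1.ev \<alpha>) = scale (of_real \<alpha>) (r1.var () 0 * r1.ev \<alpha>)"
  by (simp add: D1_def Y1_ev exp_vop_vac)

text \<open>
  $[D, h(-n-1)] = (n+1) h(-n-2)$; together with the value on $e_\alpha$ this determines $D$.
\<close>

lemma D1_var: "D1 (r1.var () n * a) = r1.var () n * D1 a + scale (of_nat (Suc n)) (r1.var () (Suc n) * a)"
proof -
  have "D1 (r1.var () n * a) = (\<Sum>m\<le>Suc 0. creation_coeff n m (Y1 a (1 - real m) 0 (r1.ev 0)))"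
    unfolding D1_def Y1_var_vac by (rule Sum_any_finite) (simp add: Y1_vac_neg)
  then show ?thesis by (simp add: creation_coeff_0_eq creation_coeff_1_eq Y1_creation D1_def)
qed

abbreviation pd :: "nat \<Rightarrow> state1 \<Rightarrow> state1" where
  "pd \<equiv> r1.pderiv ()"

lemmas pd_add = clinear_add[OF clinear_r1_pderiv]
  and pd_scale = clinear_scale[OF clinear_r1_pderiv]
  and pd_0 [simp] = clinear_zero[OF clinear_r1_pderiv]

lemma pd_var: "pd j (r1.var () n * a) = (if j = n then a else 0) + r1.var () n * pd j a"
proof (rule clinear_eqI[of "\<lambda>a. pd j (r1.var () n * a)" "\<lambda>a. (if j = n then a else 0) + r1.var () n * pd j a"])
  show "clinear (\<lambda>a. pd j (r1.var () n * a))"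
    by (rule clinear_compose[OF clinear_r1_pderiv clinear_times])
  have "clinear (\<lambda>a. (if j = n then a else 0))"
    using clinear_id clinear_zero_fun by (cases "j = n") auto
  then show "clinear (\<lambda>a. (if j = n then a else 0) + r1.var () n * pd j a)"
    by (rule clinear_plus[OF _ clinear_compose[OF clinear_times clinear_r1_pderiv]])
  fix x :: "real \<times> unit monomial"
  obtain \<alpha> \<mu> where x: "x = (\<alpha>, \<mu>)" by (cases x)
  show "pd j (r1.var () n * bas x) = (if j = n then bas x else 0) + r1.var () n * pd j (bas x)"
  proof (cases "j = n")
    case True
    have 1: "X1 n + \<mu> - X1 n = \<mu>" by (rule poly_mapping_eqI) (simp add: lookup_minus lookup_add)
    have 2: "X1 n + (\<mu> - X1 n) = \<mu>" if "coef \<mu> ((), n) \<noteq> 0"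
      using that by (auto intro!: poly_mapping_eqI simp: lookup_minus lookup_add lookup_single when_def)
    show ?thesis unfolding x True r1_var_bas r1_pderiv_bas 1
      by (cases "coef \<mu> ((), n) = 0")
        (simp_all add: lookup_add var_scale r1_var_bas[simplified] 2[simplified] cvs.scale_left_distrib)
  next
    case False
    have 1: "X1 n + \<mu> - X1 j = X1 n + (\<mu> - X1 j)"
      using False by (auto intro!: poly_mapping_eqI simp: lookup_minus lookup_add lookup_single when_def)
    show ?thesis unfolding x r1_var_bas r1_pderiv_bas 1 using False
      by (simp add: lookup_add lookup_single when_def var_scale r1_var_bas[simplified])
  qed
qed

lemma pd_ev: "pd j (r1.ev \<alpha>) = 0"
  by (simp add: r1.ev_def r1_pderiv_bas)

lemma osc1_zero_var: "osc1 0 (r1.var () n * a) = r1.var () n * osc1 0 a"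
proof (rule clinear_eqI[OF clinear_compose[OF clinear_osc1 clinear_times] clinear_compose[OF clinear_times clinear_osc1]])
  fix x :: "real \<times> unit monomial"
  obtain \<alpha> \<mu> where x: "x = (\<alpha>, \<mu>)" by (cases x)
  show "osc1 0 (r1.var () n * bas x) = r1.var () n * osc1 0 (bas x)"
    unfolding x by (simp only: r1_var_bas osc1_bas var_scale)
qed

text \<open>
  The commutator of \<open>pd j\<close> with $D$.  Since \<open>pd j\<close> is $h(j+1)/(j+1)$,
  it is $h(j)$, which for $j > 0$ is written with \<open>pd\<close> as well.
\<close>

definition comm_term :: "nat \<Rightarrow> state1 \<Rightarrow> state1" where
  "comm_term j a = (if j = 0 then osc1 0 a else scale (of_nat j) (pd (j - 1) a))"

lemma comm_term_lin: "comm_term j (a + b) = comm_term j a + comm_term j b" "comm_term j (scale c a) = scale c (comm_term j a)" "comm_term j 0 = 0"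
  by (auto simp: comm_term_def osc1_add osc1_scale pd_add pd_scale cvs.scale_right_distrib mult.commute)

lemma comm_term_var: "comm_term j (r1.var () n * a) = (if j = Suc n then scale (of_nat j) a else 0) + r1.var () n * comm_term j a"
  by (cases j) (auto simp: comm_term_def osc1_zero_var pd_var var_scale cvs.scale_right_distrib)

lemma pd_D1: "pd j (D1 a) = D1 (pd j a) + comm_term j a"
proof (induction a rule: state1_induct)
  case (ev \<alpha>)
  show ?case
    by (cases j) (simp_all add: D1_ev pd_scale pd_var pd_ev comm_term_def clinear_zero[OF clinear_D1] osc1_bas(2)[of _ 0, folded r1.ev_def])
next
  case (var n a)
  show ?case
    unfolding D1_var pd_var pd_add pd_scale var comm_term_var clinear_add[OF clinear_D1]
    by (auto simp: D1_var algebra_simps clinear_zero[OF clinear_D1] distrib_left cvs.scale_right_distrib)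
qed (simp_all add: clinear_zero[OF clinear_D1] clinear_add[OF clinear_D1]
    clinear_scale[OF clinear_D1] pd_add pd_scale comm_term_lin cvs.scale_right_distrib)

lemma lookup_osc1_zero: "coef (osc1 0 a) x = of_real (fst x) * coef a x"
proof -
  have "osc1 0 a = lin (\<lambda>x. scale (of_real (fst x)) (bas x)) a"
    by (simp add: osc1_zero split_def)
  then show ?thesis by (simp add: lookup_lin_diagonal)
qed

lemma number_op_bas: "r1.var () n * pd n (bas x) = scale (of_nat (coef (snd x) ((), n))) (bas x)"
proof -
  obtain \<alpha> \<mu> where x: "x = (\<alpha>, \<mu>)" by (cases x)
  have 2: "X1 n + (\<mu> - X1 n) = \<mu>" if "coef \<mu> ((), n) \<noteq> 0"
    using that by (auto intro!: poly_mapping_eqI simp: lookup_minus lookup_add lookup_single when_def)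
  show ?thesis unfolding x r1_pderiv_bas var_scale r1_var_bas
    by (cases "coef \<mu> ((), n) = 0") (simp_all add: 2[simplified])
qed

lemma lookup_number_op:
  "coef (r1.var () n * pd n a) x = of_nat (coef (snd x) ((), n)) * coef a x"
proof -
  have "r1.var () n * pd n a = lin (\<lambda>x. r1.var () n * pd n (bas x)) a"
    by (rule clinear_eq_lin[OF clinear_compose[OF clinear_times clinear_r1_pderiv]])
  then show ?thesis unfolding number_op_bas by (simp add: lookup_lin_diagonal)
qed

text \<open>
  If $Da = 0$ and $h(j+1)a = 0$ then $h(j)a = 0$ by the commutator of $h(j+1)$ and $D$.  As $h(j)a = 0$
  for large $j$, all $h(j)$ with $j \ge 0$ annihilate $a$.  Hence $a$ has charge $0$ and contains no
  oscillators.
\<close>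

lemma D1_kernel:
  assumes "D1 a = 0" shows "a \<in> supp_on {(0, 0)}"
proof -
  have step: "comm_term j a = 0" if "pd j a = 0" for j
    using pd_D1[of j a] that assms by (simp add: clinear_zero[OF clinear_D1])
  have desc: "pd j a = 0" if "pd (Suc j) a = 0" for j
    using step[OF that] by (simp add: comm_term_def del: of_nat_Suc)
  obtain M where M: "\<forall>j>M. osc1 (int j) a = 0" using osc1_eventually_zero by blast
  have "osc1 (int M + 1) a = 0" using M[rule_format, of "Suc M"] by (simp add: add.commute)
  then have "pd M a = 0" unfolding osc1_pos by (simp del: of_nat_Suc)
  \<comment> \<open>the start of the descent: large modes annihilate every vector\<close>
  have big: "pd j a = 0" if "j \<ge> M" for j
  proof -
    have "osc1 (int j + 1) a = 0" using M[rule_format, of "Suc j"] that by (simp add: add.commute)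
    then show ?thesis unfolding osc1_pos by (simp del: of_nat_Suc)
  qed
  have pd0: "pd j a = 0" for j
  proof (cases "j \<ge> M")
    case False
    then have "j \<le> M" by simp
    then show ?thesis by (induction rule: inc_induct) (simp_all add: big desc)
  qed (rule big)
  have "osc1 0 a = 0" using step[OF pd0[of 0]] by (simp add: comm_term_def)
  have "x = (0, 0)" if x: "coef a x \<noteq> 0" for x
  proof -
    have "fst x = 0" using lookup_osc1_zero[of a x] \<open>osc1 0 a = 0\<close> x by simp
    moreover have "coef (snd x) ((), n) = 0" for n
      using lookup_number_op[of n a x] pd0[of n] x by simp
    then have "snd x = 0" by (intro poly_mapping_eqI) (metis lookup_zero old.unit.exhaust surj_pair)
    ultimately show ?thesis by (simp add: prod_eq_iff)
  qed
  then show ?thesis by (auto simp: supp_on_iff)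
qed

lemma D1_vac: "D1 (r1.ev 0) = 0"
  by (simp add: D1_ev)

section \<open>Splitting the plane into two orthogonal lines\<close>

text \<open>
  Polynomials in two kinds of variables form the tensor product of the polynomials in each kind;
  this is the bijection on monomials.
\<close>

definition merge :: "unit monomial \<Rightarrow> unit monomial \<Rightarrow> bool monomial" where
  "merge \<mu> \<nu> = Abs_poly_mapping (\<lambda>(b, n). if b then coef \<mu> ((), n) else coef \<nu> ((), n))"

lemma lookup_merge:
  "coef (merge \<mu> \<nu>) (b, n) = (if b then coef \<mu> ((), n) else coef \<nu> ((), n))"
proof -
  have "{x. (case x of (b, n) \<Rightarrow> if b then coef \<mu> ((), n) else coef \<nu> ((), n)) \<noteq> 0} \<subseteq>
      (\<lambda>x. (True, snd x)) ` supp \<mu> \<union> (\<lambda>x. (False, snd x)) ` supp \<nu>"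
    by (force simp: in_keys_iff split: if_splits)
  then have "finite {x. (case x of (b, n) \<Rightarrow> if b then coef \<mu> ((), n) else coef \<nu> ((), n)) \<noteq> 0}"
    by (rule finite_subset) simp
  then show ?thesis by (simp add: merge_def)
qed

lemma merge_eqI: "(\<And>b n. coef \<kappa> (b, n) = coef \<kappa>' (b, n)) \<Longrightarrow> \<kappa> = \<kappa>'"
  for \<kappa> \<kappa>' :: "bool monomial"
  by (rule poly_mapping_eqI) (metis surj_pair)

lemma unit_monomial_eqI: "(\<And>n. coef \<mu> ((), n) = coef \<nu> ((), n)) \<Longrightarrow> \<mu> = \<nu>"
  for \<mu> \<nu> :: "unit monomial"
  by (rule poly_mapping_eqI) (metis old.unit.exhaust surj_pair)

lemma merge_inject: "merge \<mu> \<nu> = merge \<mu>' \<nu>' \<longleftrightarrow> \<mu> = \<mu>' \<and> \<nu> = \<nu>'"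
proof
  assume eq: "merge \<mu> \<nu> = merge \<mu>' \<nu>'"
  have "coef \<mu> ((), n) = coef \<mu>' ((), n)"
    "coef \<nu> ((), n) = coef \<nu>' ((), n)" for n
    using arg_cong[OF eq, of "\<lambda>\<kappa>. coef \<kappa> (True, n)"]
      arg_cong[OF eq, of "\<lambda>\<kappa>. coef \<kappa> (False, n)"] by (simp_all add: lookup_merge)
  then show "\<mu> = \<mu>' \<and> \<nu> = \<nu>'" by (auto intro!: unit_monomial_eqI)
qed simp

lemma merge_surj: "\<exists>\<mu> \<nu>. \<kappa> = merge \<mu> \<nu>"
proof -
  have "inj (\<lambda>x::unit \<times> nat. (b, snd x))" for b :: bool by (auto intro!: injI simp: prod_eq_iff)
  then show ?thesis
    by (intro exI[of _ "Poly_Mapping.map_key (\<lambda>x. (True, snd x)) \<kappa>"]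
        exI[of _ "Poly_Mapping.map_key (\<lambda>x. (False, snd x)) \<kappa>"] merge_eqI)
      (simp add: lookup_merge map_key.rep_eq)
qed

lemma merge_0: "merge 0 0 = 0"
  by (rule merge_eqI) (simp add: lookup_merge)

lemma merge_X1: "merge (X1 n + \<mu>) \<nu> = single (True, n) 1 + merge \<mu> \<nu>"
  "merge \<mu> (X1 n + \<nu>) = single (False, n) 1 + merge \<mu> \<nu>"
  by (auto intro!: merge_eqI simp: lookup_merge lookup_add lookup_single when_def)

lemma merge_minus_X1: "merge (\<mu> - X1 n) \<nu> = merge \<mu> \<nu> - single (True, n) 1"
  "merge \<mu> (\<nu> - X1 n) = merge \<mu> \<nu> - single (False, n) 1"
  by (auto intro!: merge_eqI simp: lookup_merge lookup_minus lookup_single when_def)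

definition deg :: "unit monomial \<Rightarrow> nat" where
  "deg \<mu> = Sum_any (coef \<mu>)"

lemma deg_add: "deg (\<mu> + \<nu>) = deg \<mu> + deg \<nu>"
  unfolding deg_def by (subst Sum_any.distrib[symmetric]) (simp_all add: lookup_add)

lemma deg_0: "deg 0 = 0"
  by (simp add: deg_def)

lemma deg_X1: "deg (X1 n) = 1"
proof -
  have "deg (X1 n) = Sum_any (\<lambda>k. if k = ((), n) then 1 else 0)"
    unfolding deg_def by (intro arg_cong[where f = Sum_any] ext) (auto simp: lookup_single when_def)
  then show ?thesis by simp
qed

text \<open>
  The oscillators of the basis vector $\bar v_R$ are the negatives of those of $-\bar v_R$, with
  respect to which the second coordinate is taken.  So a monomial in them changes by this sign.
\<close>

definition sgn_deg :: "unit monomial \<Rightarrow> complex" where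
  "sgn_deg \<mu> = (- 1) ^ deg \<mu>"

lemma sgn_deg_add: "sgn_deg (\<mu> + \<nu>) = sgn_deg \<mu> * sgn_deg \<nu>"
  and sgn_deg_0: "sgn_deg 0 = 1"
  and sgn_deg_X1: "sgn_deg (X1 n) = - 1"
  and sgn_deg_nonzero: "sgn_deg \<mu> \<noteq> 0"
  unfolding sgn_deg_def deg_add deg_0 deg_X1 by (simp_all add: power_add)

lemma sgn_deg_minus: "coef \<mu> ((), n) \<noteq> 0 \<Longrightarrow> sgn_deg (\<mu> - X1 n) = - sgn_deg \<mu>"
proof -
  assume "coef \<mu> ((), n) \<noteq> 0"
  then have "X1 n + (\<mu> - X1 n) = \<mu>"
    by (auto intro!: poly_mapping_eqI simp: lookup_add lookup_minus lookup_single when_def)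
  then have "sgn_deg \<mu> = - sgn_deg (\<mu> - X1 n)" by (metis sgn_deg_add sgn_deg_X1 mult_minus1)
  then show ?thesis by simp
qed

type_synonym state2 = "((real \<times> unit monomial) \<times> (real \<times> unit monomial)) \<Rightarrow>\<^sub>0 complex"
type_synonym stateH = "(H, bool) state"

locale circle =
  fixes R :: real assumes R_pos: "R > 0"
begin

sublocale h: fock ipH "pR R" "BR R" .

text \<open>
  In these coordinates $(\cdot,\cdot)_{p_R}$ is the standard scalar product.  The minus sign is chosen
  such that the indices of the summands of $C_R$ become $(i, n_{p,q} i)$.
\<close>

definition g :: "real \<Rightarrow> real \<Rightarrow> H" where
  "g s t = s *\<^sub>R vR R - t *\<^sub>R vbarR R"

lemma ipH_diff: "ipH (a - b) c = ipH a c - ipH b c" "ipH c (a - b) = ipH c a - ipH c b"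
  and ipH_minus: "ipH (- a) c = - ipH a c" "ipH c (- a) = - ipH c a"
  and ipH_scale: "ipH (r *\<^sub>R a) c = r * ipH a c" "ipH c (r *\<^sub>R a) = r * ipH c a"
  by (simp_all add: ipH_def algebra_simps)

lemmas ipH_basis = ipH_vR[OF R_pos]

lemma ipH_g: "ipH (g s t) (vR R) = s" "ipH (g s t) (vbarR R) = t"
  by (simp_all add: g_def ipH_diff ipH_scale ipH_basis)

lemma g_inject: "g s t = g s' t' \<longleftrightarrow> s = s' \<and> t = t'"
  by (metis ipH_g)

lemma g_add: "g (s + s') (t + t') = g s t + g s' t'"
  by (simp add: g_def algebra_simps)

lemma g_0: "g 0 0 = 0"
  by (simp add: g_def)

lemma g_coordinates: "h = g (ipH h (vR R)) (ipH h (vbarR R))"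
proof -
  have "R * inverse R = 1" "sqrt 2 * sqrt 2 = (2::real)" using R_pos by auto
  then show ?thesis
    using R_pos by (cases h) (simp add: g_def ipH_def vR_def vbarR_def field_simps)
qed

lemma g_surj: obtains s t where "h = g s t"
  using g_coordinates by blast

lemma pR_g: "pR R (g s t) = g s 0" and pbar_g: "h.pbar (g s t) = g 0 t"
  by (simp_all add: pR_def h.pbar_def ipH_g) (simp_all add: g_def)

lemma ipp_g: "h.ipp (g s t) (g s' t') = s * s' + t * t'"
  by (simp add: h.ipp_def pR_g pbar_g) (simp add: g_def ipH_minus ipH_scale ipH_basis)

lemma BR_g: "BR R True = g 1 0" "BR R False = g 0 (- 1)"
  by (simp_all add: BR_def g_def)

section \<open>The Fock space of the plane as a tensor product\<close>

fun fuse :: "(real \<times> unit monomial) \<times> (real \<times> unit monomial) \<Rightarrow> H \<times> bool monomial" where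
  "fuse ((s, \<mu>), (t, \<nu>)) = (g s t, merge \<mu> \<nu>)"

text \<open>
  This linear bijection identifies the tensor product of two rank one Fock spaces with the Fock space
  of $H$.  The signs make it compatible with the oscillators (\<open>osc_J2\<close>).
\<close>

definition J :: "state2 \<Rightarrow> stateH" where
  "J = monomial_map (\<lambda>x. sgn_deg (snd (snd x))) fuse"

lemma inj_fuse: "inj fuse"
  by (rule injI) (auto simp: g_inject merge_inject elim!: fuse.elims)

lemma surj_fuse: "surj fuse"
proof (rule surjI)
  fix y :: "H \<times> bool monomial"
  have "\<exists>x. fuse x = y"
  proof (cases y)
    case (Pair h \<kappa>)
    obtain s t where "h = g s t" by (rule g_surj)
    moreover obtain \<mu> \<nu> where "\<kappa> = merge \<mu> \<nu>" using merge_surj by blast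
    ultimately have "fuse ((s, \<mu>), (t, \<nu>)) = y" using Pair by simp
    then show ?thesis by blast
  qed
  then show "fuse (SOME x. fuse x = y) = y" by (rule someI_ex)
qed

lemma clinear_J: "clinear J"
  by (simp add: J_def clinear_monomial_map)

lemma supp_on_UNIV: "supp_on UNIV = UNIV"
  by (simp add: supp_on_def)

lemma bij_J: "bij J"
  using bij_betw_monomial_map[of fuse UNIV "\<lambda>x. sgn_deg (snd (snd x))"] inj_fuse surj_fuse
  by (simp add: J_def supp_on_UNIV sgn_deg_nonzero)

lemma J_bas: "J (bas ((s, \<mu>), (t, \<nu>))) = scale (sgn_deg \<nu>) (bas (g s t, merge \<mu> \<nu>))"
  by (simp add: J_def)

definition J2 :: "state1 \<Rightarrow> state1 \<Rightarrow> stateH" where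
  "J2 u v = J (tens u v)"

lemma J2_add: "J2 (u + u') v = J2 u v + J2 u' v" "J2 u (v + v') = J2 u v + J2 u v'"
  and J2_scale: "J2 (scale c u) v = scale c (J2 u v)" "J2 u (scale c v) = scale c (J2 u v)"
  and J2_zero [simp]: "J2 0 v = 0" "J2 u 0 = 0"
  by (simp_all add: J2_def tens_add_left tens_add_right tens_scale_left tens_scale_right
      clinear_add[OF clinear_J] clinear_scale[OF clinear_J] clinear_zero[OF clinear_J])

lemma clinear_J2_left: "clinear (\<lambda>u. J2 u v)"
  and clinear_J2_right: "clinear (\<lambda>v. J2 u v)"
  by (auto intro!: clinearI simp: J2_add J2_scale)

lemma J2_bas: "J2 (bas (s, \<mu>)) (bas (t, \<nu>)) = scale (sgn_deg \<nu>) (bas (g s t, merge \<mu> \<nu>))"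
  by (simp add: J2_def J_bas)

lemma ev_g: "h.ev (g s t) = J2 (r1.ev s) (r1.ev t)"
  by (simp add: h.ev_def r1.ev_def J2_bas sgn_deg_0 merge_0)

definition Jinv :: "stateH \<Rightarrow> state2" where
  "Jinv = inv J"

lemma Jinv_J [simp]: "Jinv (J w) = w"
  using bij_J by (simp add: Jinv_def bij_is_inj)

lemma J_Jinv [simp]: "J (Jinv w) = w"
  using bij_J by (simp add: Jinv_def bij_is_surj surj_f_inv_f)

lemma clinear_Jinv: "clinear Jinv"
  by (rule clinearI) (metis Jinv_J J_Jinv clinear_add[OF clinear_J], metis Jinv_J J_Jinv clinear_scale[OF clinear_J])

lemma Jinv_J2 [simp]: "Jinv (J2 u v) = tens u v"
  by (simp add: J2_def)

lemma J_eqI: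
  assumes "clinear f" "clinear f'" "\<And>x y. f (J2 (bas x) (bas y)) = f' (J2 (bas x) (bas y))"
  shows "f w = f' w"
proof -
  have "f (J (Jinv w)) = f' (J (Jinv w))"
    by (rule clinear_eqI[OF clinear_compose[OF assms(1) clinear_J] clinear_compose[OF assms(2) clinear_J]])
      (use assms(3) in \<open>auto simp: J2_def\<close>)
  then show ?thesis by simp
qed

lemma var_J2: "h.var True n * J2 u v = J2 (r1.var () n * u) v"
  "h.var False n * J2 u v = - J2 u (r1.var () n * v)"
proof -
  have b: "h.var k n * bas (\<alpha>, \<kappa>) = bas (\<alpha>, single (k, n) 1 + \<kappa>)" for k \<alpha> \<kappa>
    by (simp add: h.var_def mult_single)
  show "h.var True n * J2 u v = J2 (r1.var () n * u) v"
  proof (rule bilin_eqI[of "\<lambda>u v. h.var True n * J2 u v"])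
    fix i j :: "real \<times> unit monomial"
    obtain s \<mu> t \<nu> where ij: "i = (s, \<mu>)" "j = (t, \<nu>)" by (cases i; cases j)
    show "h.var True n * J2 (bas i) (bas j) = J2 (r1.var () n * bas i) (bas j)"
      unfolding ij J2_bas r1_var_bas clinear_scale[OF clinear_times] b merge_X1 ..
  qed (intro clinear_compose[OF clinear_times] clinear_J2_left clinear_J2_right
      clinear_compose[OF clinear_J2_left clinear_times])+
  have neg: "- J2 u v = scale (- 1) (J2 u v)" for u v by simp
  show "h.var False n * J2 u v = - J2 u (r1.var () n * v)"
    unfolding neg
  proof (rule bilin_eqI[of "\<lambda>u v. h.var False n * J2 u v"])
    fix i j :: "real \<times> unit monomial"
    obtain s \<mu> t \<nu> where ij: "i = (s, \<mu>)" "j = (t, \<nu>)" by (cases i; cases j)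
    show "h.var False n * J2 (bas i) (bas j) = scale (- 1) (J2 (bas i) (r1.var () n * bas j))"
      unfolding ij J2_bas r1_var_bas clinear_scale[OF clinear_times] b merge_X1 sgn_deg_add sgn_deg_X1
      by simp
  qed (intro clinear_compose[OF clinear_times] clinear_J2_left clinear_J2_right clinear_scaled
      clinear_compose[OF clinear_J2_right clinear_times])+
qed

lemma clinear_h_pderiv: "clinear (h.pderiv k n)"
  by (simp add: h.pderiv_def clinear_lin)

lemma pderiv_J2: "h.pderiv True n (J2 u v) = J2 (pd n u) v"
  "h.pderiv False n (J2 u v) = - J2 u (pd n v)"
proof -
  have b: "h.pderiv k n (bas (\<alpha>, \<kappa>)) =
      scale (of_nat (coef \<kappa> (k, n))) (bas (\<alpha>, \<kappa> - single (k, n) 1))" for k \<alpha> \<kappa>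
    by (simp add: h.pderiv_def)
  show "h.pderiv True n (J2 u v) = J2 (pd n u) v"
  proof (rule bilin_eqI[of "\<lambda>u v. h.pderiv True n (J2 u v)"])
    fix i j :: "real \<times> unit monomial"
    obtain s \<mu> t \<nu> where ij: "i = (s, \<mu>)" "j = (t, \<nu>)" by (cases i; cases j)
    show "h.pderiv True n (J2 (bas i) (bas j)) = J2 (pd n (bas i)) (bas j)"
      unfolding ij J2_bas r1_pderiv_bas clinear_scale[OF clinear_h_pderiv] b J2_scale merge_minus_X1 lookup_merge
      by (simp add: mult.commute)
  qed (intro clinear_compose[OF clinear_h_pderiv] clinear_J2_left clinear_J2_right
      clinear_compose[OF clinear_J2_left clinear_r1_pderiv])+
  have neg: "- J2 u v = scale (- 1) (J2 u v)" for u v by simp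
  show "h.pderiv False n (J2 u v) = - J2 u (pd n v)"
    unfolding neg
  proof (rule bilin_eqI[of "\<lambda>u v. h.pderiv False n (J2 u v)"])
    fix i j :: "real \<times> unit monomial"
    obtain s \<mu> t \<nu> where ij: "i = (s, \<mu>)" "j = (t, \<nu>)" by (cases i; cases j)
    show "h.pderiv False n (J2 (bas i) (bas j)) = scale (- 1) (J2 (bas i) (pd n (bas j)))"
      unfolding ij J2_bas r1_pderiv_bas clinear_scale[OF clinear_h_pderiv] b J2_scale merge_minus_X1 lookup_merge
      by (cases "coef \<nu> ((), n) = 0") (simp_all add: sgn_deg_minus[simplified])
  qed (intro clinear_compose[OF clinear_h_pderiv] clinear_J2_left clinear_J2_right clinear_scaled
      clinear_compose[OF clinear_J2_right clinear_r1_pderiv])+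
qed

lemma ipp_BR: "h.ipp (g s t) (BR R True) = s" "h.ipp (g s t) (BR R False) = - t"
  by (simp_all add: BR_g ipp_g)

lemma clinear_h_osc: "clinear (h.osc a m)"
proof -
  consider "m < 0" | "m = 0" | "m > 0" by linarith
  then show ?thesis
  proof cases
    case 1
    then have "h.osc a m = (\<lambda>v. \<Sum>k\<in>UNIV. scale (of_real (h.ipp a (BR R k))) (h.var k (nat (- m - 1)) * v))"
      by (simp add: h.osc_def fun_eq_iff)
    then show ?thesis by (simp only:) (intro clinear_sum_fun clinear_scaled clinear_times)
  next
    case 2
    then have "h.osc a m = lin (\<lambda>(\<alpha>, \<mu>). scale (of_real (h.ipp a \<alpha>)) (bas (\<alpha>, \<mu>)))"
      by (simp add: h.osc_def fun_eq_iff)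
    then show ?thesis by (simp only: clinear_lin)
  next
    case 3
    then have "h.osc a m = (\<lambda>v. \<Sum>k\<in>UNIV. scale (of_int m * of_real (h.ipp a (BR R k))) (h.pderiv k (nat (m - 1)) v))"
      by (simp add: h.osc_def fun_eq_iff)
    then show ?thesis by (simp only:) (intro clinear_sum_fun clinear_scaled clinear_h_pderiv)
  qed
qed

lemma osc_J2: "h.osc (g s t) m (J2 u v) = scale (of_real s) (J2 (osc1 m u) v) + scale (of_real t) (J2 u (osc1 m v))"
proof (cases m rule: int_cases3)
  case (neg n)
  show ?thesis unfolding neg osc1_neg
    by (simp add: h.osc_def UNIV_bool ipp_BR var_J2)
next
  case (pos n)
  show ?thesis unfolding pos osc1_pos J2_scale
    by (simp add: h.osc_def UNIV_bool ipp_BR pderiv_J2 ac_simps)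
next
  case zero
  show ?thesis unfolding zero
  proof (rule bilin_eqI[of "\<lambda>u v. h.osc (g s t) 0 (J2 u v)"])
    fix i j :: "real \<times> unit monomial"
    obtain s' \<mu> t' \<nu> where ij: "i = (s', \<mu>)" "j = (t', \<nu>)" by (cases i; cases j)
    have "h.osc (g s t) 0 (bas (g s' t', \<kappa>)) = scale (of_real (s * s' + t * t')) (bas (g s' t', \<kappa>))" for \<kappa>
      by (simp add: h.osc_def ipp_g)
    then show "h.osc (g s t) 0 (J2 (bas i) (bas j)) =
        scale (of_real s) (J2 (osc1 0 (bas i)) (bas j)) + scale (of_real t) (J2 (bas i) (osc1 0 (bas j)))"
      unfolding ij osc1_bas J2_scale J2_bas clinear_scale[OF clinear_h_osc]
      by (simp add: cvs.scale_left_distrib cvs.scale_right_distrib distrib_left mult_ac)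
  qed (intro clinear_compose[OF clinear_h_osc] clinear_plus clinear_scaled clinear_J2_left clinear_J2_right
      clinear_compose[OF clinear_J2_left clinear_osc1] clinear_compose[OF clinear_J2_right clinear_osc1])+
qed

section \<open>Products of series in the two variables\<close>

text \<open>
  $F(z) \otimes G(\bar z)$ as an operator on the Fock space of $H$, for series \<open>F\<close> and
  \<open>G\<close> that contain only powers of their first variable.
\<close>

definition box :: "(state1, state1) series \<Rightarrow> (state1, state1) series \<Rightarrow> (stateH, stateH) series"
    (infix \<open>\<boxtimes>\<close> 75) where
  "(F \<boxtimes> G) r s w = lin (\<lambda>(x, y). J2 (F r 0 (bas x)) (G s 0 (bas y))) (Jinv w)"

lemma lin_ser_box: "lin_ser (F \<boxtimes> G)"
  unfolding lin_ser_def box_def by (intro allI clinear_compose[OF clinear_lin clinear_Jinv])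

lemma box_J2_bas: "(F \<boxtimes> G) r s (J2 (bas x) (bas y)) = J2 (F r 0 (bas x)) (G s 0 (bas y))"
  by (simp add: box_def)

lemma box_J2:
  assumes "lin_ser F" "lin_ser G"
  shows "(F \<boxtimes> G) r s (J2 u v) = J2 (F r 0 u) (G s 0 v)"
  by (rule bilin_eqI[of "\<lambda>u v. (F \<boxtimes> G) r s (J2 u v)"])
    (auto simp: box_J2_bas intro!: clinear_compose[OF lin_serD[OF lin_ser_box]] clinear_J2_left clinear_J2_right
      clinear_compose[OF clinear_J2_left lin_serD] clinear_compose[OF clinear_J2_right lin_serD] assms)

lemma box_eqI:
  assumes "lin_ser F" "\<And>r s x y. F r s (J2 (bas x) (bas y)) = G r s (J2 (bas x) (bas y))" "lin_ser G"
  shows "F = G"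
  by (intro ext) (rule J_eqI[OF lin_serD[OF assms(1)] lin_serD[OF assms(3)] assms(2)])

lemma box_nonzeroE:
  assumes "(F \<boxtimes> G) r s w \<noteq> 0"
  obtains x y where "(x, y) \<in> supp (Jinv w)" "F r 0 (bas x) \<noteq> 0" "G s 0 (bas y) \<noteq> 0"
proof -
  from assms obtain p where p: "p \<in> supp (Jinv w)"
    "scale (coef (Jinv w) p) (case p of (x, y) \<Rightarrow> J2 (F r 0 (bas x)) (G s 0 (bas y))) \<noteq> 0"
    unfolding box_def lin_def by (elim sum.not_neutral_contains_not_neutral)
  then show ?thesis using that by (cases p) fastforce
qed

lemma pos_ser_box: "pos_ser F \<Longrightarrow> pos_ser G \<Longrightarrow> pos_ser (F \<boxtimes> G)"
  unfolding pos_ser_def by (blast elim: box_nonzeroE)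

lemma fin_ser_box:
  assumes "fin_ser F" "fin_ser G" shows "fin_ser (F \<boxtimes> G)"
  unfolding fin_ser_def
proof
  fix w
  have "{(r, s). (F \<boxtimes> G) r s w \<noteq> 0} \<subseteq> (\<Union>(x, y)\<in>supp (Jinv w).
      (fst ` {(r, s). F r s (bas x) \<noteq> 0}) \<times> (fst ` {(r, s). G r s (bas y) \<noteq> 0}))"
    by (force elim!: box_nonzeroE)
  then show "finite {(r, s). (F \<boxtimes> G) r s w \<noteq> 0}"
    by (rule finite_subset) (use assms in \<open>auto simp: fin_ser_def\<close>)
qed

lemma field_ser_box:
  assumes "field_ser F" "field_ser G" shows "field_ser (F \<boxtimes> G)"
  unfolding field_ser_def
proof
  fix w
  obtain S where S: "\<And>v. finite (S v)"
    "\<And>v r s. F r s v \<noteq> 0 \<Longrightarrow> \<exists>(r0, s0)\<in>S v. r - r0 \<in> \<nat> \<and> s - s0 \<in> \<nat>"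
    using assms(1) unfolding field_ser_def by metis
  obtain T where T: "\<And>v. finite (T v)"
    "\<And>v r s. G r s v \<noteq> 0 \<Longrightarrow> \<exists>(r0, s0)\<in>T v. r - r0 \<in> \<nat> \<and> s - s0 \<in> \<nat>"
    using assms(2) unfolding field_ser_def by metis
  define U where "U = (\<Union>(x, y)\<in>supp (Jinv w). fst ` S (bas x) \<times> fst ` T (bas y))"
  have "\<exists>(r0, s0)\<in>U. r - r0 \<in> \<nat> \<and> s - s0 \<in> \<nat>" if nz: "(F \<boxtimes> G) r s w \<noteq> 0" for r s
  proof -
    obtain x y where xy: "(x, y) \<in> supp (Jinv w)" and F: "F r 0 (bas x) \<noteq> 0" and G: "G s 0 (bas y) \<noteq> 0"
      using nz by (rule box_nonzeroE)
    obtain r0 r1 where r0: "(r0, r1) \<in> S (bas x)" "r - r0 \<in> \<nat>" using S(2)[OF F] by blast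
    obtain s0 s1 where s0: "(s0, s1) \<in> T (bas y)" "s - s0 \<in> \<nat>" using T(2)[OF G] by blast
    have "r0 \<in> fst ` S (bas x)" "s0 \<in> fst ` T (bas y)" using r0(1) s0(1) by force+
    then have "(r0, s0) \<in> U" unfolding U_def by (intro UN_I[OF xy]) simp
    then show ?thesis using r0 s0 by blast
  qed
  moreover have "finite U" unfolding U_def using S(1) T(1) by auto
  ultimately show "\<exists>S. finite S \<and> (\<forall>r s. (F \<boxtimes> G) r s w \<noteq> 0 \<longrightarrow> (\<exists>(r0, s0)\<in>S. r - r0 \<in> \<nat> \<and> s - s0 \<in> \<nat>))"
    by blast
qed

lemma hol_sprod:
  assumes "hol_ser G" "lin_ser F"
  shows "(F \<star> G) r 0 u = Sum_any (\<lambda>r'. F (r - r') 0 (G r' 0 u))"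
proof -
  have "(F \<star> G) r 0 u = Sum_any (\<lambda>r'. case (r', 0) of (r', s') \<Rightarrow> F (r - r') (0 - s') (G r' s' u))"
    unfolding sprod_def
  proof (rule Sum_any_reindex_inj)
    show "inj (\<lambda>r'::real. (r', 0::real))" by (auto intro: injI)
    fix x assume nz: "(case x of (r', s') \<Rightarrow> F (r - r') (0 - s') (G r' s' u)) \<noteq> 0"
    obtain r' s' where x: "x = (r', s')" by (cases x)
    have "G r' s' u \<noteq> 0" using nz assms(2) by (auto simp: x)
    then have "s' = 0" using assms(1) unfolding hol_ser_def by blast
    then show "x \<in> range (\<lambda>r'. (r', 0))" by (simp add: x)
  qed
  then show ?thesis by simp
qed

text \<open>
  A product of two finite sums; this is what makes the product of series in $z$ and $\bar z$ factor
  (\<open>box_sprod\<close>).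
\<close>

lemma J2_Sum_any:
  assumes "finite {a. f a \<noteq> 0}" "finite {b. f' b \<noteq> 0}"
  shows "J2 (Sum_any f) (Sum_any f') = Sum_any (\<lambda>(a, b). J2 (f a) (f' b))"
proof -
  let ?A = "{a. f a \<noteq> 0}" and ?B = "{b. f' b \<noteq> 0}"
  have "J2 (Sum_any f) (Sum_any f') = (\<Sum>a\<in>?A. \<Sum>b\<in>?B. J2 (f a) (f' b))"
    unfolding Sum_any.expand_set clinear_sum[OF clinear_J2_left] clinear_sum[OF clinear_J2_right]
    by (rule sum.swap)
  also have "\<dots> = (\<Sum>(a, b)\<in>?A \<times> ?B. J2 (f a) (f' b))"
    by (rule sum.cartesian_product)
  also have "\<dots> = Sum_any (\<lambda>(a, b). J2 (f a) (f' b))"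
  proof (rule Sum_any.expand_superset[symmetric])
    show "{a. (case a of (a, b) \<Rightarrow> J2 (f a) (f' b)) \<noteq> 0} \<subseteq> ?A \<times> ?B"
      by auto
  qed (use assms in simp)
  finally show ?thesis .
qed

lemma sprod_fin_slice:
  assumes "sprod_fin F G" shows "finite {r'. F (r - r') 0 (G r' 0 u) \<noteq> 0}"
proof -
  have "{r'. F (r - r') 0 (G r' 0 u) \<noteq> 0} \<subseteq> fst ` {(r', s'). F (r - r') (0 - s') (G r' s' u) \<noteq> 0}"
    by (intro subsetI, rule_tac x = "(x, 0)" in image_eqI) auto
  moreover have "finite {(r', s'). F (r - r') (0 - s') (G r' s' u) \<noteq> 0}"
    using assms unfolding sprod_fin_def by blast
  ultimately show ?thesis by (meson finite_imageI finite_subset)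
qed

lemma box_sprod_apply:
  assumes lin: "lin_ser F1" "lin_ser F2" "lin_ser G1" "lin_ser G2" and hol: "hol_ser F2" "hol_ser G2"
    and fin: "sprod_fin F1 F2" "sprod_fin G1 G2"
  shows "((F1 \<boxtimes> G1) \<star> (F2 \<boxtimes> G2)) r s (J2 u v) = J2 ((F1 \<star> F2) r 0 u) ((G1 \<star> G2) s 0 v)"
proof -
  have "((F1 \<boxtimes> G1) \<star> (F2 \<boxtimes> G2)) r s (J2 u v) =
      Sum_any (\<lambda>(r', s'). J2 (F1 (r - r') 0 (F2 r' 0 u)) (G1 (s - s') 0 (G2 s' 0 v)))"
    unfolding sprod_def by (simp only: box_J2 lin)
  also have "\<dots> = J2 (Sum_any (\<lambda>r'. F1 (r - r') 0 (F2 r' 0 u))) (Sum_any (\<lambda>s'. G1 (s - s') 0 (G2 s' 0 v)))"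
    by (rule J2_Sum_any[symmetric]) (intro sprod_fin_slice[OF fin(1)] sprod_fin_slice[OF fin(2)])+
  finally show ?thesis by (simp only: hol_sprod hol lin)
qed

lemma sprod_fin_box:
  assumes lin: "lin_ser F1" "lin_ser F2" "lin_ser G1" "lin_ser G2"
    and fin: "sprod_fin F1 F2" "sprod_fin G1 G2"
  shows "sprod_fin (F1 \<boxtimes> G1) (F2 \<boxtimes> G2)"
  unfolding sprod_fin_def
proof (intro allI)
  fix r s w
  have "{(r', s'). (F1 \<boxtimes> G1) (r - r') (s - s') ((F2 \<boxtimes> G2) r' s' w) \<noteq> 0} \<subseteq>
     (\<Union>(x, y)\<in>supp (Jinv w). {r'. F1 (r - r') 0 (F2 r' 0 (bas x)) \<noteq> 0} \<times> {s'. G1 (s - s') 0 (G2 s' 0 (bas y)) \<noteq> 0})"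
  proof safe
    fix r' s' assume nz: "(F1 \<boxtimes> G1) (r - r') (s - s') ((F2 \<boxtimes> G2) r' s' w) \<noteq> 0"
    let ?f = "\<lambda>w. (F1 \<boxtimes> G1) (r - r') (s - s') ((F2 \<boxtimes> G2) r' s' w)"
    have "clinear (\<lambda>w'. ?f (J w'))"
      by (intro clinear_compose[OF lin_serD[OF lin_ser_box]] clinear_J)
    then have "?f (J (Jinv w)) = lin (\<lambda>p. ?f (J (bas p))) (Jinv w)" by (rule clinear_eq_lin)
    then have "lin (\<lambda>p. ?f (J (bas p))) (Jinv w) \<noteq> 0" using nz by simp
    then obtain p where p: "p \<in> supp (Jinv w)" "scale (coef (Jinv w) p) (?f (J (bas p))) \<noteq> 0"
      unfolding lin_def by (elim sum.not_neutral_contains_not_neutral)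
    obtain x y where xy: "p = (x, y)" by (cases p)
    have "?f (J2 (bas x) (bas y)) \<noteq> 0" using p by (auto simp: xy J2_def)
    then have "J2 (F1 (r - r') 0 (F2 r' 0 (bas x))) (G1 (s - s') 0 (G2 s' 0 (bas y))) \<noteq> 0"
      by (simp only: box_J2 lin simp_thms not_False_eq_True)
    then show "(r', s') \<in> (\<Union>(x, y)\<in>supp (Jinv w). {r'. F1 (r - r') 0 (F2 r' 0 (bas x)) \<noteq> 0} \<times> {s'. G1 (s - s') 0 (G2 s' 0 (bas y)) \<noteq> 0})"
      using p(1) unfolding xy by (intro UN_I[of "(x, y)"]) auto
  qed
  then show "finite {(r', s'). (F1 \<boxtimes> G1) (r - r') (s - s') ((F2 \<boxtimes> G2) r' s' w) \<noteq> 0}"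
    by (rule finite_subset) (auto intro!: finite_cartesian_product sprod_fin_slice[OF fin(1)] sprod_fin_slice[OF fin(2)])
qed

lemma box_sprod:
  assumes lin: "lin_ser F1" "lin_ser F2" "lin_ser G1" "lin_ser G2" and hol: "hol_ser F2" "hol_ser G2"
    and fin: "sprod_fin F1 F2" "sprod_fin G1 G2"
  shows "(F1 \<boxtimes> G1) \<star> (F2 \<boxtimes> G2) = (F1 \<star> F2) \<boxtimes> (G1 \<star> G2)"
  by (rule box_eqI)
    (simp_all add: box_sprod_apply[OF assms] box_J2_bas lin_ser_box lin_ser_sprod sprod_fin_box lin fin)

lemma box_sadd_left: "sadd F F' \<boxtimes> G = sadd (F \<boxtimes> G) (F' \<boxtimes> G)"
  and box_sadd_right: "F \<boxtimes> sadd G G' = sadd (F \<boxtimes> G) (F \<boxtimes> G')"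
proof -
  show "sadd F F' \<boxtimes> G = sadd (F \<boxtimes> G) (F' \<boxtimes> G)"
    by (rule box_eqI) (simp_all add: lin_ser_box lin_ser_sadd sadd_def box_J2_bas J2_add)
  show "F \<boxtimes> sadd G G' = sadd (F \<boxtimes> G) (F \<boxtimes> G')"
    by (rule box_eqI) (simp_all add: lin_ser_box lin_ser_sadd sadd_def box_J2_bas J2_add)
qed

end

context circle
begin

abbreviation Id1 :: "(state1, state1) series" where
  "Id1 \<equiv> sconst (\<lambda>v. v)"

lemma Id1: "lin_ser Id1" "pos_ser Id1" "fin_ser Id1" "hol_ser Id1"
  by (simp_all add: lin_ser_sconst clinear_id pos_ser_sconst fin_ser_sconst hol_ser_sconst)

section \<open>Exponentials in two variables\<close>

text \<open>The series whose exponential is $E^\sigma$.\<close>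

definition exponent :: "int \<Rightarrow> real \<Rightarrow> (state1, state1) series" where
  "exponent \<sigma> s = gser (of_int \<sigma>) (exp_coeff \<sigma> s)"

lemma sprod_fin_Id1: "lin_ser F \<Longrightarrow> sprod_fin Id1 F" "lin_ser F \<Longrightarrow> sprod_fin F Id1"
proof -
  assume F: "lin_ser F"
  show "sprod_fin F Id1" using F by (intro sprod_fin_fin Id1)
  have "{(r', s'). Id1 (r - r') (s - s') (F r' s' v) \<noteq> 0} \<subseteq> {(r, s)}" for r s v
    by (auto simp: sconst_def)
  then show "sprod_fin Id1 F" unfolding sprod_fin_def by (meson finite.emptyI finite_insert finite_subset)
qed

lemma sprod_weighted_sum:
  assumes F: "lin_ser F" and "finite A" "\<And>i. i \<in> A \<Longrightarrow> sprod_fin F (G i)"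
  shows "(F \<star> (\<lambda>r s v. \<Sum>i\<in>A. scale (c i) (G i r s v))) r s v = (\<Sum>i\<in>A. scale (c i) ((F \<star> G i) r s v))"
proof -
  have fin: "finite {a. (case a of (r', s') \<Rightarrow> F (r - r') (s - s') (G i r' s' v)) \<noteq> 0}" if "i \<in> A" for i
    using assms(3)[OF that] unfolding sprod_fin_iff by blast
  let ?B = "\<Union>i\<in>A. {a. (case a of (r', s') \<Rightarrow> F (r - r') (s - s') (G i r' s' v)) \<noteq> 0}"
  have B: "finite ?B" using assms(2) fin by blast
  have eq: "(\<lambda>(r', s'). F (r - r') (s - s') (\<Sum>i\<in>A. scale (c i) (G i r' s' v))) =
      (\<lambda>a. \<Sum>i\<in>A. scale (c i) (case a of (r', s') \<Rightarrow> F (r - r') (s - s') (G i r' s' v)))"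
    by (simp add: fun_eq_iff clinear_sum[OF lin_serD[OF F]] clinear_scale[OF lin_serD[OF F]])
  have "(F \<star> (\<lambda>r s v. \<Sum>i\<in>A. scale (c i) (G i r s v))) r s v =
      (\<Sum>a\<in>?B. \<Sum>i\<in>A. scale (c i) (case a of (r', s') \<Rightarrow> F (r - r') (s - s') (G i r' s' v)))"
    unfolding sprod_def eq
  proof (rule Sum_any.expand_superset[OF B], rule subsetI)
    fix a assume "a \<in> {a. (\<Sum>i\<in>A. scale (c i) (case a of (r', s') \<Rightarrow> F (r - r') (s - s') (G i r' s' v))) \<noteq> 0}"
    then obtain i where "i \<in> A" "scale (c i) (case a of (r', s') \<Rightarrow> F (r - r') (s - s') (G i r' s' v)) \<noteq> 0"
      by (auto elim: sum.not_neutral_contains_not_neutral)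
    then show "a \<in> ?B" by (intro UN_I[of i]) auto
  qed
  also have "\<dots> = (\<Sum>i\<in>A. scale (c i) (\<Sum>a\<in>?B. (case a of (r', s') \<Rightarrow> F (r - r') (s - s') (G i r' s' v))))"
    by (subst sum.swap) (simp only: cvs.scale_sum_right)
  also have "\<dots> = (\<Sum>i\<in>A. scale (c i) ((F \<star> G i) r s v))"
    unfolding sprod_def
    by (intro sum.cong refl arg_cong[where f = "scale _"] Sum_any.expand_superset[OF B, symmetric]) blast
  finally show ?thesis .
qed

lemma sum_binomial_step:
  fixes a :: "nat \<Rightarrow> 'i \<Rightarrow>\<^sub>0 complex"
  shows "(\<Sum>i\<le>k. scale (of_nat (k choose i)) (a (Suc i))) + (\<Sum>i\<le>k. scale (of_nat (k choose i)) (a i)) =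
    (\<Sum>i\<le>Suc k. scale (of_nat (Suc k choose i)) (a i))"
proof -
  have "(\<Sum>i\<le>k. scale (of_nat (k choose i)) (a i)) = (\<Sum>i\<le>Suc k. scale (of_nat (k choose i)) (a i))"
    by (simp add: binomial_eq_0)
  also have "\<dots> = a 0 + (\<Sum>i\<le>k. scale (of_nat (k choose Suc i)) (a (Suc i)))"
    by (subst sum.atMost_Suc_shift) simp
  finally show ?thesis
    by (subst sum.atMost_Suc_shift) (simp add: cvs.scale_left_distrib sum.distrib algebra_simps)
qed

lemma lin_ser_exponent: "lin_ser (exponent \<sigma> s)"
  unfolding exponent_def by (intro lin_ser_gser clinear_exp_coeff)

lemma fin_ser_exponent: "fin_ser (exponent 1 s)"
proof -
  have "finite {n. exp_coeff 1 s n v \<noteq> 0}" for v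
  proof -
    obtain M where M: "\<forall>j>M. osc1 (int j) v = 0" using osc1_eventually_zero by blast
    have "{n. exp_coeff 1 s n v \<noteq> 0} \<subseteq> {..M}"
    proof
      fix n assume "n \<in> {n. exp_coeff 1 s n v \<noteq> 0}"
      then have "\<not> n > M" using M by (auto simp: exp_coeff_def r1_osc_scale)
      then show "n \<in> {..M}" by simp
    qed
    then show ?thesis by (rule finite_subset) simp
  qed
  then show ?thesis unfolding exponent_def by (intro fin_ser_gser) auto
qed

lemma spow_exponent:
  assumes "\<sigma> = 1 \<or> \<sigma> = - 1"
  shows "lin_ser (spow (exponent \<sigma> s) k)" "hol_ser (spow (exponent \<sigma> s) k)" "sprod_fin (exponent \<sigma> s) (spow (exponent \<sigma> s) k)"
proof -
  have eq: "spow (exponent \<sigma> s) k = gser (of_int \<sigma>) (opow (exp_coeff \<sigma> s) k)"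
    unfolding exponent_def using assms by (intro spow_gser) auto
  show "lin_ser (spow (exponent \<sigma> s) k)" "hol_ser (spow (exponent \<sigma> s) k)"
    unfolding eq by (intro lin_ser_gser clinear_opow clinear_exp_coeff hol_ser_gser)+
  show "sprod_fin (exponent \<sigma> s) (spow (exponent \<sigma> s) k)"
    using assms
  proof
    assume "\<sigma> = 1"
    then show ?thesis using lin_fin_spow[OF lin_ser_exponent fin_ser_exponent] by (intro sprod_fin_fin lin_ser_exponent) auto
  next
    assume s: "\<sigma> = - 1"
    then have "pos_ser (exponent \<sigma> s)" by (simp add: exponent_def pos_ser_gser)
    then show ?thesis using lin_pos_spow[OF lin_ser_exponent]
      by (intro sprod_fin_pos_field lin_ser_exponent pos_imp_field) auto
  qed
qed

lemma osc_J2_axes: "h.osc (g s 0) m (J2 u v) = scale (of_real s) (J2 (osc1 m u) v)"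
  "h.osc (g 0 t) m (J2 u v) = scale (of_real t) (J2 u (osc1 m v))"
  by (simp_all add: osc_J2)

lemma lin_ser_h_zser: "lin_ser (zser (\<lambda>m v. let n = - \<sigma> * m in if n \<ge> 1 then scale (- of_int \<sigma> / of_int n) (h.osc a (\<sigma> * n) v) else 0))"
proof (rule lin_ser_zser)
  fix m
  show "clinear (\<lambda>v. let n = - \<sigma> * m in if n \<ge> 1 then scale (- of_int \<sigma> / of_int n) (h.osc a (\<sigma> * n) v) else 0)"
    unfolding Let_def using clinear_scaled[OF clinear_h_osc] clinear_zero_fun by (cases "- \<sigma> * m \<ge> 1") simp_all
qed

lemma h_exponent:
  assumes "\<sigma> = 1 \<or> \<sigma> = - 1"
  shows "zser (\<lambda>m v. let n = - \<sigma> * m in if n \<ge> 1 then scale (- of_int \<sigma> / of_int n) (h.osc (g s 0) (\<sigma> * n) v) else 0) = exponent \<sigma> s \<boxtimes> Id1"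
    "sconj (zser (\<lambda>m v. let n = - \<sigma> * m in if n \<ge> 1 then scale (- of_int \<sigma> / of_int n) (h.osc (g 0 t) (\<sigma> * n) v) else 0)) = Id1 \<boxtimes> exponent \<sigma> t"
proof -
  show "zser (\<lambda>m v. let n = - \<sigma> * m in if n \<ge> 1 then scale (- of_int \<sigma> / of_int n) (h.osc (g s 0) (\<sigma> * n) v) else 0) = exponent \<sigma> s \<boxtimes> Id1"
    unfolding exponent_def zser_eq_gser[OF assms, symmetric]
  proof (rule box_eqI[OF lin_ser_h_zser _ lin_ser_box])
    fix r q x y
    show "zser (\<lambda>m v. let n = - \<sigma> * m in if n \<ge> 1 then scale (- of_int \<sigma> / of_int n) (h.osc (g s 0) (\<sigma> * n) v) else 0) r q (J2 (bas x) (bas y)) =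
      (zser (\<lambda>m v. let n = - \<sigma> * m in if n \<ge> 1 then scale (- of_int \<sigma> / of_int n) (r1.osc s (\<sigma> * n) v) else 0) \<boxtimes> Id1) r q (J2 (bas x) (bas y))"
      unfolding box_J2_bas zser_def sconst_def Let_def osc_J2_axes r1_osc_scale
      by (simp add: J2_scale)
  qed
  show "sconj (zser (\<lambda>m v. let n = - \<sigma> * m in if n \<ge> 1 then scale (- of_int \<sigma> / of_int n) (h.osc (g 0 t) (\<sigma> * n) v) else 0)) = Id1 \<boxtimes> exponent \<sigma> t"
    unfolding exponent_def zser_eq_gser[OF assms, symmetric]
  proof (rule box_eqI[OF lin_ser_sconj[OF lin_ser_h_zser] _ lin_ser_box])
    fix r q x y
    show "sconj (zser (\<lambda>m v. let n = - \<sigma> * m in if n \<ge> 1 then scale (- of_int \<sigma> / of_int n) (h.osc (g 0 t) (\<sigma> * n) v) else 0)) r q (J2 (bas x) (bas y)) =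
      (Id1 \<boxtimes> zser (\<lambda>m v. let n = - \<sigma> * m in if n \<ge> 1 then scale (- of_int \<sigma> / of_int n) (r1.osc t (\<sigma> * n) v) else 0)) r q (J2 (bas x) (bas y))"
      unfolding box_J2_bas zser_def sconst_def sconj_def Let_def osc_J2_axes r1_osc_scale
      by (simp add: J2_scale)
  qed
qed

text \<open>
  The exponent for $H$ is the sum of $X \otimes 1$ and $1 \otimes X'$, which commute.  So its powers
  are given by the binomial formula and its exponential is the Cauchy product of the two exponential
  series.  In a given degree only finitely many powers of $X$ and $X'$ contribute, so that the Cauchy
  product involves finite sums only.
\<close>

lemma h_Eser:
  assumes \<sigma>: "\<sigma> = 1 \<or> \<sigma> = - 1"
  shows "h.Eser \<sigma> (g s t) = r1.Eser \<sigma> s \<boxtimes> r1.Eser \<sigma> t"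
proof -
  let ?X = "sadd (exponent \<sigma> s \<boxtimes> Id1) (Id1 \<boxtimes> exponent \<sigma> t)"
  let ?S = "\<lambda>i. spow (exponent \<sigma> s) i" and ?T = "\<lambda>j. spow (exponent \<sigma> t) j"
  have E: "h.Eser \<sigma> (g s t) = sexp ?X"
    unfolding h.Eser_def pR_g pbar_g h_exponent[OF \<sigma>, symmetric] Let_def ..
  note S = spow_exponent[OF \<sigma>, of s] and T = spow_exponent[OF \<sigma>, of t]
  have sfin1: "sprod_fin (exponent \<sigma> s \<boxtimes> Id1) (?S i \<boxtimes> ?T j)" for i j
    by (intro sprod_fin_box lin_ser_exponent Id1 S T sprod_fin_Id1)
  have sfin2: "sprod_fin (Id1 \<boxtimes> exponent \<sigma> t) (?S i \<boxtimes> ?T j)" for i j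
    by (intro sprod_fin_box lin_ser_exponent Id1 S T sprod_fin_Id1)
  have mul1: "(exponent \<sigma> s \<boxtimes> Id1) \<star> (?S i \<boxtimes> ?T j) = ?S (Suc i) \<boxtimes> ?T j" for i j
    using box_sprod[OF lin_ser_exponent S(1) Id1(1) T(1) S(2) T(2) S(3) sprod_fin_Id1(1)[OF T(1)], of i j]
    by (simp add: sprod_id_left)
  have mul2: "(Id1 \<boxtimes> exponent \<sigma> t) \<star> (?S i \<boxtimes> ?T j) = ?S i \<boxtimes> ?T (Suc j)" for i j
    using box_sprod[OF Id1(1) S(1) lin_ser_exponent T(1) S(2) T(2) sprod_fin_Id1(1)[OF S(1)] T(3), of i j]
    by (simp add: sprod_id_left)
  \<comment> \<open>the binomial formula\<close>
  have pow: "spow ?X k = (\<lambda>r q w. \<Sum>i\<le>k. scale (of_nat (k choose i)) ((?S i \<boxtimes> ?T (k - i)) r q w))" for k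
  proof (induction k)
    case 0
    have "sconst (\<lambda>w. w) = Id1 \<boxtimes> Id1"
      by (rule box_eqI) (auto simp: lin_ser_box lin_ser_sconst clinear_id box_J2_bas sconst_def)
    then show ?case by simp
  next
    case (Suc k)
    let ?G = "\<lambda>r q w. \<Sum>i\<le>k. scale (of_nat (k choose i)) ((?S i \<boxtimes> ?T (k - i)) r q w)"
    have fin: "sprod_fin F ?G" if F: "lin_ser F" "\<And>i j. sprod_fin F (?S i \<boxtimes> ?T j)" for F
      unfolding sprod_fin_def
    proof (intro allI)
      fix r q w
      have "{(r', s'). F (r - r') (q - s') (?G r' s' w) \<noteq> 0} \<subseteq>
         (\<Union>i\<in>{..k}. {(r', s'). F (r - r') (q - s') ((?S i \<boxtimes> ?T (k - i)) r' s' w) \<noteq> 0})"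
      proof safe
        fix r' s' assume "F (r - r') (q - s') (?G r' s' w) \<noteq> 0"
        then have "(\<Sum>i\<le>k. scale (of_nat (k choose i)) (F (r - r') (q - s') ((?S i \<boxtimes> ?T (k - i)) r' s' w))) \<noteq> 0"
          by (simp add: clinear_sum[OF lin_serD[OF F(1)]] clinear_scale[OF lin_serD[OF F(1)]])
        then obtain i where "i \<le> k" "scale (of_nat (k choose i)) (F (r - r') (q - s') ((?S i \<boxtimes> ?T (k - i)) r' s' w)) \<noteq> 0"
          by (auto elim: sum.not_neutral_contains_not_neutral)
        then show "(r', s') \<in> (\<Union>i\<in>{..k}. {(r', s'). F (r - r') (q - s') ((?S i \<boxtimes> ?T (k - i)) r' s' w) \<noteq> 0})"
          by (intro UN_I[of i]) auto
      qed
      then show "finite {(r', s'). F (r - r') (q - s') (?G r' s' w) \<noteq> 0}"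
        by (rule finite_subset) (use F(2) in \<open>auto simp: sprod_fin_def\<close>)
    qed
    show ?case
    proof (intro ext)
      fix r q w
      have "spow ?X (Suc k) r q w = ((exponent \<sigma> s \<boxtimes> Id1) \<star> ?G) r q w + ((Id1 \<boxtimes> exponent \<sigma> t) \<star> ?G) r q w"
        using sprod_sadd_left[OF fin[OF lin_ser_box sfin1] fin[OF lin_ser_box sfin2]]
        by (simp add: Suc sadd_def)
      also have "\<dots> = (\<Sum>i\<le>k. scale (of_nat (k choose i)) ((?S (Suc i) \<boxtimes> ?T (k - i)) r q w)) +
          (\<Sum>i\<le>k. scale (of_nat (k choose i)) ((?S i \<boxtimes> ?T (Suc (k - i))) r q w))"
        by (simp only: sprod_weighted_sum lin_ser_box sfin1 sfin2 finite_atMost mul1 mul2)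
      also have "(\<Sum>i\<le>k. scale (of_nat (k choose i)) ((?S i \<boxtimes> ?T (Suc (k - i))) r q w)) =
          (\<Sum>i\<le>k. scale (of_nat (k choose i)) ((?S i \<boxtimes> ?T (Suc k - i)) r q w))"
        by (intro sum.cong refl) (simp add: Suc_diff_le)
      also have "(\<Sum>i\<le>k. scale (of_nat (k choose i)) ((?S (Suc i) \<boxtimes> ?T (k - i)) r q w)) =
          (\<Sum>i\<le>k. scale (of_nat (k choose i)) ((?S (Suc i) \<boxtimes> ?T (Suc k - Suc i)) r q w))"
        by simp
      also note sum_binomial_step[of k "\<lambda>i. (?S i \<boxtimes> ?T (Suc k - i)) r q w"]
      finally show "spow ?X (Suc k) r q w =
          (\<Sum>i\<le>Suc k. scale (of_nat (Suc k choose i)) ((?S i \<boxtimes> ?T (Suc k - i)) r q w))" .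
    qed
  qed
  have bound: "\<exists>N. \<forall>i>N. spow (exponent \<sigma> c) i r 0 v = 0" for c r v
  proof -
    have "spow (exponent \<sigma> c) i r 0 v = 0" if "i > nat \<lfloor>- of_int \<sigma> * r\<rfloor>" for i
      unfolding exponent_def
      using \<sigma> that by (subst spow_gser) (auto simp: gser_def exp_coeff_0 intro!: opow_zero)
    then show ?thesis by blast
  qed
  have summand: "scale (1 / fact k) (spow ?X k r q (J2 u v)) =
      (\<Sum>i\<le>k. J2 (scale (1 / fact i) (?S i r 0 u)) (scale (1 / fact (k - i)) (?T (k - i) q 0 v)))" for k r q u v
    unfolding pow cvs.scale_sum_right
    by (intro sum.cong refl) (simp add: box_J2 S T J2_scale binomial_fact)
  have vanish: "(\<Sum>i\<le>k. J2 (scale (1 / fact i) (?S i r 0 u)) (scale (1 / fact (k - i)) (?T (k - i) q 0 v))) = 0"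
    if N: "\<forall>i>N. ?S i r 0 u = 0" and M: "\<forall>j>M. ?T j q 0 v = 0" and k: "k > N + M" for k N M r q u v
  proof (rule sum.neutral, rule ballI)
    fix i assume "i \<in> {..k}"
    then have "i > N \<or> k - i > M" using k by auto
    then show "J2 (scale (1 / fact i) (?S i r 0 u)) (scale (1 / fact (k - i)) (?T (k - i) q 0 v)) = 0"
      using N M by auto
  qed
  have powlin: "lin_ser (spow ?X k)" for k
    unfolding pow lin_ser_def by (intro allI clinear_sum_fun clinear_scaled lin_serD[OF lin_ser_box])
  have fin: "\<exists>K. \<forall>k>K. scale (1 / fact k) (spow ?X k r q w) = 0" for r q w
  proof -
    have "\<exists>K. \<forall>k>K. scale (1 / fact k) (spow ?X k r q (J w')) = 0" for w'
    proof (induction w' rule: vec_induct)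
      case zero
      then show ?case by (simp add: clinear_zero[OF clinear_J] lin_ser_zero[OF powlin])
    next
      case (add u v)
      then obtain K K' where "\<forall>k>K. scale (1 / fact k) (spow ?X k r q (J u)) = 0"
        "\<forall>k>K'. scale (1 / fact k) (spow ?X k r q (J v)) = 0" by blast
      then show ?case
        by (intro exI[of _ "max K K'"])
          (simp add: clinear_add[OF clinear_J] clinear_add[OF lin_serD[OF powlin]] cvs.scale_right_distrib)
    next
      case (bas c p)
      obtain x y where p: "p = (x, y)" by (cases p)
      obtain N M where "\<forall>i>N. ?S i r 0 (bas x) = 0" "\<forall>j>M. ?T j q 0 (bas y) = 0"
        using bound by blast
      then have *: "scale (1 / fact k) (spow ?X k r q (J2 (bas x) (bas y))) = 0" if "k > N + M" for k
        unfolding summand using that by (rule vanish)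
      have "scale (1 / fact k) (spow ?X k r q (J (scale c (bas p)))) = 0" if "k > N + M" for k
        using arg_cong[OF *[OF that], of "scale c"]
        by (simp add: p clinear_scale[OF clinear_J] clinear_scale[OF lin_serD[OF powlin]] J2_def mult.commute)
      then show ?case by blast
    qed
    from this[of "Jinv w"] show ?thesis by simp
  qed
  have lin: "lin_ser (sexp ?X)"
  proof -
    have finn: "finite {k. scale (1 / fact k) (spow ?X k r q w) \<noteq> 0}" for r q w
    proof -
      obtain K where K: "\<forall>k>K. scale (1 / fact k) (spow ?X k r q w) = 0" using fin by blast
      have "{k. scale (1 / fact k) (spow ?X k r q w) \<noteq> 0} \<subseteq> {..K}"
      proof
        fix k assume "k \<in> {k. scale (1 / fact k) (spow ?X k r q w) \<noteq> 0}"
        then have "\<not> k > K" using K by blast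
        then show "k \<in> {..K}" by simp
      qed
      then show ?thesis by (rule finite_subset) simp
    qed
    have sx: "sexp ?X r q = (\<lambda>w. Sum_any (\<lambda>k. scale (1 / fact k) (spow ?X k r q w)))" for r q
      by (simp add: sexp_def fun_eq_iff)
    show ?thesis unfolding lin_ser_def sx
      by (intro allI clinear_Sum_any_fun[OF clinear_scaled[OF lin_serD[OF powlin]]] finn)
  qed
  have eval: "sexp ?X r q (J2 u v) = J2 (sexp (exponent \<sigma> s) r 0 u) (sexp (exponent \<sigma> t) q 0 v)" for r q u v
  proof -
    obtain N M where N: "\<forall>i>N. ?S i r 0 u = 0" and M: "\<forall>j>M. ?T j q 0 v = 0"
      using bound by blast
    let ?A = "\<lambda>i. scale (1 / fact i) (?S i r 0 u)" and ?B = "\<lambda>j. scale (1 / fact j) (?T j q 0 v)"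
    have "sexp ?X r q (J2 u v) = (\<Sum>k\<le>N + M. \<Sum>i\<le>k. J2 (?A i) (?B (k - i)))"
      unfolding sexp_def summand by (rule Sum_any_finite) (rule vanish[OF N M])
    \<comment> \<open>The triangle of the Cauchy product contains the rectangle outside of which all terms vanish.\<close>
    also have "\<dots> = (\<Sum>(i, j)\<in>{(i, j). i + j \<le> N + M}. J2 (?A i) (?B j))"
      by (rule sum.triangle_reindex_eq[symmetric])
    also have "\<dots> = (\<Sum>(i, j)\<in>{..N} \<times> {..M}. J2 (?A i) (?B j))"
    proof (rule sum.mono_neutral_right)
      have "{(i, j). i + j \<le> N + M} \<subseteq> {..N + M} \<times> {..N + M}" by auto
      then show "finite {(i, j). i + j \<le> N + M}" by (rule finite_subset) simp
      show "{..N} \<times> {..M} \<subseteq> {(i, j). i + j \<le> N + M}" by auto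
      show "\<forall>p\<in>{(i, j). i + j \<le> N + M} - {..N} \<times> {..M}. (case p of (i, j) \<Rightarrow> J2 (?A i) (?B j)) = 0"
      proof
        fix p assume "p \<in> {(i, j). i + j \<le> N + M} - {..N} \<times> {..M}"
        then obtain i j where p: "p = (i, j)" "i > N \<or> j > M" by (cases p) auto
        then show "(case p of (i, j) \<Rightarrow> J2 (?A i) (?B j)) = 0" using N M by auto
      qed
    qed
    also have "\<dots> = J2 (\<Sum>i\<le>N. ?A i) (\<Sum>j\<le>M. ?B j)"
      unfolding clinear_sum[OF clinear_J2_left] clinear_sum[OF clinear_J2_right] sum.cartesian_product[symmetric]
      by (rule sum.swap)
    also have "(\<Sum>i\<le>N. ?A i) = sexp (exponent \<sigma> s) r 0 u"
      unfolding sexp_def by (rule Sum_any_finite[symmetric]) (simp add: N)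
    also have "(\<Sum>j\<le>M. ?B j) = sexp (exponent \<sigma> t) q 0 v"
      unfolding sexp_def by (rule Sum_any_finite[symmetric]) (simp add: M)
    finally show ?thesis .
  qed
  have r1: "r1.Eser \<sigma> c = sexp (exponent \<sigma> c)" for c
    unfolding r1_Eser[OF \<sigma>] exponent_def using \<sigma> by (intro sexp_gser[symmetric]) (auto simp: exp_coeff_0)
  show ?thesis
    unfolding E r1 by (rule box_eqI[OF lin _ lin_ser_box]) (simp add: eval box_J2_bas)
qed

section \<open>The vertex operators of the plane\<close>

lemma lin_ser_h_zpow: "lin_ser (h.zpow \<alpha>)"
  by (simp add: lin_ser_def h.zpow_def clinear_lin)

lemma h_zpow: "h.zpow (g s t) = r1.zpow s \<boxtimes> r1.zpow t"
proof (rule box_eqI[OF lin_ser_h_zpow _ lin_ser_box])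
  fix r q and x y :: "real \<times> unit monomial"
  obtain s' \<mu> t' \<nu> where xy: "x = (s', \<mu>)" "y = (t', \<nu>)" by (cases x; cases y)
  have "h.zpow (g s t) r q (bas (g s' t', \<kappa>)) = (if s * s' = r \<and> t * t' = q then bas (g s' t', \<kappa>) else 0)" for \<kappa>
    by (simp add: h.zpow_def pR_g pbar_g ipp_g)
  then show "h.zpow (g s t) r q (J2 (bas x) (bas y)) = (r1.zpow s \<boxtimes> r1.zpow t) r q (J2 (bas x) (bas y))"
    unfolding box_J2_bas unfolding xy r1_zpow_bas J2_bas clinear_scale[OF lin_serD[OF lin_ser_h_zpow]]
    by (auto simp: J2_bas)
qed

lemma h_ev_times: "sconst ((*) (h.ev (g s t))) = sconst ((*) (r1.ev s)) \<boxtimes> sconst ((*) (r1.ev t))"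
proof (rule box_eqI[OF lin_ser_sconst[OF clinear_times] _ lin_ser_box])
  fix r q and x y :: "real \<times> unit monomial"
  obtain s' \<mu> t' \<nu> where xy: "x = (s', \<mu>)" "y = (t', \<nu>)" by (cases x; cases y)
  have "h.ev (g s t) * J2 (bas x) (bas y) = J2 (r1.ev s * bas x) (r1.ev t * bas y)"
    unfolding xy J2_bas h.ev_def r1.ev_def clinear_scale[OF clinear_times] mult_single
    by (simp add: J2_bas[simplified] g_add)
  then show "sconst ((*) (h.ev (g s t))) r q (J2 (bas x) (bas y)) =
      (sconst ((*) (r1.ev s)) \<boxtimes> sconst ((*) (r1.ev t))) r q (J2 (bas x) (bas y))"
    unfolding box_J2_bas by (auto simp: sconst_def)
qed

lemma h_vop_ev_series:
  "h.Eser (- 1) (g s t) \<star> h.Eser 1 (g s t) \<star> sconst ((*) (h.ev (g s t))) \<star> h.zpow (g s t) = exp_vop s \<boxtimes> exp_vop t"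
proof -
  have "sconst ((*) (h.ev (g s t))) \<star> h.zpow (g s t) = charge_shift s \<boxtimes> charge_shift t"
    unfolding h_ev_times h_zpow charge_shift_def
    by (intro box_sprod lin_ser_ev r1_zpow sprod_fin_ev_zpow)
  moreover have "h.Eser 1 (g s t) \<star> (charge_shift s \<boxtimes> charge_shift t) = (r1.Eser 1 s \<star> charge_shift s) \<boxtimes> (r1.Eser 1 t \<star> charge_shift t)"
    by (subst h_Eser, simp) (intro box_sprod r1_Eser_plus charge_shift annihilated_shift)
  moreover have "h.Eser (- 1) (g s t) \<star> ((r1.Eser 1 s \<star> charge_shift s) \<boxtimes> (r1.Eser 1 t \<star> charge_shift t)) = exp_vop s \<boxtimes> exp_vop t"
    unfolding exp_vop_def charge_shift_def[symmetric]
    by (subst h_Eser, simp) (intro box_sprod r1_Eser_minus annihilated_shift sprod_fin_annihilated_shift)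
  ultimately show ?thesis by simp
qed

text \<open>The bilinear extension of $(a, b) \mapsto Y(a, z) \otimes Y(b, \bar z)$.\<close>

definition Ybox :: "stateH \<Rightarrow> (stateH, stateH) series" where
  "Ybox v r q w = lin (\<lambda>(x, y). (Y1 (bas x) \<boxtimes> Y1 (bas y)) r q w) (Jinv v)"

lemma clinear_Ybox: "clinear (\<lambda>v. Ybox v r q w)"
  unfolding Ybox_def by (rule clinear_compose[OF clinear_lin clinear_Jinv])

lemma lin_ser_Ybox: "lin_ser (Ybox v)"
proof -
  have "Ybox v r q = (\<lambda>w. \<Sum>p\<in>supp (Jinv v). scale (coef (Jinv v) p)
      ((Y1 (bas (fst p)) \<boxtimes> Y1 (bas (snd p))) r q w))" for r q
    by (simp add: Ybox_def lin_def fun_eq_iff split_def)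
  then show ?thesis
    unfolding lin_ser_def by (simp only:) (intro allI clinear_sum_fun clinear_scaled lin_serD[OF lin_ser_box])
qed

lemma Ybox_J2_apply: "Ybox (J2 a b) r q (J2 u v) = J2 (Y1 a r 0 u) (Y1 b q 0 v)"
  by (rule bilin_eqI[of "\<lambda>a b. Ybox (J2 a b) r q (J2 u v)"])
    (auto simp: Ybox_def box_J2 lin_ser_Y1
      intro!: clinear_compose[OF clinear_lin clinear_tens_left] clinear_compose[OF clinear_lin clinear_tens_right]
      clinear_compose[OF clinear_J2_left clinear_Y1_left] clinear_compose[OF clinear_J2_right clinear_Y1_left])

lemma Ybox_J2: "Ybox (J2 a b) = Y1 a \<boxtimes> Y1 b"
  by (rule box_eqI[OF lin_ser_Ybox _ lin_ser_box]) (simp add: Ybox_J2_apply box_J2_bas)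

lemma Ybox_add: "Ybox (v + w) = sadd (Ybox v) (Ybox w)"
  and Ybox_scale: "Ybox (scale c v) = sscale c (Ybox v)"
  and Ybox_zero: "Ybox 0 = (\<lambda>r s w. 0)"
  by (simp_all add: fun_eq_iff sadd_def sscale_def clinear_add[OF clinear_Ybox] clinear_scale[OF clinear_Ybox]
      clinear_zero[OF clinear_Ybox])

lemma stateH_induct [case_names zero add scale J2]:
  assumes "P 0" "\<And>u v. P u \<Longrightarrow> P v \<Longrightarrow> P (u + v)" "\<And>c u. P u \<Longrightarrow> P (scale c u)"
    and "\<And>x y. P (J2 (bas x) (bas y))"
  shows "P v"
proof -
  have "P (J w)" for w
  proof (induction w rule: vec_induct)
    case (bas c i)
    have "P (J2 (bas (fst i)) (bas (snd i)))" by (rule assms(4))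
    from assms(3)[OF this, of c] show ?case by (simp add: clinear_scale[OF clinear_J] J2_def)
  qed (auto simp: clinear_zero[OF clinear_J] clinear_add[OF clinear_J] assms)
  from this[of "Jinv v"] show ?thesis by simp
qed

lemma field_ser_Ybox: "field_ser (Ybox v)"
proof (induction v rule: stateH_induct)
  case zero
  then show ?case by (auto simp: Ybox_zero field_ser_def)
next
  case (J2 x y)
  then show ?case unfolding Ybox_J2 by (intro field_ser_box field_ser_Y1)
qed (simp_all add: Ybox_add Ybox_scale field_ser_sadd field_ser_sscale)

text \<open>
  One step of the inductive definition of $\hat Y$, for the two halves \<open>C\<close> and
  \<open>A\<close> of a derivative of a current.
\<close>

definition current_action :: "(stateH, stateH) series \<Rightarrow> (stateH, stateH) series \<Rightarrow> (stateH, stateH) series \<Rightarrow> (stateH, stateH) series" where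
  "current_action C A F = sadd (C \<star> F) (F \<star> A)"

definition current_pair :: "(stateH, stateH) series \<Rightarrow> (stateH, stateH) series \<Rightarrow> bool" where
  "current_pair C A \<longleftrightarrow> lin_ser C \<and> pos_ser C \<and> lin_ser A \<and> fin_ser A"

lemma current_pair_sprod_fin:
  assumes "current_pair C A" "lin_ser F" "field_ser F"
  shows "sprod_fin C F" "sprod_fin F A"
  using assms by (auto simp: current_pair_def intro: sprod_fin_pos_field sprod_fin_fin)

lemma current_action_linear:
  assumes CA: "current_pair C A" and F: "lin_ser F" "field_ser F" and G: "lin_ser G" "field_ser G"
  shows "current_action C A (sadd F G) = sadd (current_action C A F) (current_action C A G)"
    "current_action C A (sscale c F) = sscale c (current_action C A F)"
    "current_action (sscale c C) (sscale c A) F = sscale c (current_action C A F)"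
proof -
  note f = current_pair_sprod_fin[OF CA F] and g = current_pair_sprod_fin[OF CA G]
  have C: "lin_ser C" using CA by (simp add: current_pair_def)
  have 1: "C \<star> sadd F G = sadd (C \<star> F) (C \<star> G)" by (rule sprod_sadd_right[OF C f(1) g(1)])
  have 2: "sadd F G \<star> A = sadd (F \<star> A) (G \<star> A)" by (rule sprod_sadd_left[OF f(2) g(2)])
  show "current_action C A (sadd F G) = sadd (current_action C A F) (current_action C A G)"
    unfolding current_action_def 1 2 by (simp add: sadd_def fun_eq_iff ac_simps)
  have 3: "C \<star> sscale c F = sscale c (C \<star> F)" by (rule sprod_sscale_right[OF C f(1)])
  have 4: "sscale c F \<star> A = sscale c (F \<star> A)" by (rule sprod_sscale_left[OF f(2)])
  show "current_action C A (sscale c F) = sscale c (current_action C A F)"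
    unfolding current_action_def 3 4 by (simp add: sadd_def sscale_def fun_eq_iff cvs.scale_right_distrib)
  have 5: "sscale c C \<star> F = sscale c (C \<star> F)" by (rule sprod_sscale_left[OF f(1)])
  have 6: "F \<star> sscale c A = sscale c (F \<star> A)" by (rule sprod_sscale_right[OF F(1) f(2)])
  show "current_action (sscale c C) (sscale c A) F = sscale c (current_action C A F)"
    unfolding current_action_def 5 6 by (simp add: sadd_def sscale_def fun_eq_iff cvs.scale_right_distrib)
qed

lemma current_pairs:
  "current_pair (creation n \<boxtimes> Id1) (annihilation n \<boxtimes> Id1)" "current_pair (Id1 \<boxtimes> creation n) (Id1 \<boxtimes> annihilation n)"
  unfolding current_pair_def by (intro conjI lin_ser_box pos_ser_box fin_ser_box creation annihilation Id1)+

lemma current_action_box: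
  assumes F: "hol_field F" and G: "hol_field G"
  shows "current_action (creation n \<boxtimes> Id1) (annihilation n \<boxtimes> Id1) (F \<boxtimes> G) = current_prod n F \<boxtimes> G"
    "current_action (Id1 \<boxtimes> creation n) (Id1 \<boxtimes> annihilation n) (F \<boxtimes> G) = F \<boxtimes> current_prod n G"
proof -
  have f: "lin_ser F" "hol_ser F" and g: "lin_ser G" "hol_ser G" using F G by (auto simp: hol_field_def)
  have "(creation n \<boxtimes> Id1) \<star> (F \<boxtimes> G) = (creation n \<star> F) \<boxtimes> (Id1 \<star> G)"
    by (intro box_sprod creation Id1 f g sprod_fin_current_prod F sprod_fin_Id1)
  moreover have "(F \<boxtimes> G) \<star> (annihilation n \<boxtimes> Id1) = (F \<star> annihilation n) \<boxtimes> (G \<star> Id1)"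
    by (intro box_sprod annihilation Id1 f g sprod_fin_current_prod F sprod_fin_Id1)
  ultimately show "current_action (creation n \<boxtimes> Id1) (annihilation n \<boxtimes> Id1) (F \<boxtimes> G) = current_prod n F \<boxtimes> G"
    by (simp add: current_action_def current_prod_def box_sadd_left sprod_id_left sprod_id_right g)
  have "(Id1 \<boxtimes> creation n) \<star> (F \<boxtimes> G) = (Id1 \<star> F) \<boxtimes> (creation n \<star> G)"
    by (intro box_sprod creation Id1 f g sprod_fin_current_prod G sprod_fin_Id1)
  moreover have "(F \<boxtimes> G) \<star> (Id1 \<boxtimes> annihilation n) = (F \<star> Id1) \<boxtimes> (G \<star> annihilation n)"
    by (intro box_sprod annihilation Id1 f g sprod_fin_current_prod G sprod_fin_Id1)
  ultimately show "current_action (Id1 \<boxtimes> creation n) (Id1 \<boxtimes> annihilation n) (F \<boxtimes> G) = F \<boxtimes> current_prod n G"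
    by (simp add: current_action_def current_prod_def box_sadd_right sprod_id_left sprod_id_right f)
qed

lemma current_action_Ybox:
  "current_action (creation n \<boxtimes> Id1) (annihilation n \<boxtimes> Id1) (Ybox v) = Ybox (h.osc (g 1 0) (- int n - 1) v)"
  "current_action (Id1 \<boxtimes> creation n) (Id1 \<boxtimes> annihilation n) (Ybox v) = Ybox (h.osc (g 0 1) (- int n - 1) v)"
proof -
  have zero: "current_action C A (\<lambda>r s w. 0) = (\<lambda>r s w. 0)" if "current_pair C A" for C A
    using that by (simp add: current_action_def sadd_def sprod_def current_pair_def fun_eq_iff)
  show "current_action (creation n \<boxtimes> Id1) (annihilation n \<boxtimes> Id1) (Ybox v) = Ybox (h.osc (g 1 0) (- int n - 1) v)"
  proof (induction v rule: stateH_induct)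
    case (J2 x y)
    show ?case
      unfolding Ybox_J2 osc_J2_axes current_action_box[OF hol_field_Y1 hol_field_Y1] osc1_neg by (simp add: Ybox_J2 Y1_var)
  qed (simp_all add: Ybox_zero zero current_pairs clinear_zero[OF clinear_h_osc] Ybox_add Ybox_scale
      current_action_linear[OF current_pairs(1) lin_ser_Ybox field_ser_Ybox lin_ser_Ybox field_ser_Ybox]
      clinear_add[OF clinear_h_osc] clinear_scale[OF clinear_h_osc])
  show "current_action (Id1 \<boxtimes> creation n) (Id1 \<boxtimes> annihilation n) (Ybox v) = Ybox (h.osc (g 0 1) (- int n - 1) v)"
  proof (induction v rule: stateH_induct)
    case (J2 x y)
    show ?case
      unfolding Ybox_J2 osc_J2_axes current_action_box[OF hol_field_Y1 hol_field_Y1] osc1_neg by (simp add: Ybox_J2 Y1_var)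
  qed (simp_all add: Ybox_zero zero current_pairs clinear_zero[OF clinear_h_osc] Ybox_add Ybox_scale
      current_action_linear[OF current_pairs(2) lin_ser_Ybox field_ser_Ybox lin_ser_Ybox field_ser_Ybox]
      clinear_add[OF clinear_h_osc] clinear_scale[OF clinear_h_osc])
qed

lemma lin_ser_h_cur: "lin_ser (h.cur_creation a)" "lin_ser (h.cur_annihilation a)"
proof -
  have "clinear (\<lambda>v. if m \<ge> 0 then h.osc a (- m - 1) v else 0)" "clinear (\<lambda>v. if m < 0 then h.osc a (- m - 1) v else 0)" for m
    using clinear_h_osc clinear_zero_fun by (cases "m \<ge> 0", simp_all)+
  then show "lin_ser (h.cur_creation a)" "lin_ser (h.cur_annihilation a)"
    unfolding h.cur_creation_def h.cur_annihilation_def by (auto intro!: lin_ser_zser)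
qed

lemma h_cur_chiral:
  "h.cur_creation (g s 0) = sscale (of_real s) (r1.cur_creation 1 \<boxtimes> Id1)"
  "h.cur_annihilation (g s 0) = sscale (of_real s) (r1.cur_annihilation 1 \<boxtimes> Id1)"
  by (rule box_eqI[OF lin_ser_h_cur(1) _ lin_ser_sscale[OF lin_ser_box]],
      simp add: h.cur_creation_def r1.cur_creation_def sscale_def box_J2_bas zser_def sconst_def osc_J2_axes osc1_def)
    (rule box_eqI[OF lin_ser_h_cur(2) _ lin_ser_sscale[OF lin_ser_box]],
      simp add: h.cur_annihilation_def r1.cur_annihilation_def sscale_def box_J2_bas zser_def sconst_def osc_J2_axes osc1_def)

lemma h_cur_antichiral:
  "sconj (h.cur_creation (g 0 t)) = sscale (of_real t) (Id1 \<boxtimes> r1.cur_creation 1)"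
  "sconj (h.cur_annihilation (g 0 t)) = sscale (of_real t) (Id1 \<boxtimes> r1.cur_annihilation 1)"
  by (rule box_eqI[OF lin_ser_sconj[OF lin_ser_h_cur(1)] _ lin_ser_sscale[OF lin_ser_box]],
      simp add: h.cur_creation_def r1.cur_creation_def sconj_def sscale_def box_J2_bas zser_def sconst_def osc_J2_axes osc1_def)
    (rule box_eqI[OF lin_ser_sconj[OF lin_ser_h_cur(2)] _ lin_ser_sscale[OF lin_ser_box]],
      simp add: h.cur_annihilation_def r1.cur_annihilation_def sconj_def sscale_def box_J2_bas zser_def sconst_def osc_J2_axes osc1_def)

lemma dz_div_box: "dz_div n (F \<boxtimes> G) = dz_div n F \<boxtimes> G"
proof (intro ext)
  fix r s w
  show "dz_div n (F \<boxtimes> G) r s w = (dz_div n F \<boxtimes> G) r s w"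
    by (simp add: dz_div_apply box_def J2_scale lin_scaled[symmetric] split_def)
qed

lemma dz_div_box_conj: "sconj (dz_div n (sconj (F \<boxtimes> G))) = F \<boxtimes> dz_div n G"
proof (intro ext)
  fix r s w
  show "sconj (dz_div n (sconj (F \<boxtimes> G))) r s w = (F \<boxtimes> dz_div n G) r s w"
    by (simp add: dz_div_apply sconj_def box_def J2_scale lin_scaled[symmetric] split_def)
qed

lemma h_currents:
  "dz_div n (h.cur_creation (g s 0)) = sscale (of_real s) (creation n \<boxtimes> Id1)"
  "dz_div n (h.cur_annihilation (g s 0)) = sscale (of_real s) (annihilation n \<boxtimes> Id1)"
  "sconj (dz_div n (h.cur_creation (g 0 t))) = sscale (of_real t) (Id1 \<boxtimes> creation n)"
  "sconj (dz_div n (h.cur_annihilation (g 0 t))) = sscale (of_real t) (Id1 \<boxtimes> annihilation n)"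
proof -
  have sc: "sconj (sconj F) = F" for F :: "(stateH, stateH) series" by (simp add: sconj_def fun_eq_iff)
  have ss: "sconj (sscale c F) = sscale c (sconj F)" for c and F :: "(stateH, stateH) series"
    by (simp add: sconj_def sscale_def fun_eq_iff)
  show "dz_div n (h.cur_creation (g s 0)) = sscale (of_real s) (creation n \<boxtimes> Id1)"
    "dz_div n (h.cur_annihilation (g s 0)) = sscale (of_real s) (annihilation n \<boxtimes> Id1)"
    unfolding h_cur_chiral dz_div_sscale dz_div_box creation_def annihilation_def by (rule refl)+
  have "h.cur_creation (g 0 t) = sscale (of_real t) (sconj (Id1 \<boxtimes> r1.cur_creation 1))"
    "h.cur_annihilation (g 0 t) = sscale (of_real t) (sconj (Id1 \<boxtimes> r1.cur_annihilation 1))"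
    using arg_cong[OF h_cur_antichiral(1), of sconj] arg_cong[OF h_cur_antichiral(2), of sconj] by (simp_all add: sc ss)
  then show "sconj (dz_div n (h.cur_creation (g 0 t))) = sscale (of_real t) (Id1 \<boxtimes> creation n)"
    "sconj (dz_div n (h.cur_annihilation (g 0 t))) = sscale (of_real t) (Id1 \<boxtimes> annihilation n)"
    by (simp_all only: dz_div_sscale ss dz_div_box_conj creation_def annihilation_def)
qed

lemma h_osc_scale: "h.osc (g s 0) m v = scale (of_real s) (h.osc (g 1 0) m v)"
  "h.osc (g 0 t) m v = scale (of_real t) (h.osc (g 0 1) m v)"
  by (rule J_eqI[OF clinear_h_osc clinear_scaled[OF clinear_h_osc]], simp add: osc_J2_axes)+

text \<open>
  The two recursive rules for $\hat Y$ act in one tensor factor only, where they hold for the rank one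
  vertex operators.
\<close>

lemma vop_rules:
  "sadd (dz_div n (h.cur_creation (g s 0)) \<star> Ybox v) (Ybox v \<star> dz_div n (h.cur_annihilation (g s 0))) =
    Ybox (h.osc (g s 0) (- int n - 1) v)"
  "sadd (sconj (dz_div n (h.cur_creation (g 0 t))) \<star> Ybox v) (Ybox v \<star> sconj (dz_div n (h.cur_annihilation (g 0 t)))) =
    Ybox (h.osc (g 0 t) (- int n - 1) v)"
  unfolding h_currents current_action_def[symmetric] h_osc_scale[of s] h_osc_scale(2)[of t] Ybox_scale current_action_Ybox[symmetric]
  by (rule current_action_linear(3)[OF _ lin_ser_Ybox field_ser_Ybox lin_ser_Ybox field_ser_Ybox], rule current_pairs)+

lemma vop_imp_Ybox: "h.vop a F \<Longrightarrow> F = Ybox a"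
proof (induction rule: h.vop.induct)
  case (vop_ev \<alpha>)
  obtain s t where "\<alpha> = g s t" by (rule g_surj)
  then show ?case by (simp only: h_vop_ev_series) (simp add: ev_g Ybox_J2 Y1_ev)
next
  case (vop_chiral a v F n)
  obtain s t where a: "a = g s t" by (rule g_surj)
  then have "t = 0" using vop_chiral(1) by (simp add: pbar_g) (metis g_0 g_inject)
  then show ?case using vop_chiral by (simp add: a vop_rules)
next
  case (vop_antichiral a v F n)
  obtain s t where a: "a = g s t" by (rule g_surj)
  then have "s = 0" using vop_antichiral(1) by (simp add: pR_g) (metis g_0 g_inject)
  then show ?case using vop_antichiral by (simp add: a vop_rules)
qed (simp_all add: Ybox_add Ybox_scale)

text \<open>
  Every monomial is reached by first creating the oscillators of the right factor and then those of
  the left factor.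
\<close>

lemma vop_Ybox: "h.vop a (Ybox a)"
proof (induction a rule: stateH_induct)
  case zero
  have "h.vop (scale 0 (h.ev 0)) (sscale 0 (h.Eser (- 1) 0 \<star> h.Eser 1 0 \<star> sconst ((*) (h.ev 0)) \<star> h.zpow 0))"
    by (rule h.vop_scale[OF h.vop_ev])
  moreover have "sscale 0 F = Ybox 0" for F by (simp add: Ybox_zero fun_eq_iff sscale_def)
  ultimately show ?case by simp
next
  case (add u v)
  then show ?case unfolding Ybox_add by (rule h.vop_add)
next
  case (scale c u)
  then show ?case unfolding Ybox_scale by (rule h.vop_scale)
next
  case (J2 x y)
  obtain s \<mu> t \<nu> where xy: "x = (s, \<mu>)" "y = (t, \<nu>)" by (cases x; cases y)
  have "h.vop (J2 (bas (s, \<mu>)) (bas (t, \<nu>))) (Ybox (J2 (bas (s, \<mu>)) (bas (t, \<nu>))))"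
  proof (induction \<mu> rule: monomial_induct)
    case zero
    show ?case
    proof (induction \<nu> rule: monomial_induct)
      case zero
      show ?case
        using h.vop_ev[of "g s t"] unfolding h_vop_ev_series unfolding ev_g
        by (simp add: Ybox_J2 Y1_ev flip: r1.ev_def)
    next
      case (single k \<nu>)
      obtain n where k: "k = ((), n)" by (cases k) auto
      have "h.vop (h.osc (g 0 1) (- int n - 1) (J2 (bas (s, 0)) (bas (t, \<nu>))))
          (Ybox (h.osc (g 0 1) (- int n - 1) (J2 (bas (s, 0)) (bas (t, \<nu>)))))"
        using h.vop_antichiral[OF _ single, of "g 0 1" n] unfolding vop_rules by (simp add: pR_g g_0)
      then show ?case unfolding k osc_J2_axes osc1_bas by simp
    qed
  next
    case (single k \<mu>)
    obtain n where k: "k = ((), n)" by (cases k) auto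
    have "h.vop (h.osc (g 1 0) (- int n - 1) (J2 (bas (s, \<mu>)) (bas (t, \<nu>))))
        (Ybox (h.osc (g 1 0) (- int n - 1) (J2 (bas (s, \<mu>)) (bas (t, \<nu>)))))"
      using h.vop_chiral[OF _ single, of "g 1 0" n] unfolding vop_rules by (simp add: pbar_g g_0)
    then show ?case unfolding k osc_J2_axes osc1_bas by simp
  qed
  then show ?case unfolding xy .
qed

lemma Yhat_eq: "h.Yhat = Ybox"
proof
  fix a
  show "h.Yhat a = Ybox a"
    unfolding h.Yhat_def using vop_Ybox[of a] vop_imp_Ybox[of a] by (rule the_equality)
qed

text \<open>
  The reduction to rank one: under the identification of the Fock spaces,
  $\hat Y(a \otimes b, \underline z) = Y(a, z) \otimes Y(b, \bar z)$.
\<close>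

lemma Yhat_J2: "h.Yhat (J2 a b) r q (J2 u v) = J2 (Y1 a r 0 u) (Y1 b q 0 v)"
  by (simp add: Yhat_eq Ybox_J2_apply)

lemma clinear_Yhat_left: "clinear (\<lambda>a. h.Yhat a r q w)"
  and clinear_Yhat_right: "clinear (h.Yhat a r q)"
  unfolding Yhat_eq by (rule clinear_Ybox lin_serD[OF lin_ser_Ybox])+

end

section \<open>The tensor product of the two rank one algebras\<close>
lemma lookup_monomial_map:
  assumes "inj h" shows "coef (monomial_map c h v) (h x) = c x * coef v x"
proof (induction v rule: vec_induct)
  case (bas d i)
  then show ?case using injD[OF assms, of i x]
    by (auto simp: clinear_scale[OF clinear_monomial_map] lookup_single when_def)
qed (simp_all add: clinear_zero[OF clinear_monomial_map] clinear_add[OF clinear_monomial_map] lookup_add distrib_left)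

lemma clinear_lin_fun:
  assumes "\<And>x. clinear (f x)" shows "clinear (\<lambda>a. lin (\<lambda>x. f x a) w)"
  unfolding lin_def by (intro clinear_sum_fun clinear_scaled assms)

lemma clinear_tens_action_left: "clinear (\<lambda>u. tens_action F G u r s w)"
  unfolding tens_action_def by (rule clinear_lin)

lemma clinear_tens_action_right: "clinear (tens_action F G u r s)"
proof -
  have "tens_action F G u r s = (\<lambda>w. lin (\<lambda>x. (case x of (i, j) \<Rightarrow> \<lambda>w. lin (\<lambda>(m, n).
       Sum_any (\<lambda>(r', s'). tens (F (bas i) r' s' (bas m)) (G (bas j) (r - r') (s - s') (bas n)))) w) w) u)"
    by (intro ext) (simp add: tens_action_def split_def)
  moreover have "clinear \<dots>"
    by (rule clinear_lin_fun) (auto simp: clinear_lin split: prod.splits)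
  ultimately show ?thesis by simp
qed

lemma tens_action_bas:
  "tens_action F G (bas (i, j)) r s (bas (m, n)) =
    Sum_any (\<lambda>(r', s'). tens (F (bas i) r' s' (bas m)) (G (bas j) (r - r') (s - s') (bas n)))"
  by (simp add: tens_action_def)

text \<open>The vertex operator of $V \otimes \bar V$ and the action on its modules.\<close>

abbreviation Y2 :: "state2 \<Rightarrow> (state2, state2) series" where
  "Y2 \<equiv> tens_action Y1 (conj_action Y1)"

text \<open>
  Since the first factor contains powers of $z$ only and the second one powers of $\bar z$ only, a
  single term of the convolution remains.
\<close>

lemma Y2_bas: "Y2 (bas (i, j)) r q (bas (m, n)) = tens (Y1 (bas i) r 0 (bas m)) (Y1 (bas j) q 0 (bas n))"
proof -
  have "Y2 (bas (i, j)) r q (bas (m, n)) =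
      Sum_any (\<lambda>a. if a = (r, 0::real) then tens (Y1 (bas i) r 0 (bas m)) (Y1 (bas j) q 0 (bas n)) else 0)"
    unfolding tens_action_bas
  proof (intro arg_cong[where f = Sum_any] ext)
    fix a :: "real \<times> real"
    obtain r' s' where a: "a = (r', s')" by (cases a)
    show "(case a of (r', s') \<Rightarrow> tens (Y1 (bas i) r' s' (bas m)) (conj_action Y1 (bas j) (r - r') (q - s') (bas n))) =
        (if a = (r, 0::real) then tens (Y1 (bas i) r 0 (bas m)) (Y1 (bas j) q 0 (bas n)) else 0)"
      using Y1_nonhol[of s' "bas i" r' "bas m"] Y1_nonhol[of "r - r'" "bas j" "q - s'" "bas n"]
      by (auto simp: a conj_action_def sconj_def)
  qed
  then show ?thesis by simp
qed

lemma Y2_tens: "Y2 (tens a b) r q (tens u v) = tens (Y1 a r 0 u) (Y1 b q 0 v)"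
proof (rule bilin_eqI[of "\<lambda>a b. Y2 (tens a b) r q (tens u v)"])
  fix i j
  show "Y2 (tens (bas i) (bas j)) r q (tens u v) = tens (Y1 (bas i) r 0 u) (Y1 (bas j) q 0 v)"
    by (rule bilin_eqI[of "\<lambda>u v. Y2 (tens (bas i) (bas j)) r q (tens u v)"])
      (auto simp: Y2_bas intro!: clinear_compose[OF clinear_tens_action_right] clinear_tens_left clinear_tens_right
        clinear_compose[OF clinear_tens_left clinear_Y1_right] clinear_compose[OF clinear_tens_right clinear_Y1_right])
qed (intro clinear_compose[OF clinear_tens_action_left] clinear_tens_left clinear_tens_right
    clinear_compose[OF clinear_tens_left clinear_Y1_left] clinear_compose[OF clinear_tens_right clinear_Y1_left])+

abbreviation bifock :: "real set \<Rightarrow> real set \<Rightarrow> state2 set" where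
  "bifock S T \<equiv> supp_on ((S \<times> UNIV) \<times> (T \<times> UNIV))"

lemma tens_bifock: "u \<in> charge s \<Longrightarrow> v \<in> charge t \<Longrightarrow> s \<in> S \<Longrightarrow> t \<in> T \<Longrightarrow> tens u v \<in> bifock S T"
  by (rule tens_in_supp_on) (auto simp: supp_on_def)

lemma closed_under_Y2:
  assumes "\<And>s s'. s \<in> S1 \<Longrightarrow> s' \<in> S \<Longrightarrow> s + s' \<in> S" "\<And>t t'. t \<in> T1 \<Longrightarrow> t' \<in> T \<Longrightarrow> t + t' \<in> T"
  shows "closed_under (bifock S1 T1) Y2 (bifock S T)"
  unfolding closed_under_def
proof (intro ballI allI)
  fix u w r q assume u: "u \<in> bifock S1 T1" and w: "w \<in> bifock S T"
  show "Y2 u r q w \<in> bifock S T"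
  proof (rule clinear_image_supp_on[OF clinear_tens_action_left subspace_supp_on u])
    fix p :: "(real \<times> unit monomial) \<times> (real \<times> unit monomial)" assume p: "p \<in> (S1 \<times> UNIV) \<times> (T1 \<times> UNIV)"
    show "Y2 (bas p) r q w \<in> bifock S T"
    proof (rule clinear_image_supp_on[OF clinear_tens_action_right subspace_supp_on w])
      fix p' :: "(real \<times> unit monomial) \<times> (real \<times> unit monomial)" assume p': "p' \<in> (S \<times> UNIV) \<times> (T \<times> UNIV)"
      obtain s \<mu> t \<nu> s' \<mu>' t' \<nu>' where eq: "p = ((s, \<mu>), (t, \<nu>))" "p' = ((s', \<mu>'), (t', \<nu>'))"
        by (metis surj_pair)
      have "Y1 (bas (s, \<mu>)) r 0 (bas (s', \<mu>')) \<in> charge (s + s')" "Y1 (bas (t, \<nu>)) q 0 (bas (t', \<nu>')) \<in> charge (t + t')"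
        by (auto intro!: Y1_charge)
      then show "Y2 (bas p) r q (bas p') \<in> bifock S T"
        unfolding eq Y2_bas using p p' assms by (intro tens_bifock) (auto simp: eq)
    qed
  qed
qed

section \<open>Irreducibility\<close>

text \<open>
  The oscillators of the two factors, given as modes of states in order that submodules are visibly
  stable under them.
\<close>

definition osc_left :: "int \<Rightarrow> state2 \<Rightarrow> state2" where
  "osc_left m = Y2 (bas ((0, X1 0), (0, 0))) (of_int (- m - 1)) 0"

definition osc_right :: "int \<Rightarrow> state2 \<Rightarrow> state2" where
  "osc_right m = Y2 (bas ((0, 0), (0, X1 0))) 0 (of_int (- m - 1))"

lemma bas_current:
  "bas ((0, X1 0), (0, 0)) = tens (r1.var () 0 * r1.ev 0) (r1.ev 0)"
  "bas ((0, 0), (0, X1 0)) = tens (r1.ev 0) (r1.var () 0 * r1.ev 0)"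
  by (simp_all add: r1.ev_def r1.var_def mult_single)

lemma osc_left_tens: "osc_left m (tens u v) = tens (osc1 m u) v"
  unfolding osc_left_def bas_current Y2_tens Y1_current by (simp add: Y1_vac)

lemma osc_right_tens: "osc_right m (tens u v) = tens u (osc1 m v)"
  unfolding osc_right_def bas_current Y2_tens Y1_current by (simp add: Y1_vac)

lemma clinear_osc_left: "clinear (osc_left m)" and clinear_osc_right: "clinear (osc_right m)"
  unfolding osc_left_def osc_right_def by (rule clinear_tens_action_right)+

text \<open>
  The charges $h(0)$ and the operators $h(-n-1) h(n+1)$ of both factors; the latter count the
  oscillators of mode $n + 1$, with the factor $n + 1$.
\<close>

fun diag_op :: "bool \<times> nat \<Rightarrow> state2 \<Rightarrow> state2" where
  "diag_op (b, 0) v = (if b then osc_left 0 v else osc_right 0 v)"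
| "diag_op (b, Suc n) v = (if b then osc_left (- int n - 1) (osc_left (int n + 1) v)
     else osc_right (- int n - 1) (osc_right (int n + 1) v))"

fun diag_ev :: "bool \<times> nat \<Rightarrow> (real \<times> unit monomial) \<times> (real \<times> unit monomial) \<Rightarrow> complex" where
  "diag_ev (b, 0) (x, y) = of_real (if b then fst x else fst y)"
| "diag_ev (b, Suc n) (x, y) = of_nat (Suc n * coef (snd (if b then x else y)) ((), n))"

lemma osc1_number: "osc1 (- int n - 1) (osc1 (int n + 1) (bas x)) =
    scale (of_nat (Suc n * coef (snd x) ((), n))) (bas x)"
  unfolding osc1_pos osc1_neg var_scale number_op_bas by (simp only: cvs.scale_scale of_nat_mult)

lemma osc1_zero_bas: "osc1 0 (bas x) = scale (of_real (fst x)) (bas x)"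
  by (cases x) (simp add: osc1_bas)

lemma diag_op_bas: "diag_op a (bas p) = scale (diag_ev a p) (bas p)"
proof (cases a; cases p)
  fix b n x y assume ap: "a = (b, n)" "p = (x, y)"
  have p: "bas p = tens (bas x) (bas y)" by (simp add: ap)
  show ?thesis unfolding p
    by (cases n; cases b)
      (simp_all only: ap diag_op.simps diag_ev.simps if_True if_False osc_left_tens osc_right_tens
        osc1_number osc1_zero_bas tens_scale_left tens_scale_right)
qed

lemma clinear_diag_op: "clinear (diag_op a)"
proof (cases a)
  case (Pair b n)
  have "diag_op (b, n) = (case n of 0 \<Rightarrow> if b then osc_left 0 else osc_right 0 | Suc n \<Rightarrow>
      if b then (\<lambda>v. osc_left (- int n - 1) (osc_left (int n + 1) v)) else (\<lambda>v. osc_right (- int n - 1) (osc_right (int n + 1) v)))"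
    by (cases n) (auto simp: fun_eq_iff)
  then show ?thesis unfolding Pair
    using clinear_compose[OF clinear_osc_left clinear_osc_left] clinear_compose[OF clinear_osc_right clinear_osc_right]
    by (simp add: clinear_osc_left clinear_osc_right split: nat.split)
qed

lemma diag_ev_separates: assumes "p \<noteq> p'" shows "\<exists>a. diag_ev a p \<noteq> diag_ev a p'"
proof (rule ccontr)
  assume "\<nexists>a. diag_ev a p \<noteq> diag_ev a p'"
  then have eq: "diag_ev a p = diag_ev a p'" for a by blast
  obtain x y x' y' where p: "p = (x, y)" "p' = (x', y')" by (cases p; cases p')
  have "fst x = fst x'" "fst y = fst y'" using eq[of "(True, 0)"] eq[of "(False, 0)"] by (simp_all add: p)
  moreover have "coef (snd x) ((), n) = coef (snd x') ((), n)"
    "coef (snd y) ((), n) = coef (snd y') ((), n)" for n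
    using eq[of "(True, Suc n)"] eq[of "(False, Suc n)"]
    unfolding p diag_ev.simps of_nat_eq_iff by (simp_all del: mult_Suc)
  then have "snd x = snd x'" "snd y = snd y'" by (auto intro: unit_monomial_eqI)
  ultimately show False using assms by (simp add: p prod_eq_iff)
qed

text \<open>
  The sets \<open>S\<close> and \<open>T\<close> are cosets of the groups \<open>S1\<close> and \<open>T1\<close>.  By
  \<open>supp_on_diagonal\<close> a nonzero submodule contains a basis vector.  Annihilation operators
  take it to a highest weight vector, the operators of $e_\alpha$ move this to every other highest weight
  vector, and creation operators then give all basis vectors.
\<close>

lemma irreducible_bifock:
  assumes 0: "0 \<in> S1" "0 \<in> T1" and ne: "S \<noteq> {}" "T \<noteq> {}"
    and add: "\<And>s s'. s \<in> S1 \<Longrightarrow> s' \<in> S \<Longrightarrow> s + s' \<in> S" "\<And>t t'. t \<in> T1 \<Longrightarrow> t' \<in> T \<Longrightarrow> t + t' \<in> T"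
    and diff: "\<And>s s'. s \<in> S \<Longrightarrow> s' \<in> S \<Longrightarrow> s' - s \<in> S1" "\<And>t t'. t \<in> T \<Longrightarrow> t' \<in> T \<Longrightarrow> t' - t \<in> T1"
  shows "irreducible_module (bifock S1 T1) Y2 (bifock S T)"
  unfolding irreducible_module_def
proof (intro conjI allI impI)
  show "submodule_of (bifock S1 T1) Y2 (bifock S T) (bifock S T)"
    using closed_under_Y2[OF add] by (simp add: submodule_of_def subspace_supp_on)
  obtain s t where st: "s \<in> S" "t \<in> T" using ne by blast
  then have "bas ((s, 0), (t, 0)) \<in> bifock S T" by simp
  moreover have "bas ((s, 0), (t, 0)) \<noteq> (0 :: state2)" by (metis keys_single keys_zero insert_not_empty zero_neq_one)
  ultimately show "bifock S T \<noteq> {0}" by blast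
  fix W assume "submodule_of (bifock S1 T1) Y2 W (bifock S T)"
  then have W: "cvs.subspace W" "W \<subseteq> bifock S T" and cl: "closed_under (bifock S1 T1) Y2 W"
    by (auto simp: submodule_of_def)
  have act: "Y2 u r q w \<in> W" if "u \<in> bifock S1 T1" "w \<in> W" for u r q w
    using cl that unfolding closed_under_def by blast
  have oscW: "osc_left m w \<in> W" "osc_right m w \<in> W" if "w \<in> W" for m w
    unfolding osc_left_def osc_right_def using that 0 by (auto intro!: act)
  have scaleW: "bas p \<in> W" if "scale c (bas p) \<in> W" "c \<noteq> 0" for c p
    using cvs.subspace_scale[OF W(1) that(1), of "1 / c"] that(2) by simp
  show "W = {0} \<or> W = bifock S T"
  proof (cases "W \<subseteq> {0}")
    case True
    then show ?thesis using cvs.subspace_0[OF W(1)] by blast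
  next
    case False
    then obtain v where v: "v \<in> W" "v \<noteq> 0" by blast
    then obtain p where p: "p \<in> supp v" by (metis lookup_zero poly_mapping_eqI in_keys_iff)
    have diagW: "diag_op a w \<in> W" if "w \<in> W" for a w
      using that by (cases a; cases "snd a") (auto intro!: oscW)
    have "bas p \<in> W"
      by (rule supp_on_diagonal[OF W(1) clinear_diag_op diagW diag_op_bas diag_ev_separates v(1) p])
    obtain s \<mu> t \<nu> where pe: "p = ((s, \<mu>), (t, \<nu>))" by (metis surj_pair)
    have "p \<in> (S \<times> UNIV) \<times> (T \<times> UNIV)" using p v(1) W(2) by (auto simp: supp_on_def)
    then have st: "s \<in> S" "t \<in> T" by (auto simp: pe)
    \<comment> \<open>The operator $h(n+1)$ removes one factor $h(-n-1)$, up to a nonzero multiple.\<close>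
    have lower_left: "bas ((s, 0), y) \<in> W" if "bas ((s, \<mu>), y) \<in> W" for \<mu> y
      using that
    proof (induction \<mu> rule: monomial_induct)
      case (single k \<mu>)
      obtain n where k: "k = ((), n)" by (cases k) auto
      have "osc_left (int n + 1) (tens (bas (s, X1 n + \<mu>)) (bas y)) \<in> W"
        using single.prems by (intro oscW) (simp add: k)
      then have "scale (of_nat (Suc n * Suc (coef \<mu> ((), n)))) (bas ((s, X1 n + \<mu> - X1 n), y)) \<in> W"
        unfolding osc_left_tens osc1_bas by (simp add: tens_scale_left lookup_add del: of_nat_mult of_nat_Suc mult_Suc mult_Suc_right)
      then have "bas ((s, X1 n + \<mu> - X1 n), y) \<in> W" by (rule scaleW) (simp del: of_nat_mult of_nat_Suc)
      then show ?case by (intro single.IH) simp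
    qed
    have lower_right: "bas (x, (t, 0)) \<in> W" if "bas (x, (t, \<nu>)) \<in> W" for \<nu> x
      using that
    proof (induction \<nu> rule: monomial_induct)
      case (single k \<nu>)
      obtain n where k: "k = ((), n)" by (cases k) auto
      have "osc_right (int n + 1) (tens (bas x) (bas (t, X1 n + \<nu>))) \<in> W"
        using single.prems by (intro oscW) (simp add: k)
      then have "scale (of_nat (Suc n * Suc (coef \<nu> ((), n)))) (bas (x, (t, X1 n + \<nu> - X1 n))) \<in> W"
        unfolding osc_right_tens osc1_bas by (simp add: tens_scale_right lookup_add del: of_nat_mult of_nat_Suc mult_Suc mult_Suc_right)
      then have "bas (x, (t, X1 n + \<nu> - X1 n)) \<in> W" by (rule scaleW) (simp del: of_nat_mult of_nat_Suc)
      then show ?case by (intro single.IH) simp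
    qed
    have ground: "bas ((s, 0), (t, 0)) \<in> W"
      using \<open>bas p \<in> W\<close> unfolding pe by (intro lower_left[OF lower_right])
    \<comment> \<open>the leading coefficient of $Y(e_\alpha, z) e_\beta$ is $e_{\alpha+\beta}$\<close>
    have move: "bas ((s', 0), (t', 0)) \<in> W" if "s' \<in> S" "t' \<in> T" for s' t'
    proof -
      have "Y2 (tens (r1.ev (s' - s)) (r1.ev (t' - t))) ((s' - s) * s) ((t' - t) * t) (tens (r1.ev s) (r1.ev t)) \<in> W"
        using ground diff st that by (intro act) (auto simp: r1.ev_def)
      then show ?thesis unfolding Y2_tens Y1_ev_leading by (simp add: r1.ev_def)
    qed
    have raise_left: "bas ((s', \<mu>), (t', 0)) \<in> W" if "s' \<in> S" "t' \<in> T" for s' t' \<mu>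
    proof (induction \<mu> rule: monomial_induct)
      case (single k \<mu>)
      obtain n where k: "k = ((), n)" by (cases k) auto
      have "osc_left (- int n - 1) (tens (bas (s', \<mu>)) (bas (t', 0))) \<in> W"
        using single by (intro oscW) simp
      then show ?case unfolding osc_left_tens osc1_bas k by simp
    qed (rule move[OF that])
    have raise_right: "bas ((s', \<mu>), (t', \<nu>)) \<in> W" if "s' \<in> S" "t' \<in> T" for s' t' \<mu> \<nu>
    proof (induction \<nu> rule: monomial_induct)
      case (single k \<nu>)
      obtain n where k: "k = ((), n)" by (cases k) auto
      have "osc_right (- int n - 1) (tens (bas (s', \<mu>)) (bas (t', \<nu>))) \<in> W"
        using single by (intro oscW) simp
      then show ?case unfolding osc_right_tens osc1_bas k by simp
    qed (rule raise_left[OF that])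
    have "bifock S T \<subseteq> W"
      by (rule supp_on_subset_subspace[OF W(1)]) (auto intro: raise_right)
    then show ?thesis using W(2) by blast
  qed
qed

section \<open>The vertex operators of $C_R$\<close>

locale circle_cocycle = circle +
  fixes \<epsilon> :: "H \<Rightarrow> H \<Rightarrow> complex"
  assumes cocycle: "lattice_cocycle \<epsilon>"
begin

lemma eps_nonzero: "\<alpha> \<in> L \<Longrightarrow> \<beta> \<in> L \<Longrightarrow> \<epsilon> \<alpha> \<beta> \<noteq> 0"
  and eps_cocycle: "\<alpha> \<in> L \<Longrightarrow> \<beta> \<in> L \<Longrightarrow> \<gamma> \<in> L \<Longrightarrow> \<epsilon> \<alpha> \<beta> * \<epsilon> (\<alpha> + \<beta>) \<gamma> = \<epsilon> \<alpha> (\<beta> + \<gamma>) * \<epsilon> \<beta> \<gamma>"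
  and eps_0: "\<alpha> \<in> L \<Longrightarrow> \<epsilon> \<alpha> 0 = 1" "\<alpha> \<in> L \<Longrightarrow> \<epsilon> 0 \<alpha> = 1"
  and eps_commutator: "\<alpha> \<in> L \<Longrightarrow> \<beta> \<in> L \<Longrightarrow> \<epsilon> \<alpha> \<beta> = (-1) powi \<lfloor>ipH \<alpha> \<beta>\<rfloor> * \<epsilon> \<beta> \<alpha>"
  using cocycle unfolding lattice_cocycle_def by blast+

lemma L_0: "0 \<in> L" and L_add: "\<alpha> \<in> L \<Longrightarrow> \<beta> \<in> L \<Longrightarrow> \<alpha> + \<beta> \<in> L" and L_minus: "\<alpha> \<in> L \<Longrightarrow> - \<alpha> \<in> L"
  by (auto simp: L_def zero_prod_def)

lemma L_diff: "\<alpha> \<in> L \<Longrightarrow> \<beta> \<in> L \<Longrightarrow> \<alpha> - \<beta> \<in> L"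
  using L_add[OF _ L_minus, of \<alpha> \<beta>] by simp

abbreviation A :: "(H \<times> bool monomial) fva" where
  "A \<equiv> C_fva R \<epsilon>"

abbreviation YA :: "stateH \<Rightarrow> (stateH, stateH) series" where
  "YA \<equiv> h.Ytwist \<epsilon>"

lemma A_simps: "carr A = supp_on (L \<times> UNIV)" "vac A = h.ev 0" "Y A = YA"
  by (simp_all add: C_fva_def fock_sum_eq)

lemma fock_proj_bas: "h.fock_proj \<alpha> (bas x) = (if fst x = \<alpha> then bas x else 0)"
  by (cases x) (simp add: h.fock_proj_def)

lemma clinear_fock_proj: "clinear (h.fock_proj \<alpha>)"
  by (simp add: h.fock_proj_def clinear_lin)

lemma finite_fock_proj: "finite {\<alpha>. h.fock_proj \<alpha> v \<noteq> 0}"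
proof -
  have "{\<alpha>. h.fock_proj \<alpha> v \<noteq> 0} \<subseteq> fst ` supp v"
  proof safe
    fix \<alpha> assume "h.fock_proj \<alpha> v \<noteq> 0"
    then obtain x where "x \<in> supp v" "scale (coef v x) (case x of (\<beta>, \<mu>) \<Rightarrow> if \<beta> = \<alpha> then bas (\<beta>, \<mu>) else 0) \<noteq> 0"
      unfolding h.fock_proj_def lin_def by (elim sum.not_neutral_contains_not_neutral)
    then show "\<alpha> \<in> fst ` supp v" by (force split: if_splits prod.splits)
  qed
  then show ?thesis by (rule finite_subset) simp
qed

lemma YA_summand:
  "clinear (\<lambda>a. case p of (\<alpha>, \<beta>) \<Rightarrow> scale (\<epsilon> \<alpha> \<beta>) (h.Yhat (h.fock_proj \<alpha> a) r s (h.fock_proj \<beta> w)))"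
  "clinear (\<lambda>w. case p of (\<alpha>, \<beta>) \<Rightarrow> scale (\<epsilon> \<alpha> \<beta>) (h.Yhat (h.fock_proj \<alpha> a) r s (h.fock_proj \<beta> w)))"
  by (cases p, simp add: clinear_scaled[OF clinear_compose[OF clinear_Yhat_left clinear_fock_proj]]
      clinear_scaled[OF clinear_compose[OF clinear_Yhat_right clinear_fock_proj]])+

lemma YA_finite:
  "finite {p. (case p of (\<alpha>, \<beta>) \<Rightarrow> scale (\<epsilon> \<alpha> \<beta>) (h.Yhat (h.fock_proj \<alpha> a) r s (h.fock_proj \<beta> w))) \<noteq> 0}"
proof (rule finite_subset)
  show "{p. (case p of (\<alpha>, \<beta>) \<Rightarrow> scale (\<epsilon> \<alpha> \<beta>) (h.Yhat (h.fock_proj \<alpha> a) r s (h.fock_proj \<beta> w))) \<noteq> 0} \<subseteq>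
      {\<alpha>. h.fock_proj \<alpha> a \<noteq> 0} \<times> {\<beta>. h.fock_proj \<beta> w \<noteq> 0}"
    by (auto simp: clinear_zero[OF clinear_Yhat_left] clinear_zero[OF clinear_Yhat_right])
qed (simp add: finite_fock_proj)

lemma clinear_YA_left: "clinear (\<lambda>a. YA a r s w)"
  unfolding h.Ytwist_def by (rule clinear_Sum_any_fun[OF YA_summand(1) YA_finite])

lemma clinear_YA_right: "clinear (YA a r s)"
proof -
  have "YA a r s = (\<lambda>w. Sum_any (\<lambda>(\<alpha>, \<beta>). scale (\<epsilon> \<alpha> \<beta>) (h.Yhat (h.fock_proj \<alpha> a) r s (h.fock_proj \<beta> w))))"
    by (simp add: h.Ytwist_def fun_eq_iff)
  then show ?thesis using clinear_Sum_any_fun[OF YA_summand(2) YA_finite] by simp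
qed

lemma YA_bas: "YA (bas x) r s (bas y) = scale (\<epsilon> (fst x) (fst y)) (h.Yhat (bas x) r s (bas y))"
proof -
  have "YA (bas x) r s (bas y) = Sum_any (\<lambda>p. if p = (fst x, fst y) then scale (\<epsilon> (fst x) (fst y)) (h.Yhat (bas x) r s (bas y)) else 0)"
    unfolding h.Ytwist_def
    by (intro arg_cong[where f = Sum_any] ext)
      (auto simp: fock_proj_bas clinear_zero[OF clinear_Yhat_left] clinear_zero[OF clinear_Yhat_right]
        split: if_splits)
  then show ?thesis by simp
qed

lemma YA_J2_bas:
  "YA (J2 (bas (s, \<mu>)) (bas (t, \<nu>))) r q (J2 (bas (s', \<mu>')) (bas (t', \<nu>'))) =
    scale (\<epsilon> (g s t) (g s' t')) (J2 (Y1 (bas (s, \<mu>)) r 0 (bas (s', \<mu>'))) (Y1 (bas (t, \<nu>)) q 0 (bas (t', \<nu>'))))"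
proof -
  have "YA (J2 (bas (s, \<mu>)) (bas (t, \<nu>))) r q (J2 (bas (s', \<mu>')) (bas (t', \<nu>'))) =
      scale (\<epsilon> (g s t) (g s' t')) (h.Yhat (J2 (bas (s, \<mu>)) (bas (t, \<nu>))) r q (J2 (bas (s', \<mu>')) (bas (t', \<nu>'))))"
    unfolding J2_bas clinear_scale[OF clinear_YA_left] clinear_scale[OF clinear_YA_right] YA_bas
      clinear_scale[OF clinear_Yhat_left] clinear_scale[OF clinear_Yhat_right]
    by (simp add: mult_ac)
  then show ?thesis by (simp add: Yhat_J2)
qed

lemma YA_J2:
  assumes "a \<in> charge s" "b \<in> charge t" "u \<in> charge s'" "v \<in> charge t'"
  shows "YA (J2 a b) r q (J2 u v) = scale (\<epsilon> (g s t) (g s' t')) (J2 (Y1 a r 0 u) (Y1 b q 0 v))"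
proof (rule bilin_eqI[of "\<lambda>a b. YA (J2 a b) r q (J2 u v)"])
  fix i j assume "i \<in> supp a" "j \<in> supp b"
  then obtain \<mu> \<nu> where ij: "i = (s, \<mu>)" "j = (t, \<nu>)" using assms by (force simp: supp_on_def)
  show "YA (J2 (bas i) (bas j)) r q (J2 u v) = scale (\<epsilon> (g s t) (g s' t')) (J2 (Y1 (bas i) r 0 u) (Y1 (bas j) q 0 v))"
  proof (rule bilin_eqI[of "\<lambda>u v. YA (J2 (bas i) (bas j)) r q (J2 u v)"])
    fix m n assume "m \<in> supp u" "n \<in> supp v"
    then obtain \<mu>' \<nu>' where mn: "m = (s', \<mu>')" "n = (t', \<nu>')" using assms by (force simp: supp_on_def)
    show "YA (J2 (bas i) (bas j)) r q (J2 (bas m) (bas n)) = scale (\<epsilon> (g s t) (g s' t')) (J2 (Y1 (bas i) r 0 (bas m)) (Y1 (bas j) q 0 (bas n)))"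
      unfolding ij mn by (rule YA_J2_bas)
  qed (intro clinear_compose[OF clinear_YA_right] clinear_J2_left clinear_J2_right clinear_scaled
      clinear_compose[OF clinear_J2_left clinear_Y1_right] clinear_compose[OF clinear_J2_right clinear_Y1_right])+
qed (intro clinear_compose[OF clinear_YA_left] clinear_J2_left clinear_J2_right clinear_scaled
    clinear_compose[OF clinear_J2_left clinear_Y1_left] clinear_compose[OF clinear_J2_right clinear_Y1_left])+

section \<open>Chiral and anti-chiral vectors\<close>

lemma J_in_supp_on: "J b \<in> supp_on (fuse ` S) \<longleftrightarrow> b \<in> supp_on S"
proof -
  have l: "coef (J b) (fuse x) = 0 \<longleftrightarrow> coef b x = 0" for x
    unfolding J_def by (simp add: lookup_monomial_map[OF inj_fuse] sgn_deg_nonzero)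
  have "J b \<in> supp_on (fuse ` S) \<longleftrightarrow> (\<forall>y. y \<notin> fuse ` S \<longrightarrow> coef (J b) y = 0)"
    by (rule supp_on_iff)
  also have "\<dots> \<longleftrightarrow> (\<forall>x. fuse x \<notin> fuse ` S \<longrightarrow> coef (J b) (fuse x) = 0)"
    using surj_fuse by (metis surjD)
  also have "\<dots> \<longleftrightarrow> b \<in> supp_on S"
    unfolding l inj_image_mem_iff[OF inj_fuse] by (rule supp_on_iff[symmetric])
  finally show ?thesis .
qed

lemma vac_J2: "h.ev 0 = J2 (r1.ev 0) (r1.ev 0)"
  using ev_g[of 0 0] by (simp add: g_0)

text \<open>
  The charges of $\ker \bar D$ and of $\ker D$: the two axes, intersected with the lattice.
\<close>

definition S1 :: "real set" where
  "S1 = {s. g s 0 \<in> L}"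

definition S2 :: "real set" where
  "S2 = {t. g 0 t \<in> L}"

text \<open>
  Indices of the bases of $\ker \bar D$ and $\ker D$ before the identification of the Fock spaces.
\<close>

definition K1 :: "((real \<times> unit monomial) \<times> (real \<times> unit monomial)) set" where
  "K1 = (S1 \<times> UNIV) \<times> {(0, 0)}"

definition K2 :: "((real \<times> unit monomial) \<times> (real \<times> unit monomial)) set" where
  "K2 = {(0, 0)} \<times> (S2 \<times> UNIV)"

lemma fst_fuse: "fst (fuse x) = g (fst (fst x)) (fst (snd x))"
  by (cases x rule: fuse.cases) simp

lemma carr_A_eq: "supp_on (L \<times> UNIV) = supp_on (fuse ` {x. g (fst (fst x)) (fst (snd x)) \<in> L})"
proof -
  have "L \<times> UNIV = fuse ` {x. g (fst (fst x)) (fst (snd x)) \<in> L}"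
  proof safe
    fix \<alpha> \<kappa> assume "\<alpha> \<in> L"
    moreover obtain x where x: "(\<alpha>, \<kappa>) = fuse x" using surj_fuse by (metis surjD)
    ultimately have "g (fst (fst x)) (fst (snd x)) \<in> L" using fst_fuse[of x] by (metis fst_conv)
    then show "(\<alpha>, \<kappa>) \<in> fuse ` {x. g (fst (fst x)) (fst (snd x)) \<in> L}" unfolding x by blast
  qed auto
  then show ?thesis by simp
qed

lemma YA_vac_J2:
  assumes "g s t \<in> L" "a \<in> charge s" "b \<in> charge t"
  shows "YA (J2 a b) r q (h.ev 0) = J2 (Y1 a r 0 (r1.ev 0)) (Y1 b q 0 (r1.ev 0))"
  using YA_J2[OF assms(2,3), of "r1.ev 0" 0 "r1.ev 0" 0 r q] eps_0[OF assms(1)]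
  by (simp add: vac_J2 g_0) (simp add: r1.ev_def)

lemma YA_vac_tens:
  assumes "b \<in> supp_on {x. g (fst (fst x)) (fst (snd x)) \<in> L}"
  shows "YA (J b) r q (h.ev 0) = J (lin (\<lambda>(x, y). tens (Y1 (bas x) r 0 (r1.ev 0)) (Y1 (bas y) q 0 (r1.ev 0))) b)"
proof (rule clinear_eqI[OF clinear_compose[OF clinear_YA_left clinear_J] clinear_compose[OF clinear_J clinear_lin]])
  fix p assume "p \<in> supp b"
  then have p: "g (fst (fst p)) (fst (snd p)) \<in> L" using assms by (auto simp: supp_on_def)
  obtain s \<mu> t \<nu> where pe: "p = ((s, \<mu>), (t, \<nu>))" by (metis surj_pair)
  have "YA (J2 (bas (s, \<mu>)) (bas (t, \<nu>))) r q (h.ev 0) = J2 (Y1 (bas (s, \<mu>)) r 0 (r1.ev 0)) (Y1 (bas (t, \<nu>)) q 0 (r1.ev 0))"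
    using p by (intro YA_vac_J2) (auto simp: pe)
  then show "YA (J (bas p)) r q (h.ev 0) = J (lin (\<lambda>(x, y). tens (Y1 (bas x) r 0 (r1.ev 0)) (Y1 (bas y) q 0 (r1.ev 0))) (bas p))"
    by (simp add: pe J2_def)
qed

text \<open>
  The components of an element of a tensor product with respect to a basis of one factor.  They reduce
  $(1 \otimes D) b = 0$ to $D b_x = 0$ for all components $b_x$.
\<close>

definition slice_right :: "real \<times> unit monomial \<Rightarrow> state2 \<Rightarrow> state1" where
  "slice_right x = lin (\<lambda>(x', y). if x' = x then bas y else 0)"

definition slice_left :: "real \<times> unit monomial \<Rightarrow> state2 \<Rightarrow> state1" where
  "slice_left y = lin (\<lambda>(x, y'). if y' = y then bas x else 0)"

lemma clinear_slice: "clinear (slice_right x)" "clinear (slice_left x)"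
  unfolding slice_right_def slice_left_def by (rule clinear_lin)+

lemma lookup_slice: "coef (slice_right x b) y = coef b (x, y)"
  "coef (slice_left y b) x = coef b (x, y)"
proof -
  show "coef (slice_right x b) y = coef b (x, y)"
  proof (induction b rule: vec_induct)
    case (bas c i)
    then show ?case
      by (cases i) (auto simp: clinear_scale[OF clinear_slice(1)] slice_right_def lin_scale lookup_single when_def)
  qed (simp_all add: clinear_zero[OF clinear_slice(1)] clinear_add[OF clinear_slice(1)] lookup_add)
  show "coef (slice_left y b) x = coef b (x, y)"
  proof (induction b rule: vec_induct)
    case (bas c i)
    then show ?case
      by (cases i) (auto simp: clinear_scale[OF clinear_slice(2)] slice_left_def lin_scale lookup_single when_def)
  qed (simp_all add: clinear_zero[OF clinear_slice(2)] clinear_add[OF clinear_slice(2)] lookup_add)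
qed

lemma slice_tens: "slice_right x (tens u v) = scale (coef u x) v"
  "slice_left y (tens u v) = scale (coef v y) u"
  by (rule poly_mapping_eqI, simp add: lookup_slice lookup_tens)+

lemma slice_D1:
  "slice_right x (lin (\<lambda>(x, y). tens (bas x) (D1 (bas y))) b) = D1 (slice_right x b)"
  "slice_left y (lin (\<lambda>(x, y). tens (D1 (bas x)) (bas y)) b) = D1 (slice_left y b)"
proof -
  show "slice_right x (lin (\<lambda>(x, y). tens (bas x) (D1 (bas y))) b) = D1 (slice_right x b)"
    by (rule clinear_eqI[OF clinear_compose[OF clinear_slice(1) clinear_lin] clinear_compose[OF clinear_D1 clinear_slice(1)]])
      (auto simp: slice_tens, auto simp: slice_right_def lookup_single when_def clinear_zero[OF clinear_D1])
  show "slice_left y (lin (\<lambda>(x, y). tens (D1 (bas x)) (bas y)) b) = D1 (slice_left y b)"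
    by (rule clinear_eqI[OF clinear_compose[OF clinear_slice(2) clinear_lin] clinear_compose[OF clinear_D1 clinear_slice(2)]])
      (auto simp: slice_tens, auto simp: slice_left_def lookup_single when_def clinear_zero[OF clinear_D1])
qed

lemma D1_bas_00: "D1 (bas (0, 0)) = 0"
  using D1_vac by (simp add: r1.ev_def)

text \<open>
  Under the identification of the Fock spaces $\bar D$ is $1 \otimes D$, the value of the cocycle with
  the vacuum being $1$; hence its kernel is given by the kernel of $D$ in rank one.
\<close>

lemma carr_ker_Dbar: "carr (ker_Dbar A) = supp_on (fuse ` K1)"
proof -
  have D: "Dbar A (J b) = J (lin (\<lambda>(x, y). tens (bas x) (D1 (bas y))) b)"
    if "b \<in> supp_on {x. g (fst (fst x)) (fst (snd x)) \<in> L}" for b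
    using YA_vac_tens[OF that, of 0 1] by (simp add: Dbar_def fmode_def A_simps Y1_creation D1_def)
  have J0: "J w = 0 \<longleftrightarrow> w = 0" for w by (metis Jinv_J clinear_zero[OF clinear_J])
  have "J b \<in> carr (ker_Dbar A) \<longleftrightarrow> J b \<in> supp_on (fuse ` K1)" for b
  proof
    assume "J b \<in> carr (ker_Dbar A)"
    then have b: "b \<in> supp_on {x. g (fst (fst x)) (fst (snd x)) \<in> L}" and "Dbar A (J b) = 0"
      by (simp_all add: ker_Dbar_def A_simps carr_A_eq J_in_supp_on)
    then have z: "lin (\<lambda>(x, y). tens (bas x) (D1 (bas y))) b = 0" by (simp only: D[OF b] J0)
    have "D1 (slice_right x b) = 0" for x
      using slice_D1(1)[of x b] unfolding z by (simp add: clinear_zero[OF clinear_slice(1)])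
    then have "slice_right x b \<in> supp_on {(0, 0)}" for x by (rule D1_kernel)
    then have *: "coef b (x, y) = 0" if "y \<noteq> (0, 0)" for x y
      using that unfolding supp_on_iff lookup_slice by blast
    have "p \<in> K1" if p: "p \<in> supp b" for p
    proof -
      obtain x y where xy: "p = (x, y)" by (cases p)
      have "y = (0, 0)" using p * unfolding xy in_keys_iff by blast
      moreover have "g (fst x) (fst y) \<in> L" using b p unfolding supp_on_def xy by auto
      ultimately show ?thesis by (cases x; cases y) (auto simp: K1_def S1_def xy)
    qed
    then have "b \<in> supp_on K1" unfolding supp_on_def by blast
    then show "J b \<in> supp_on (fuse ` K1)" unfolding J_in_supp_on .
  next
    assume "J b \<in> supp_on (fuse ` K1)"
    then have b: "b \<in> supp_on K1" by (simp add: J_in_supp_on)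
    have b': "b \<in> supp_on {x. g (fst (fst x)) (fst (snd x)) \<in> L}"
      using b by (auto simp: supp_on_def K1_def S1_def)
    have "lin (\<lambda>(x, y). tens (bas x) (D1 (bas y))) b = 0"
      by (rule clinear_eqI[OF clinear_lin clinear_zero_fun]) (use b in \<open>auto simp: supp_on_def K1_def D1_bas_00\<close>)
    then show "J b \<in> carr (ker_Dbar A)"
      using b' by (simp add: ker_Dbar_def A_simps carr_A_eq J_in_supp_on D J0)
  qed
  then show ?thesis by (metis J_Jinv set_eqI)
qed

lemma carr_ker_D: "carr (ker_D A) = supp_on (fuse ` K2)"
proof -
  have D: "Dop A (J b) = J (lin (\<lambda>(x, y). tens (D1 (bas x)) (bas y)) b)"
    if "b \<in> supp_on {x. g (fst (fst x)) (fst (snd x)) \<in> L}" for b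
    using YA_vac_tens[OF that, of 1 0] by (simp add: Dop_def fmode_def A_simps Y1_creation D1_def)
  have J0: "J w = 0 \<longleftrightarrow> w = 0" for w by (metis Jinv_J clinear_zero[OF clinear_J])
  have "J b \<in> carr (ker_D A) \<longleftrightarrow> J b \<in> supp_on (fuse ` K2)" for b
  proof
    assume "J b \<in> carr (ker_D A)"
    then have b: "b \<in> supp_on {x. g (fst (fst x)) (fst (snd x)) \<in> L}" and "Dop A (J b) = 0"
      by (simp_all add: ker_D_def A_simps carr_A_eq J_in_supp_on)
    then have z: "lin (\<lambda>(x, y). tens (D1 (bas x)) (bas y)) b = 0" by (simp only: D[OF b] J0)
    have "D1 (slice_left y b) = 0" for y
      using slice_D1(2)[of y b] unfolding z by (simp add: clinear_zero[OF clinear_slice(2)])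
    then have "slice_left y b \<in> supp_on {(0, 0)}" for y by (rule D1_kernel)
    then have *: "coef b (x, y) = 0" if "x \<noteq> (0, 0)" for x y
      using that unfolding supp_on_iff lookup_slice by blast
    have "p \<in> K2" if p: "p \<in> supp b" for p
    proof -
      obtain x y where xy: "p = (x, y)" by (cases p)
      have "x = (0, 0)" using p * unfolding xy in_keys_iff by blast
      moreover have "g (fst x) (fst y) \<in> L" using b p unfolding supp_on_def xy by auto
      ultimately show ?thesis by (cases x; cases y) (auto simp: K2_def S2_def xy)
    qed
    then have "b \<in> supp_on K2" unfolding supp_on_def by blast
    then show "J b \<in> supp_on (fuse ` K2)" unfolding J_in_supp_on .
  next
    assume "J b \<in> supp_on (fuse ` K2)"
    then have b: "b \<in> supp_on K2" by (simp add: J_in_supp_on)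
    have b': "b \<in> supp_on {x. g (fst (fst x)) (fst (snd x)) \<in> L}"
      using b by (auto simp: supp_on_def K2_def S2_def)
    have "lin (\<lambda>(x, y). tens (D1 (bas x)) (bas y)) b = 0"
      by (rule clinear_eqI[OF clinear_lin clinear_zero_fun]) (use b in \<open>auto simp: supp_on_def K2_def D1_bas_00\<close>)
    then show "J b \<in> carr (ker_D A)"
      using b' by (simp add: ker_D_def A_simps carr_A_eq J_in_supp_on D J0)
  qed
  then show ?thesis by (metis J_Jinv set_eqI)
qed

lemma ker_tens_simps:
  "carr (ker_tens A) = supp_on (fuse ` K1 \<times> fuse ` K2)" "vac (ker_tens A) = tens (h.ev 0) (h.ev 0)"
  "Y (ker_tens A) = tens_action YA YA"
proof -
  have *: "vac (ker_Dbar A) = h.ev 0" "Y (ker_Dbar A) = YA" "vac (ker_D A) = h.ev 0" "Y (ker_D A) = YA"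
    by (simp_all add: ker_Dbar_def ker_D_def A_simps)
  show "carr (ker_tens A) = supp_on (fuse ` K1 \<times> fuse ` K2)" "vac (ker_tens A) = tens (h.ev 0) (h.ev 0)"
    "Y (ker_tens A) = tens_action YA YA"
    by (simp_all add: ker_tens_def tens_fva_def carr_ker_Dbar carr_ker_D tens_space_supp_on *)
qed

end

section \<open>The algebra generated by the kernels and its coset modules\<close>
lemma sgn_deg_square: "sgn_deg \<mu> * sgn_deg \<mu> = 1"
  by (simp add: sgn_deg_def flip: power_mult_distrib)

context circle
begin

lemma J2_left_bas: "J2 (bas x) (r1.ev 0) = bas (fuse (x, (0, 0)))"
  by (cases x) (simp add: r1.ev_def J2_bas sgn_deg_0)

lemma J2_right_bas: "bas (fuse ((0, 0), y)) = scale (sgn_deg (snd y)) (J2 (r1.ev 0) (bas y))"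
  by (cases y) (simp add: r1.ev_def J2_bas sgn_deg_square)

lemma image_fuse: "fuse ` ((S \<times> UNIV) \<times> (T \<times> UNIV)) = {g s t | s t. s \<in> S \<and> t \<in> T} \<times> UNIV"
proof
  show "{g s t | s t. s \<in> S \<and> t \<in> T} \<times> UNIV \<subseteq> fuse ` ((S \<times> UNIV) \<times> (T \<times> UNIV))"
  proof
    fix p assume "p \<in> {g s t | s t. s \<in> S \<and> t \<in> T} \<times> (UNIV :: bool monomial set)"
    then obtain s t \<kappa> where p: "p = (g s t, \<kappa>)" "s \<in> S" "t \<in> T" by blast
    obtain \<mu> \<nu> where "\<kappa> = merge \<mu> \<nu>" using merge_surj by blast
    then show "p \<in> fuse ` ((S \<times> UNIV) \<times> (T \<times> UNIV))"
      using p by (intro image_eqI[of _ _ "((s, \<mu>), (t, \<nu>))"]) auto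
  qed
  show "fuse ` ((S \<times> UNIV) \<times> (T \<times> UNIV)) \<subseteq> {g s t | s t. s \<in> S \<and> t \<in> T} \<times> UNIV"
  proof
    fix p assume "p \<in> fuse ` ((S \<times> UNIV) \<times> (T \<times> UNIV))"
    then obtain s \<mu> t \<nu> where "p = fuse ((s, \<mu>), (t, \<nu>))" "s \<in> S" "t \<in> T" by auto
    then show "p \<in> {g s t | s t. s \<in> S \<and> t \<in> T} \<times> UNIV" by (simp only: fuse.simps) blast
  qed
qed

lemma bas_charge: "bas (s, \<mu>) \<in> charge s" and ev_charge: "r1.ev s \<in> charge s"
  by (simp_all add: r1.ev_def)

end

text \<open>
  On the sublattice $L'$ generated by its intersections with the axes the cocycle is the coboundary of
  \<open>eta\<close>: the elements \<open>eta \<alpha>\<close>$\,\mathsf e_\alpha$ multiply like the elements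
  of an ordinary group algebra.
\<close>

locale trivialized = circle_cocycle +
  fixes eta :: "H \<Rightarrow> complex"
  assumes eta_nonzero: "\<And>s t. s \<in> S1 \<Longrightarrow> t \<in> S2 \<Longrightarrow> eta (g s t) \<noteq> 0"
    and eta_mult: "\<And>s t s' t'. s \<in> S1 \<Longrightarrow> t \<in> S2 \<Longrightarrow> s' \<in> S1 \<Longrightarrow> t' \<in> S2 \<Longrightarrow>
      eta (g (s + s') (t + t')) = eta (g s t) * eta (g s' t') * \<epsilon> (g s t) (g s' t')"
begin

lemma S1_group: "0 \<in> S1" "s \<in> S1 \<Longrightarrow> s' \<in> S1 \<Longrightarrow> s + s' \<in> S1" "s \<in> S1 \<Longrightarrow> s' \<in> S1 \<Longrightarrow> s - s' \<in> S1"
  and S2_group: "0 \<in> S2" "t \<in> S2 \<Longrightarrow> t' \<in> S2 \<Longrightarrow> t + t' \<in> S2" "t \<in> S2 \<Longrightarrow> t' \<in> S2 \<Longrightarrow> t - t' \<in> S2"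
proof -
  have d: "g (s - s') 0 = g s 0 - g s' 0" "g 0 (t - t') = g 0 t - g 0 t'" for s s' t t'
    by (simp_all add: g_def algebra_simps)
  show "0 \<in> S1" "s \<in> S1 \<Longrightarrow> s' \<in> S1 \<Longrightarrow> s + s' \<in> S1" "s \<in> S1 \<Longrightarrow> s' \<in> S1 \<Longrightarrow> s - s' \<in> S1"
    "0 \<in> S2" "t \<in> S2 \<Longrightarrow> t' \<in> S2 \<Longrightarrow> t + t' \<in> S2" "t \<in> S2 \<Longrightarrow> t' \<in> S2 \<Longrightarrow> t - t' \<in> S2"
    using L_0 L_add L_diff g_add[of s s' 0 0] g_add[of 0 0 t t'] by (auto simp: S1_def S2_def g_0 d)
qed

lemma g_in_L: "s \<in> S1 \<Longrightarrow> t \<in> S2 \<Longrightarrow> g s t \<in> L"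
  using g_add[of s 0 0 t] by (auto simp: S1_def S2_def intro: L_add)

lemma eta_0: "eta (g 0 0) = 1"
  using eta_mult[of 0 0 0 0] eta_nonzero[of 0 0] S1_group(1) S2_group(1) eps_0(1)[OF L_0] by (simp add: g_0)

lemma eta_axes: "s \<in> S1 \<Longrightarrow> t \<in> S2 \<Longrightarrow> eta (g s t) = eta (g s 0) * eta (g 0 t) * \<epsilon> (g s 0) (g 0 t)"
  using eta_mult[of s 0 0 t] S1_group(1) S2_group(1) by simp

text \<open>
  $a \otimes b \mapsto (a \otimes \mathbf 1) \otimes (\mathbf 1 \otimes b)$, rescaled by the cochain on
  both axes.
\<close>

definition phi :: "state2 \<Rightarrow> ((H \<times> bool monomial) \<times> (H \<times> bool monomial)) \<Rightarrow>\<^sub>0 complex" where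
  "phi = monomial_map (\<lambda>(x, y). eta (g (fst x) 0) * eta (g 0 (fst y)) * sgn_deg (snd y))
    (\<lambda>(x, y). (fuse (x, (0, 0)), fuse ((0, 0), y)))"

lemma clinear_phi: "clinear phi"
  by (simp add: phi_def clinear_monomial_map)

lemma phi_bas: "phi (bas (x, y)) =
    scale (eta (g (fst x) 0) * eta (g 0 (fst y)) * sgn_deg (snd y)) (bas (fuse (x, (0, 0)), fuse ((0, 0), y)))"
  by (simp add: phi_def)

lemma phi_tens:
  assumes "u \<in> charge s" "v \<in> charge t"
  shows "phi (tens u v) = scale (eta (g s 0) * eta (g 0 t)) (tens (J2 u (r1.ev 0)) (J2 (r1.ev 0) v))"
proof (rule bilin_eqI[of "\<lambda>u v. phi (tens u v)"])
  fix i j assume "i \<in> supp u" "j \<in> supp v"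
  then obtain \<mu> \<nu> where ij: "i = (s, \<mu>)" "j = (t, \<nu>)" using assms by (force simp: supp_on_def)
  have "phi (tens (bas i) (bas j)) = scale (eta (g s 0) * eta (g 0 t) * sgn_deg \<nu>)
      (tens (bas (fuse (i, (0, 0)))) (bas (fuse ((0, 0), j))))"
    by (simp only: tens_bas phi_bas) (simp add: ij)
  also have "\<dots> = scale (eta (g s 0) * eta (g 0 t) * sgn_deg \<nu>)
      (tens (J2 (bas i) (r1.ev 0)) (scale (sgn_deg \<nu>) (J2 (r1.ev 0) (bas j))))"
    by (simp only: J2_left_bas J2_right_bas) (simp add: ij)
  also have "\<dots> = scale (eta (g s 0) * eta (g 0 t) * (sgn_deg \<nu> * sgn_deg \<nu>)) (tens (J2 (bas i) (r1.ev 0)) (J2 (r1.ev 0) (bas j)))"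
    by (simp only: tens_scale_right cvs.scale_scale mult.assoc)
  finally show "phi (tens (bas i) (bas j)) = scale (eta (g s 0) * eta (g 0 t)) (tens (J2 (bas i) (r1.ev 0)) (J2 (r1.ev 0) (bas j)))"
    by (simp only: sgn_deg_square mult_1_right)
qed (intro clinear_compose[OF clinear_phi] clinear_tens_left clinear_tens_right clinear_scaled
    clinear_compose[OF clinear_tens_left clinear_J2_left] clinear_compose[OF clinear_tens_right clinear_J2_right])+

text \<open>
  A chiral vector has no powers of $\bar z$ and an antichiral one no powers of $z$, so again only
  one term of the convolution remains.
\<close>

lemma tens_action_YA:
  assumes "i = (s, \<mu>)" "j = (t, \<nu>)" "m = (s', \<mu>')" "n = (t', \<nu>')"
  shows "tens_action YA YA (bas (fuse (i, (0, 0)), fuse ((0, 0), j))) r q (bas (fuse (m, (0, 0)), fuse ((0, 0), n))) =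
    scale (\<epsilon> (g s 0) (g s' 0) * \<epsilon> (g 0 t) (g 0 t') * (sgn_deg \<nu> * sgn_deg \<nu>'))
      (tens (J2 (Y1 (bas i) r 0 (bas m)) (r1.ev 0)) (J2 (r1.ev 0) (Y1 (bas j) q 0 (bas n))))" (is "_ = ?rhs")
proof -
  have left: "YA (bas (fuse (i, (0, 0)))) r' s'' (bas (fuse (m, (0, 0)))) =
      scale (\<epsilon> (g s 0) (g s' 0)) (J2 (Y1 (bas i) r' 0 (bas m)) (if s'' = 0 then r1.ev 0 else 0))" for r' s''
    unfolding J2_left_bas[symmetric] assms
    by (subst YA_J2[OF bas_charge ev_charge bas_charge ev_charge]) (simp add: Y1_vac)
  have right: "YA (bas (fuse ((0, 0), j))) r' s'' (bas (fuse ((0, 0), n))) =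
      scale (\<epsilon> (g 0 t) (g 0 t') * (sgn_deg \<nu> * sgn_deg \<nu>')) (J2 (if r' = 0 then r1.ev 0 else 0) (Y1 (bas j) s'' 0 (bas n)))" for r' s''
    unfolding J2_right_bas assms snd_conv clinear_scale[OF clinear_YA_left] clinear_scale[OF clinear_YA_right]
    by (subst YA_J2[OF ev_charge bas_charge ev_charge bas_charge]) (simp add: Y1_vac mult_ac)
  have "tens_action YA YA (bas (fuse (i, (0, 0)), fuse ((0, 0), j))) r q (bas (fuse (m, (0, 0)), fuse ((0, 0), n))) =
      Sum_any (\<lambda>a. if a = (r, 0::real) then ?rhs else 0)"
    unfolding tens_action_bas left right
    by (intro arg_cong[where f = Sum_any] ext) (auto simp: tens_scale_left tens_scale_right mult_ac split: if_splits)
  then show ?thesis by simp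
qed

theorem fva_iso_phi:
  assumes src: "carr V = bifock S1 S2" "vac V = tens (r1.ev 0) (r1.ev 0)" "Y V = Y2"
  shows "fva_iso phi V (ker_tens A)"
proof (rule fva_isoI)
  let ?h = "\<lambda>(x, y). (fuse (x, (0, 0)), fuse ((0, 0), y))"
  show "clinear phi" by (rule clinear_phi)
  have "inj ?h" by (rule injI) (auto simp: g_inject merge_inject)
  then have inj: "inj_on ?h ((S1 \<times> UNIV) \<times> (S2 \<times> UNIV))" by (rule inj_on_subset) simp
  have img: "?h ` ((S1 \<times> UNIV) \<times> (S2 \<times> UNIV)) = fuse ` K1 \<times> fuse ` K2"
    unfolding K1_def K2_def by (auto simp: image_iff; force)
  have nz: "(case p of (x, y) \<Rightarrow> eta (g (fst x) 0) * eta (g 0 (fst y)) * sgn_deg (snd y)) \<noteq> 0"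
    if "p \<in> (S1 \<times> UNIV) \<times> (S2 \<times> UNIV)" for p
    using that eta_nonzero S1_group(1) S2_group(1) by (auto simp: sgn_deg_nonzero)
  show "bij_betw phi (carr V) (carr (ker_tens A))"
    unfolding src ker_tens_simps phi_def img[symmetric] by (rule bij_betw_monomial_map[OF inj nz])
  show "phi (vac V) = vac (ker_tens A)"
    unfolding src ker_tens_simps phi_tens[OF ev_charge ev_charge] vac_J2 by (simp add: eta_0)
  show "closed_under (carr V) (Y V) (carr V)"
    unfolding src by (intro closed_under_Y2 S1_group S2_group)
  fix a b r q assume a: "a \<in> carr V" and b: "b \<in> carr V"
  show "phi (Y V a r q b) = Y (ker_tens A) (phi a) r q (phi b)"
    unfolding src ker_tens_simps
  proof (rule bilin_eqI[of "\<lambda>a b. phi (Y2 a r q b)" "\<lambda>a b. tens_action YA YA (phi a) r q (phi b)"])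
    fix p p' assume "p \<in> supp a" "p' \<in> supp b"
    then have pS: "p \<in> (S1 \<times> UNIV) \<times> (S2 \<times> UNIV)" "p' \<in> (S1 \<times> UNIV) \<times> (S2 \<times> UNIV)"
      using a b unfolding src supp_on_def by auto
    obtain s \<mu> t \<nu> s' \<mu>' t' \<nu>' where eq: "p = ((s, \<mu>), (t, \<nu>))" "p' = ((s', \<mu>'), (t', \<nu>'))"
      by (metis surj_pair)
    have st: "s \<in> S1" "t \<in> S2" "s' \<in> S1" "t' \<in> S2" using pS by (auto simp: eq)
    have B1: "eta (g (s + s') 0) = eta (g s 0) * eta (g s' 0) * \<epsilon> (g s 0) (g s' 0)"
      using eta_mult[of s 0 s' 0] st S2_group(1) by simp
    have B2: "eta (g 0 (t + t')) = eta (g 0 t) * eta (g 0 t') * \<epsilon> (g 0 t) (g 0 t')"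
      using eta_mult[of 0 t 0 t'] st S1_group(1) by simp
    let ?E = "tens (J2 (Y1 (bas (s, \<mu>)) r 0 (bas (s', \<mu>'))) (r1.ev 0)) (J2 (r1.ev 0) (Y1 (bas (t, \<nu>)) q 0 (bas (t', \<nu>'))))"
    have "phi (Y2 (bas p) r q (bas p')) = scale (eta (g (s + s') 0) * eta (g 0 (t + t'))) ?E"
      unfolding eq Y2_bas by (intro phi_tens Y1_charge bas_charge)
    also have "\<dots> = scale ((eta (g s 0) * eta (g 0 t) * sgn_deg \<nu>) * (eta (g s' 0) * eta (g 0 t') * sgn_deg \<nu>') *
        (\<epsilon> (g s 0) (g s' 0) * \<epsilon> (g 0 t) (g 0 t') * (sgn_deg \<nu> * sgn_deg \<nu>'))) ?E"
      unfolding B1 B2 using sgn_deg_square[of \<nu>] sgn_deg_square[of \<nu>'] by (simp add: mult_ac)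
    also have "\<dots> = tens_action YA YA (phi (bas p)) r q (phi (bas p'))"
      unfolding eq phi_bas clinear_scale[OF clinear_tens_action_left] clinear_scale[OF clinear_tens_action_right]
        tens_action_YA[OF refl refl refl refl] by (simp add: mult_ac)
    finally show "phi (Y2 (bas p) r q (bas p')) = tens_action YA YA (phi (bas p)) r q (phi (bas p'))" .
  qed (intro clinear_compose[OF clinear_phi] clinear_tens_action_left clinear_tens_action_right
      clinear_compose[OF clinear_tens_action_left clinear_phi] clinear_compose[OF clinear_tens_action_right clinear_phi])+
qed

lemma phi_image: "phi ` bifock S1 S2 = carr (ker_tens A)"
  using fva_iso_phi[of "\<lparr>carr = bifock S1 S2, vac = tens (r1.ev 0) (r1.ev 0), Y = Y2\<rparr>"]
  by (simp add: fva_iso_def bij_betw_def)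

lemma clinear_ker_tens_map: "clinear (ker_tens_map A)"
  by (simp add: ker_tens_map_def clinear_lin)

text \<open>
  The map \<open>phi\<close> contributes the cochain at the two components of the charge, and the product
  $a(-1,-1)b$ the cocycle at these components; together they give the cochain at their sum.
\<close>

lemma ker_tens_map_phi:
  assumes "s \<in> S1" "t \<in> S2"
  shows "ker_tens_map A (phi (bas ((s, \<mu>), (t, \<nu>)))) = scale (eta (g s t)) (J2 (bas (s, \<mu>)) (bas (t, \<nu>)))"
proof -
  have k: "ker_tens_map A (bas (i, j)) = YA (bas i) 0 0 (bas j)" for i j
    by (simp add: ker_tens_map_def fmode_def A_simps)
  have "YA (bas (fuse ((s, \<mu>), (0, 0)))) 0 0 (bas (fuse ((0, 0), (t, \<nu>)))) =
      scale (sgn_deg \<nu> * \<epsilon> (g s 0) (g 0 t)) (J2 (bas (s, \<mu>)) (bas (t, \<nu>)))"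
    unfolding J2_left_bas[symmetric] J2_right_bas snd_conv clinear_scale[OF clinear_YA_right]
    by (subst YA_J2[OF bas_charge ev_charge ev_charge bas_charge]) (simp add: Y1_vac Y1_creation)
  then have "ker_tens_map A (phi (bas ((s, \<mu>), (t, \<nu>)))) =
      scale (eta (g s 0) * eta (g 0 t) * \<epsilon> (g s 0) (g 0 t) * (sgn_deg \<nu> * sgn_deg \<nu>)) (J2 (bas (s, \<mu>)) (bas (t, \<nu>)))"
    unfolding phi_bas clinear_scale[OF clinear_ker_tens_map] k by (simp add: mult_ac)
  then show ?thesis unfolding sgn_deg_square eta_axes[OF assms] by simp
qed

text \<open>
  The rescaling on the coset of $L'$ through $\gamma_0 = $ \<open>g s0 t0\<close>.  In the twisted
  group algebra \<open>coset_coeff\<close>$\,\mathsf e_\gamma$ is the product of $\mathsf e_{\gamma_0}$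
  with the rescaled $\mathsf e_{\gamma - \gamma_0}$ from the left; hence left multiplication by the rescaled
  elements of $L'$ acts on these products without a cocycle.
\<close>

definition coset_coeff :: "real \<Rightarrow> real \<Rightarrow> real \<Rightarrow> real \<Rightarrow> complex" where
  "coset_coeff s0 t0 s t = eta (g (s - s0) (t - t0)) * \<epsilon> (g (s - s0) (t - t0)) (g s0 t0)"

definition psi :: "real \<Rightarrow> real \<Rightarrow> state2 \<Rightarrow> stateH" where
  "psi s0 t0 = monomial_map (\<lambda>(x, y). coset_coeff s0 t0 (fst x) (fst y) * sgn_deg (snd y)) fuse"

lemma clinear_psi: "clinear (psi s0 t0)"
  by (simp add: psi_def clinear_monomial_map)

lemma psi_tens:
  assumes "u \<in> charge s" "v \<in> charge t"
  shows "psi s0 t0 (tens u v) = scale (coset_coeff s0 t0 s t) (J2 u v)"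
proof (rule bilin_eqI[of "\<lambda>u v. psi s0 t0 (tens u v)"])
  fix i j assume "i \<in> supp u" "j \<in> supp v"
  then obtain \<mu> \<nu> where ij: "i = (s, \<mu>)" "j = (t, \<nu>)" using assms by (force simp: supp_on_def)
  show "psi s0 t0 (tens (bas i) (bas j)) = scale (coset_coeff s0 t0 s t) (J2 (bas i) (bas j))"
    by (simp add: ij psi_def J2_bas)
qed (intro clinear_compose[OF clinear_psi] clinear_tens_left clinear_tens_right clinear_scaled
    clinear_J2_left clinear_J2_right)+

text \<open>
  Associativity of the twisted group algebra for
  $\mathsf e_\lambda (\mathsf e_{\gamma - \gamma_0} \mathsf e_{\gamma_0})$ with $\lambda \in L'$.
\<close>

lemma coset_coeff_add:
  assumes g0: "g s0 t0 \<in> L" and st: "s \<in> S1" "t \<in> S2" and st': "s' - s0 \<in> S1" "t' - t0 \<in> S2"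
  shows "coset_coeff s0 t0 (s + s') (t + t') = eta (g s t) * \<epsilon> (g s t) (g s' t') * coset_coeff s0 t0 s' t'"
proof -
  let ?l = "g s t" and ?l' = "g (s' - s0) (t' - t0)" and ?c = "g s0 t0"
  have sum: "g (s + s' - s0) (t + t' - t0) = ?l + ?l'" "?l' + ?c = g s' t'"
    using g_add[of s "s' - s0" t "t' - t0"] g_add[of "s' - s0" s0 "t' - t0" t0] by (simp_all add: add_diff_eq)
  have mult: "eta (?l + ?l') = eta ?l * eta ?l' * \<epsilon> ?l ?l'"
    using eta_mult[OF st st'] g_add[of s "s' - s0" t "t' - t0"] by simp
  have coc: "\<epsilon> ?l ?l' * \<epsilon> (?l + ?l') ?c = \<epsilon> ?l (g s' t') * \<epsilon> ?l' ?c"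
    using eps_cocycle[OF g_in_L[OF st] g_in_L[OF st'] g0] unfolding sum(2) .
  have "coset_coeff s0 t0 (s + s') (t + t') = eta ?l * eta ?l' * (\<epsilon> ?l ?l' * \<epsilon> (?l + ?l') ?c)"
    unfolding coset_coeff_def sum(1) mult by (simp add: mult_ac)
  also have "\<dots> = eta ?l * \<epsilon> ?l (g s' t') * coset_coeff s0 t0 s' t'"
    unfolding coc coset_coeff_def by (simp add: mult_ac)
  finally show ?thesis .
qed

text \<open>
  The part of $C_R$ with charges in a coset of $L'$ is isomorphic to the tensor product of Fock
  modules with the same charges, and irreducible because the latter is.
\<close>

theorem coset_module:
  assumes g0: "g s0 t0 \<in> L" and S: "S = (\<lambda>s. s + s0) ` S1" and T: "T = (\<lambda>t. t + t0) ` S2"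
  defines "W \<equiv> supp_on ({g s t | s t. s \<in> S \<and> t \<in> T} \<times> UNIV)"
  shows "module_iso (psi s0 t0) (bifock S1 S2) phi Y2 (bifock S T) (ker_tens_action A) W"
    and "irreducible_module (carr (ker_tens A)) (ker_tens_action A) W"
proof -
  have Sd: "s - s0 \<in> S1" if "s \<in> S" for s using that by (auto simp: S)
  have Td: "t - t0 \<in> S2" if "t \<in> T" for t using that by (auto simp: T)
  have Sa: "s + s' \<in> S" if "s \<in> S1" "s' \<in> S" for s s'
    using S1_group(2)[OF that(1) Sd[OF that(2)]] by (auto simp: S intro!: image_eqI[of _ _ "s + (s' - s0)"])
  have Ta: "t + t' \<in> T" if "t \<in> S2" "t' \<in> T" for t t'
    using S2_group(2)[OF that(1) Td[OF that(2)]] by (auto simp: T intro!: image_eqI[of _ _ "t + (t' - t0)"])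
  show iso: "module_iso (psi s0 t0) (bifock S1 S2) phi Y2 (bifock S T) (ker_tens_action A) W"
  proof (rule module_isoI)
    show "clinear (psi s0 t0)" by (rule clinear_psi)
    have "inj_on fuse ((S \<times> UNIV) \<times> (T \<times> UNIV))" using inj_fuse by (rule inj_on_subset) simp
    moreover have "(case p of (x, y) \<Rightarrow> coset_coeff s0 t0 (fst x) (fst y) * sgn_deg (snd y)) \<noteq> 0"
      if "p \<in> (S \<times> UNIV) \<times> (T \<times> UNIV)" for p
      using that by (auto simp: sgn_deg_nonzero coset_coeff_def eta_nonzero Sd Td eps_nonzero g_in_L g0)
    ultimately show "bij_betw (psi s0 t0) (bifock S T) W"
      unfolding W_def psi_def image_fuse[symmetric] by (intro bij_betw_monomial_map)
    show "closed_under (bifock S1 S2) Y2 (bifock S T)"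
      by (rule closed_under_Y2[OF Sa Ta])
    fix u w r q assume u: "u \<in> bifock S1 S2" and w: "w \<in> bifock S T"
    show "psi s0 t0 (Y2 u r q w) = ker_tens_action A (phi u) r q (psi s0 t0 w)"
      unfolding ker_tens_action_def A_simps
    proof (rule bilin_eqI[of "\<lambda>u w. psi s0 t0 (Y2 u r q w)" "\<lambda>u w. YA (ker_tens_map A (phi u)) r q (psi s0 t0 w)"])
      fix p p' assume "p \<in> supp u" "p' \<in> supp w"
      then have pS: "p \<in> (S1 \<times> UNIV) \<times> (S2 \<times> UNIV)" "p' \<in> (S \<times> UNIV) \<times> (T \<times> UNIV)"
        using u w unfolding supp_on_def by auto
      obtain s \<mu> t \<nu> s' \<mu>' t' \<nu>' where eq: "p = ((s, \<mu>), (t, \<nu>))" "p' = ((s', \<mu>'), (t', \<nu>'))"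
        by (metis surj_pair)
      have st: "s \<in> S1" "t \<in> S2" "s' \<in> S" "t' \<in> T" using pS by (auto simp: eq)
      let ?E = "J2 (Y1 (bas (s, \<mu>)) r 0 (bas (s', \<mu>'))) (Y1 (bas (t, \<nu>)) q 0 (bas (t', \<nu>')))"
      have "psi s0 t0 (Y2 (bas p) r q (bas p')) = scale (coset_coeff s0 t0 (s + s') (t + t')) ?E"
        unfolding eq Y2_bas by (intro psi_tens Y1_charge bas_charge)
      also have "\<dots> = scale (eta (g s t) * \<epsilon> (g s t) (g s' t') * coset_coeff s0 t0 s' t') ?E"
        by (simp only: coset_coeff_add[OF g0 st(1,2) Sd[OF st(3)] Td[OF st(4)]])
      also have "\<dots> = YA (ker_tens_map A (phi (bas p))) r q (psi s0 t0 (bas p'))"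
      proof -
        have "psi s0 t0 (bas p') = scale (coset_coeff s0 t0 s' t') (J2 (bas (s', \<mu>')) (bas (t', \<nu>')))"
          using psi_tens[OF bas_charge bas_charge, of s0 t0 s' \<mu>' t' \<nu>'] by (simp add: eq)
        then show ?thesis
          unfolding eq(1) ker_tens_map_phi[OF st(1,2)]
          by (simp add: clinear_scale[OF clinear_YA_left] clinear_scale[OF clinear_YA_right] YA_J2_bas mult_ac)
      qed
      finally show "psi s0 t0 (Y2 (bas p) r q (bas p')) = YA (ker_tens_map A (phi (bas p))) r q (psi s0 t0 (bas p'))" .
    qed (intro clinear_compose[OF clinear_psi] clinear_tens_action_left clinear_tens_action_right
        clinear_compose[OF clinear_YA_left] clinear_compose[OF clinear_ker_tens_map clinear_phi]
        clinear_compose[OF clinear_YA_right clinear_psi])+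
  qed
  have "S \<noteq> {}" "T \<noteq> {}" using S1_group(1) S2_group(1) by (auto simp: S T)
  moreover have "s' - s \<in> S1" if "s \<in> S" "s' \<in> S" for s s'
    using S1_group(3)[OF Sd[OF that(2)] Sd[OF that(1)]] by simp
  moreover have "t' - t \<in> S2" if "t \<in> T" "t' \<in> T" for t t'
    using S2_group(3)[OF Td[OF that(2)] Td[OF that(1)]] by simp
  ultimately have "irreducible_module (bifock S1 S2) Y2 (bifock S T)"
    by (intro irreducible_bifock S1_group(1) S2_group(1) Sa Ta) auto
  from irreducible_module_transport[OF iso this]
  show "irreducible_module (carr (ker_tens A)) (ker_tens_action A) W"
    unfolding phi_image .
qed

end

section \<open>Trivializing the cocycle\<close>

context circle_cocycle
begin

lemma scaleR_in_L: "\<gamma> \<in> L \<Longrightarrow> of_int k *\<^sub>R \<gamma> \<in> L"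
  by (auto simp: L_def)

text \<open>
  $b(k+1) = b(k)\,\epsilon(k\gamma, \gamma)$ is the case $l = 1$ of the required identity.  It determines
  $b$ from $b(0) = 1$ in both directions, and the cocycle identity gives the case of general $l$ by
  induction on $l$.
\<close>

lemma rank_one_trivialization:
  assumes \<gamma>: "\<gamma> \<in> L"
  obtains b :: "int \<Rightarrow> complex" where "\<And>k. b k \<noteq> 0"
    "\<And>k l. b (k + l) = b k * b l * \<epsilon> (of_int k *\<^sub>R \<gamma>) (of_int l *\<^sub>R \<gamma>)"
proof -
  define e :: "int \<Rightarrow> int \<Rightarrow> complex" where "e k l = \<epsilon> (of_int k *\<^sub>R \<gamma>) (of_int l *\<^sub>R \<gamma>)" for k l
  have e_nz: "e k l \<noteq> 0" for k l
    unfolding e_def by (intro eps_nonzero scaleR_in_L \<gamma>)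
  have e_coc: "e k l * e (k + l) m = e k (l + m) * e l m" for k l m
    using eps_cocycle[OF scaleR_in_L[OF \<gamma>, of k] scaleR_in_L[OF \<gamma>, of l] scaleR_in_L[OF \<gamma>, of m]]
    by (simp add: e_def scaleR_left_distrib)
  have e_0: "e k 0 = 1" for k using eps_0(1)[OF scaleR_in_L[OF \<gamma>]] by (simp add: e_def)
  define b where "b k = (if k \<ge> 0 then \<Prod>j<nat k. e (int j) 1 else \<Prod>j<nat (- k). inverse (e (- int j - 1) 1))" for k
  have b_nz: "b k \<noteq> 0" for k by (simp add: b_def e_nz)
  have b_0: "b 0 = 1" by (simp add: b_def)
  have b_Suc: "b (k + 1) = b k * e k 1" for k
  proof (cases "k \<ge> 0")
    case True
    then have "nat (k + 1) = Suc (nat k)" by simp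
    then show ?thesis using True by (simp add: b_def)
  next
    case False
    then have "k = - int (nat (- k - 1)) - 1" by simp
    then obtain m where m: "k = - int m - 1" by blast
    have "b k = inverse (e k 1) * (\<Prod>j<m. inverse (e (- int j - 1) 1))"
    proof -
      have "nat (- k) = Suc m" by (simp add: m)
      then have "b k = (\<Prod>j<Suc m. inverse (e (- int j - 1) 1))" using False by (simp add: b_def)
      then show ?thesis by (simp add: m)
    qed
    moreover have "b (k + 1) = (\<Prod>j<m. inverse (e (- int j - 1) 1))"
      by (cases "m = 0") (simp_all add: b_def m)
    ultimately show ?thesis by (simp add: e_nz)
  qed
  have "b (k + l) = b k * b l * e k l" for k l
  proof (induction l rule: int_induct[where k = 0])
    case base
    then show ?case by (simp add: b_0 e_0)
  next
    case (step1 l)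
    have "b (k + (l + 1)) = b (k + l) * e (k + l) 1" using b_Suc[of "k + l"] by (simp add: add.assoc)
    also have "\<dots> = b k * b l * (e k l * e (k + l) 1)" by (simp add: step1)
    also have "\<dots> = b k * (b l * e l 1) * e k (l + 1)" unfolding e_coc by simp
    finally show ?case by (simp only: b_Suc)
  next
    case (step2 l)
    define m where "m = l - 1"
    have l: "l = m + 1" by (simp add: m_def)
    have "b (k + m) * e (k + m) 1 = b (k + l)" using b_Suc[of "k + m"] by (simp add: l add.assoc)
    also have "\<dots> = b k * (b m * e m 1) * e k (m + 1)" using step2 unfolding l b_Suc by simp
    also have "\<dots> = b k * b m * (e k m * e (k + m) 1)" unfolding e_coc by simp
    finally have "b (k + m) = b k * b m * e k m" by (simp add: e_nz)
    then show ?case by (simp add: m_def)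
  qed
  with b_nz show ?thesis unfolding e_def by (rule that)
qed

text \<open>
  Both sides are the scalar by which the product of four elements of the twisted group algebra differs
  from $\mathsf e_{A_1 + A_2 + B_1 + B_2}$, once bracketed as
  $(\mathsf e_{A_1} \mathsf e_{A_2})(\mathsf e_{B_1} \mathsf e_{B_2})$ and once as
  $(\mathsf e_{A_1} \mathsf e_{B_1})(\mathsf e_{A_2} \mathsf e_{B_2})$.
  They agree because $\mathsf e_{A_2}$ and $\mathsf e_{B_1}$ commute.
\<close>

lemma eps_exchange:
  assumes "A1 \<in> L" "A2 \<in> L" "B1 \<in> L" "B2 \<in> L" and comm: "\<epsilon> B1 A2 = \<epsilon> A2 B1"
  shows "\<epsilon> A1 A2 * \<epsilon> B1 B2 * \<epsilon> (A1 + A2) (B1 + B2) = \<epsilon> A1 B1 * \<epsilon> A2 B2 * \<epsilon> (A1 + B1) (A2 + B2)"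
proof -
  have 1: "\<epsilon> A1 A2 * \<epsilon> (A1 + A2) (B1 + B2) = \<epsilon> A1 (A2 + (B1 + B2)) * \<epsilon> A2 (B1 + B2)"
    using assms by (intro eps_cocycle L_add)
  have 2: "\<epsilon> A2 B1 * \<epsilon> (A2 + B1) B2 = \<epsilon> A2 (B1 + B2) * \<epsilon> B1 B2"
    using assms by (intro eps_cocycle)
  have 3: "\<epsilon> A1 B1 * \<epsilon> (A1 + B1) (A2 + B2) = \<epsilon> A1 (B1 + (A2 + B2)) * \<epsilon> B1 (A2 + B2)"
    using assms by (intro eps_cocycle L_add)
  have 4: "\<epsilon> B1 A2 * \<epsilon> (B1 + A2) B2 = \<epsilon> B1 (A2 + B2) * \<epsilon> A2 B2"
    using assms by (intro eps_cocycle)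
  have "\<epsilon> A1 A2 * \<epsilon> B1 B2 * \<epsilon> (A1 + A2) (B1 + B2) = \<epsilon> A1 (A2 + (B1 + B2)) * (\<epsilon> A2 (B1 + B2) * \<epsilon> B1 B2)"
    using 1 by (simp add: mult_ac)
  also have "\<dots> = \<epsilon> A1 (A2 + (B1 + B2)) * (\<epsilon> A2 B1 * \<epsilon> (A2 + B1) B2)" by (simp only: 2)
  also have "\<dots> = \<epsilon> A1 (B1 + (A2 + B2)) * (\<epsilon> B1 A2 * \<epsilon> (B1 + A2) B2)"
    by (simp only: comm ac_simps)
  also have "\<dots> = \<epsilon> A1 (B1 + (A2 + B2)) * (\<epsilon> B1 (A2 + B2) * \<epsilon> A2 B2)" by (simp only: 4)
  also have "\<dots> = \<epsilon> A1 B1 * \<epsilon> A2 B2 * \<epsilon> (A1 + B1) (A2 + B2)"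
    using 3 by (simp add: mult_ac)
  finally show ?thesis .
qed

text \<open>The axes are orthogonal, so the commutator is $(-1)^0$.\<close>

lemma axes_commute: "g s 0 \<in> L \<Longrightarrow> g 0 t \<in> L \<Longrightarrow> \<epsilon> (g 0 t) (g s 0) = \<epsilon> (g s 0) (g 0 t)"
proof -
  assume L: "g s 0 \<in> L" "g 0 t \<in> L"
  have "ipH (g 0 t) (g s 0) = 0" by (simp add: g_def ipH_minus ipH_scale ipH_basis)
  then show ?thesis using eps_commutator[OF L(2,1)] by simp
qed

text \<open>
  The cochain on $L'$ is the product of cochains on the axes with the value of the cocycle at the
  two components.
\<close>

lemma trivialized_of_lattice:
  fixes c :: real
  assumes c: "c > 0" and S1: "S1 = range (\<lambda>k::int. c * k)" and S2: "S2 = range (\<lambda>k::int. c * k)"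
  shows "\<exists>eta. trivialized R \<epsilon> eta"
proof -
  have gL: "g c 0 \<in> L" "g 0 c \<in> L" using S1 S2 unfolding S1_def S2_def by (force intro: range_eqI[of _ _ 1])+
  have gk: "of_int k *\<^sub>R g c 0 = g (c * k) 0" "of_int k *\<^sub>R g 0 c = g 0 (c * k)" for k :: int
    by (simp_all add: g_def mult.commute)
  obtain b :: "int \<Rightarrow> complex" where b: "\<And>k. b k \<noteq> 0" "\<And>k l. b (k + l) = b k * b l * \<epsilon> (g (c * k) 0) (g (c * l) 0)"
    using rank_one_trivialization[OF gL(1)] unfolding gk by metis
  obtain b' :: "int \<Rightarrow> complex" where b': "\<And>k. b' k \<noteq> 0" "\<And>k l. b' (k + l) = b' k * b' l * \<epsilon> (g 0 (c * k)) (g 0 (c * l))"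
    using rank_one_trivialization[OF gL(2)] unfolding gk by metis
  \<comment> \<open>On $L'$ the arguments of the floor function are integers.\<close>
  define eta where "eta \<alpha> = (let k = \<lfloor>ipH \<alpha> (vR R) / c\<rfloor>; l = \<lfloor>ipH \<alpha> (vbarR R) / c\<rfloor>
      in b k * b' l * \<epsilon> (g (c * k) 0) (g 0 (c * l)))" for \<alpha>
  have eta: "eta (g (c * k) (c * l)) = b k * b' l * \<epsilon> (g (c * k) 0) (g 0 (c * l))" for k l :: int
    using c by (simp add: eta_def ipH_g)
  have gL': "g (c * k) 0 \<in> L" "g 0 (c * k) \<in> L" for k :: int
    using scaleR_in_L[OF gL(1), of k] scaleR_in_L[OF gL(2), of k] by (simp_all add: gk)
  have "trivialized R \<epsilon> eta"
  proof unfold_locales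
    fix s t assume "s \<in> S1" "t \<in> S2"
    then obtain k l :: int where kl: "s = c * k" "t = c * l" unfolding S1 S2 by auto
    show "eta (g s t) \<noteq> 0" unfolding kl eta using b(1) b'(1) eps_nonzero gL' by simp
    fix s' t' assume "s' \<in> S1" "t' \<in> S2"
    then obtain k' l' :: int where kl': "s' = c * k'" "t' = c * l'" unfolding S1 S2 by auto
    have g2: "g (c * x) 0 + g 0 (c * y) = g (c * x) (c * y)" for x y :: int
      using g_add[of "c * x" 0 0 "c * y"] by simp
    have gs: "g (c * k) 0 + g (c * k') 0 = g (c * (k + k')) 0" "g 0 (c * l) + g 0 (c * l') = g 0 (c * (l + l'))"
      using g_add[of "c * k" "c * k'" 0 0] g_add[of 0 0 "c * l" "c * l'"] by (simp_all add: distrib_left)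
    have sum: "s + s' = c * of_int (k + k')" "t + t' = c * of_int (l + l')" by (simp_all add: kl kl' distrib_left)
    have "eta (g (s + s') (t + t')) = b (k + k') * b' (l + l') * \<epsilon> (g (c * (k + k')) 0) (g 0 (c * (l + l')))"
      unfolding sum eta ..
    also have "\<dots> = b k * b k' * b' l * b' l' * (\<epsilon> (g (c * k) 0) (g (c * k') 0) * \<epsilon> (g 0 (c * l)) (g 0 (c * l')) *
        \<epsilon> (g (c * k) 0 + g (c * k') 0) (g 0 (c * l) + g 0 (c * l')))"
      unfolding b(2) b'(2) gs by (simp add: mult_ac)
    also have "\<dots> = b k * b k' * b' l * b' l' * (\<epsilon> (g (c * k) 0) (g 0 (c * l)) * \<epsilon> (g (c * k') 0) (g 0 (c * l')) *
        \<epsilon> (g (c * k) 0 + g 0 (c * l)) (g (c * k') 0 + g 0 (c * l')))"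
      by (subst eps_exchange) (auto intro!: gL' axes_commute)
    also have "\<dots> = eta (g s t) * eta (g s' t') * \<epsilon> (g s t) (g s' t')"
      unfolding kl kl' eta g2 by (simp add: mult_ac)
    finally show "eta (g (s + s') (t + t')) = eta (g s t) * eta (g s' t') * \<epsilon> (g s t) (g s' t')" .
  qed
  then show ?thesis by blast
qed

section \<open>Irrational radius\<close>

lemma g_apply: "g s t = ((s - t) * R / sqrt 2, - ((s + t) / (R * sqrt 2)))"
  by (simp add: g_def vR_def vbarR_def inverse_eq_divide add_divide_distrib diff_divide_distrib
      left_diff_distrib right_diff_distrib mult.commute)

lemma g_in_L_iff: "g s t \<in> L \<longleftrightarrow> (s - t) * R / sqrt 2 \<in> \<int> \<and> (s + t) / (R * sqrt 2) \<in> \<int>"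
  using minus_in_Ints_iff[of "(s + t) / (R * sqrt 2)"] by (simp add: g_apply L_def)

lemma S2_eq_S1: "S2 = S1"
  using minus_in_Ints_iff[of "_ * R / sqrt 2"] by (auto simp: S1_def S2_def g_in_L_iff)

text \<open>
  If $s v_R \in L$ with $s \ne 0$ then $R^2$ is the quotient of the two integral coordinates, up to sign.
\<close>

lemma S1_irrational:
  assumes "R\<^sup>2 \<notin> \<rat>" shows "S1 = {0}"
proof -
  have "s = 0" if "s \<in> S1" for s
  proof (rule ccontr)
    assume "s \<noteq> 0"
    have "s * R / sqrt 2 \<in> \<int>" "s / (R * sqrt 2) \<in> \<int>" using that by (simp_all add: S1_def g_in_L_iff)
    then have "s * R / sqrt 2 \<in> \<rat>" "s / (R * sqrt 2) \<in> \<rat>"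
      using Ints_subset_Rats by blast+
    then have "(s * R / sqrt 2) / (s / (R * sqrt 2)) \<in> \<rat>" by (rule Rats_divide)
    also have "(s * R / sqrt 2) / (s / (R * sqrt 2)) = R\<^sup>2"
      using R_pos \<open>s \<noteq> 0\<close> by (simp add: field_simps power2_eq_square)
    finally show False using assms by simp
  qed
  then show ?thesis by (auto simp: S1_def g_0 L_0)
qed

text \<open>
  Both algebras are the tensor product of two rank one Heisenberg algebras, one via \<open>phi\<close> and
  the other via the identification of the Fock spaces.
\<close>

lemma isomorphic_irrational:
  assumes "R\<^sup>2 \<notin> \<rat>"
  shows "isomorphic_fva (ker_tens A) (Heis_fva R)"
proof -
  have S: "S1 = {0}" "S2 = {0}" using S1_irrational[OF assms] S2_eq_S1 by auto
  interpret trivialized R \<epsilon> "\<lambda>_. 1"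
    by unfold_locales (auto simp: S g_0 eps_0 L_0)
  let ?V = "\<lparr>carr = bifock {0} {0}, vac = tens (r1.ev 0) (r1.ev 0), Y = Y2\<rparr>"
  have "fva_iso phi ?V (ker_tens A)" by (rule fva_iso_phi) (simp_all add: S)
  then have 1: "isomorphic_fva ?V (ker_tens A)" by (auto simp: isomorphic_fva_def)
  have "fva_iso J ?V (Heis_fva R)"
  proof (rule fva_isoI)
    show "clinear J" by (rule clinear_J)
    have "inj_on fuse (({0} \<times> UNIV) \<times> ({0} \<times> UNIV))" using inj_fuse by (rule inj_on_subset) simp
    then have "bij_betw J (bifock {0} {0}) (supp_on (fuse ` (({0} \<times> UNIV) \<times> ({0} \<times> UNIV))))"
      unfolding J_def by (intro bij_betw_monomial_map) (simp_all add: sgn_deg_nonzero)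
    then show "bij_betw J (carr ?V) (carr (Heis_fva R))"
      by (simp add: Heis_fva_def fock_sum_eq image_fuse g_0)
    show "J (vac ?V) = vac (Heis_fva R)"
      by (simp add: Heis_fva_def vac_J2 J2_def)
    show "closed_under (carr ?V) (Y ?V) (carr ?V)"
      by simp (rule closed_under_Y2; simp)
    fix a b r q assume "a \<in> carr ?V" "b \<in> carr ?V"
    have "J (Y2 a r q b) = h.Yhat (J a) r q (J b)"
    proof (rule bilin_eqI[of "\<lambda>a b. J (Y2 a r q b)" "\<lambda>a b. h.Yhat (J a) r q (J b)"])
      fix p p' :: "(real \<times> unit monomial) \<times> (real \<times> unit monomial)"
      obtain i j m n where eq: "p = (i, j)" "p' = (m, n)" by (cases p; cases p')
      show "J (Y2 (bas p) r q (bas p')) = h.Yhat (J (bas p)) r q (J (bas p'))"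
        using Yhat_J2[of "bas i" "bas j" r q "bas m" "bas n"] by (simp add: eq Y2_bas J2_def)
    qed (intro clinear_compose[OF clinear_J] clinear_tens_action_left clinear_tens_action_right
        clinear_compose[OF clinear_Yhat_left clinear_J] clinear_compose[OF clinear_Yhat_right clinear_J])+
    then show "J (Y ?V a r q b) = Y (Heis_fva R) (J a) r q (J b)"
      by (simp add: Heis_fva_def)
  qed
  then have 2: "isomorphic_fva ?V (Heis_fva R)" by (auto simp: isomorphic_fva_def)
  have "isomorphic_fva (ker_tens A) ?V"
    using 1 by (rule isomorphic_fva_sym) (simp_all add: subspace_supp_on r1.ev_def)
  then show ?thesis using 2 by (rule isomorphic_fva_trans)
qed

end

section \<open>Rational radius\<close>

text \<open>
  The solutions of $ap - bq = 1$ differ by multiples of $(q, p)$, which change $ap + bq$ by multiples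
  of $2pq$.  So there is a unique representative.
\<close>

lemma n_pq_spec:
  assumes pq: "p > 0" "q > 0" and "coprime p q"
  obtains a b k :: int where "a * int p - b * int q = 1" "n_pq p q = a * int p + b * int q + 2 * int p * int q * k"
proof -
  let ?M = "2 * int p * int q"
  have M: "?M > 0" using pq by simp
  let ?P = "\<lambda>n::int. 0 \<le> n \<and> n < int (2 * p * q) \<and>
     (\<exists>(a::int) (b::int). a * int p - b * int q = 1 \<and> [n = a * int p + b * int q] (mod ?M))"
  have cop: "coprime (int p) (int q)" using assms(3) by simp
  obtain u v' where "u * int p + v' * int q = 1"
    using bezout_int[of "int p" "int q"] cop by auto
  then obtain v where uv: "u * int p - v * int q = 1"
    using that by (metis diff_minus_eq_add minus_mult_left)
  define w where "w = u * int p + v * int q"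
  have "\<exists>!n. ?P n"
  proof (rule ex1I[of _ "w mod ?M"])
    show "?P (w mod ?M)"
    proof -
      have "0 \<le> w mod ?M" "w mod ?M < int (2 * p * q)" using M by simp_all
      moreover have "[w mod ?M = u * int p + v * int q] (mod ?M)" by (simp add: cong_def w_def)
      ultimately show ?thesis using uv by blast
    qed
    fix n assume n: "?P n"
    then obtain a b :: int where ab: "a * int p - b * int q = 1" and cong: "[n = a * int p + b * int q] (mod ?M)" by blast
    have eq: "(a - u) * int p = (b - v) * int q" using ab uv by (simp add: algebra_simps)
    then have "int q dvd (a - u) * int p" by simp
    then have "int q dvd a - u" using cop by (simp add: coprime_dvd_mult_left_iff coprime_commute)
    then obtain k where k: "a - u = int q * k" by blast
    then have "int q * (int p * k) = int q * (b - v)" using eq by (simp add: mult_ac)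
    then have "b - v = int p * k" using pq by simp
    then have "a = u + int q * k" "b = v + int p * k" using k by simp_all
    then have "a * int p + b * int q = w + ?M * k" by (simp add: w_def algebra_simps)
    then have "n mod ?M = w mod ?M" using cong by (simp add: cong_def)
    moreover have "n mod ?M = n" using n by simp
    ultimately show "n = w mod ?M" by simp
  qed
  then have "?P (n_pq p q)" unfolding n_pq_def by (rule theI')
  then obtain a b :: int where ab: "a * int p - b * int q = 1" and "[n_pq p q = a * int p + b * int q] (mod ?M)" by blast
  then have "?M dvd n_pq p q - (a * int p + b * int q)" by (simp add: cong_iff_dvd_diff)
  then obtain k where "n_pq p q - (a * int p + b * int q) = ?M * k" by blast
  then have "n_pq p q = a * int p + b * int q + ?M * k" by simp
  then show ?thesis using ab that by blast
qed

locale rational_circle = circle_cocycle +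
  fixes p q :: nat
  assumes pq: "p > 0" "q > 0" "coprime p q" "R\<^sup>2 = real p / real q"
begin

text \<open>
  The generator of both lattices $L \cap \mathbb R v_R$ and $L \cap \mathbb R \bar v_R$.
\<close>

definition c :: real where
  "c = sqrt (2 * real (p * q))"

lemma c_pos: "c > 0"
  using pq by (simp add: c_def)

lemma c_square: "c * c = 2 * real p * real q"
  by (simp add: c_def)

lemma R_eq: "R / sqrt 2 = real p / c" "1 / (R * sqrt 2) = real q / c"
proof -
  have R: "R = sqrt (real p / real q)" using pq(4) R_pos by (metis abs_of_pos real_sqrt_abs)
  have "R * sqrt 2 * real q = c"
  proof -
    have "R * sqrt 2 * real q = sqrt (real p / real q) * sqrt 2 * sqrt (real q * real q)"
      using R by simp
    also have "\<dots> = sqrt (real p / real q * 2 * (real q * real q))" by (simp only: real_sqrt_mult)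
    also have "real p / real q * 2 * (real q * real q) = 2 * real (p * q)" using pq by simp
    finally show ?thesis by (simp add: c_def)
  qed
  then show 2: "1 / (R * sqrt 2) = real q / c" using R_pos pq c_pos by (simp add: field_simps)
  have "R / sqrt 2 = R\<^sup>2 * (1 / (R * sqrt 2))" using R_pos by (simp add: power2_eq_square)
  also have "\<dots> = real p / c" unfolding 2 pq(4) using pq by simp
  finally show "R / sqrt 2 = real p / c" .
qed

text \<open>
  In units of $1/\sqrt{2pq}$ the lattice is given by congruences between the coordinates.
\<close>

lemma g_in_L_rational: "g (x / c) (y / c) \<in> L \<longleftrightarrow> (x - y) / (2 * real q) \<in> \<int> \<and> (x + y) / (2 * real p) \<in> \<int>"
proof -
  have "(x / c - y / c) * R / sqrt 2 = (x - y) / c * (R / sqrt 2)"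
    by (simp add: diff_divide_distrib)
  also have "\<dots> = (x - y) * real p / (c * c)" unfolding R_eq(1) by simp
  also have "\<dots> = (x - y) / (2 * real q)" unfolding c_square using pq by simp
  finally have 1: "(x / c - y / c) * R / sqrt 2 = (x - y) / (2 * real q)" .
  have "(x / c + y / c) / (R * sqrt 2) = (x + y) / c * (1 / (R * sqrt 2))"
    by (simp add: add_divide_distrib)
  also have "\<dots> = (x + y) * real q / (c * c)" unfolding R_eq(2) by simp
  also have "\<dots> = (x + y) / (2 * real p)" unfolding c_square using pq by simp
  finally show ?thesis unfolding g_in_L_iff 1 by simp
qed

lemma c_times: "c * real_of_int k = real_of_int (2 * int p * int q * k) / c"
  using c_pos c_square by (simp add: field_simps)

text \<open>
  A number divisible by $2p$ and by $2q$ is divisible by $2pq$, as $p$ and $q$ are coprime.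
\<close>

lemma S1_rational: "S1 = range (\<lambda>k::int. c * k)"
proof
  show "S1 \<subseteq> range (\<lambda>k::int. c * k)"
  proof
    fix s assume "s \<in> S1"
    then have "g ((c * s) / c) (0 / c) \<in> L" using c_pos by (simp add: S1_def)
    then have "c * s / (2 * real q) \<in> \<int>" "c * s / (2 * real p) \<in> \<int>" unfolding g_in_L_rational by simp_all
    then obtain m n :: int where mn: "c * s / (2 * real q) = m" "c * s / (2 * real p) = n" by (auto elim!: Ints_cases)
    then have x: "c * s = 2 * real q * m" "c * s = 2 * real p * n" using pq by (auto simp: field_simps)
    then have "real_of_int (int q * m) = real_of_int (int p * n)" by simp
    then have eq: "int q * m = int p * n" by (simp only: of_int_eq_iff)
    then have "int p dvd int q * m" by simp
    then have "int p dvd m" using pq(3) by (simp add: coprime_dvd_mult_right_iff)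
    then obtain k where "m = int p * k" by blast
    then have "c * s = c * (c * k)" using x(1) c_square by (simp add: mult_ac)
    then show "s \<in> range (\<lambda>k::int. c * k)" using c_pos by simp
  qed
  show "range (\<lambda>k::int. c * k) \<subseteq> S1"
  proof
    fix s assume "s \<in> range (\<lambda>k::int. c * k)"
    then obtain k :: int where s: "s = c * k" by blast
    have "g (real_of_int (2 * int p * int q * k) / c) (0 / c) \<in> L"
      unfolding g_in_L_rational using pq by simp
    then show "s \<in> S1" unfolding s c_times S1_def by simp
  qed
qed

text \<open>The charges of $V_{\sqrt{2pq}\mathbb Z + i/\sqrt{2pq}}$.\<close>

definition charges :: "int \<Rightarrow> real set" where
  "charges i = range (\<lambda>k::int. c * k + i / c)"

lemma charges_eq: "charges i = (\<lambda>s. s + i / c) ` S1" "charges i = (\<lambda>s. s + i / c) ` S2"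
  by (auto simp: charges_def S2_eq_S1 S1_rational)

lemma charge_of: "c * real_of_int k + real_of_int i / c = real_of_int (i + 2 * int p * int q * k) / c"
  unfolding c_times by (simp add: add_divide_distrib)

lemma mem_charges: "real_of_int x / c \<in> charges i \<longleftrightarrow> 2 * int p * int q dvd x - i"
proof
  assume "real_of_int x / c \<in> charges i"
  then obtain k where "real_of_int x / c = real_of_int (i + 2 * int p * int q * k) / c"
    unfolding charges_def charge_of by blast
  then have "x = i + 2 * int p * int q * k" using c_pos by (simp only: divide_cancel_right of_int_eq_iff) auto
  then show "2 * int p * int q dvd x - i" by simp
next
  assume "2 * int p * int q dvd x - i"
  then obtain k where "x - i = 2 * int p * int q * k" by blast
  then have "x = i + 2 * int p * int q * k" by simp
  then show "real_of_int x / c \<in> charges i" unfolding charges_def charge_of by blast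
qed

definition summand_charges :: "int \<Rightarrow> H set" where
  "summand_charges i = {g s t | s t. s \<in> charges i \<and> t \<in> charges (n_pq p q * i)}"

text \<open>
  With $n = ap + bq$ and $ap - bq = 1$ one has $1 - n = -2bq$ and $1 + n = 2ap$, which are the
  congruences required of the coordinates $(1, n)$.
\<close>

lemma base_in_L: "g (real_of_int i / c) (real_of_int (n_pq p q * i) / c) \<in> L"
proof -
  obtain a b k :: int where ab: "a * int p - b * int q = 1" and n: "n_pq p q = a * int p + b * int q + 2 * int p * int q * k"
    using n_pq_spec[OF pq(1-3)] .
  have "1 - n_pq p q = 2 * int q * (- b - int p * k)" "1 + n_pq p q = 2 * int p * (a + int q * k)"
    using ab n by (simp_all add: algebra_simps)
  then have "(1 - n_pq p q) * i = 2 * int q * ((- b - int p * k) * i)" "(1 + n_pq p q) * i = 2 * int p * ((a + int q * k) * i)"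
    by simp_all
  then have e: "i - n_pq p q * i = 2 * int q * ((- b - int p * k) * i)" "i + n_pq p q * i = 2 * int p * ((a + int q * k) * i)"
    by (simp_all only: left_diff_distrib distrib_right mult_1)
  have "real_of_int i - real_of_int (n_pq p q * i) = 2 * real q * real_of_int ((- b - int p * k) * i)"
    "real_of_int i + real_of_int (n_pq p q * i) = 2 * real p * real_of_int ((a + int q * k) * i)"
    unfolding of_int_diff[symmetric] of_int_add[symmetric] e
    by (simp_all only: of_int_mult[of "2 * int q"] of_int_mult[of "2 * int p"] of_int_mult[of 2] of_int_of_nat_eq of_int_numeral)
  then show ?thesis unfolding g_in_L_rational using pq by simp
qed

text \<open>
  Let $(x, y)$ be the coordinates of a lattice vector in units of $1/\sqrt{2pq}$, so that
  $x = qm + pn$ and $y = pn - qm$ for integers $m$, $n$.  Modulo $2pq$ the number $n_{p,q}$ satisfies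
  $n_{p,q} + 1 = 2ap$ and $n_{p,q} - 1 = 2bq$, so multiplication by it negates $qm$ and fixes $pn$.
  Hence $y = n_{p,q} x$, and the vector lies in the summand of $x$ modulo $2pq$.
\<close>

lemma L_decomposition: "L = (\<Union>i\<in>{0..<2 * int p * int q}. summand_charges i)"
proof
  show "(\<Union>i\<in>{0..<2 * int p * int q}. summand_charges i) \<subseteq> L"
  proof safe
    fix i x assume "x \<in> summand_charges i"
    then obtain s t where x: "x = g (s + i / c) (t + real_of_int (n_pq p q * i) / c)" "s \<in> S1" "t \<in> S2"
      unfolding summand_charges_def charges_eq(1)[of i] charges_eq(2)[of "n_pq p q * i"] by blast
    have "g s t \<in> L" using x(2,3) g_add[of s 0 0 t] L_add[of "g s 0" "g 0 t"] by (simp add: S1_def S2_def)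
    then show "x \<in> L" unfolding x(1) g_add by (intro L_add base_in_L)
  qed
  show "L \<subseteq> (\<Union>i\<in>{0..<2 * int p * int q}. summand_charges i)"
  proof
    fix \<alpha> assume \<alpha>: "\<alpha> \<in> L"
    obtain s t where g: "\<alpha> = g s t" by (rule g_surj)
    have "g ((c * s) / c) ((c * t) / c) \<in> L" using \<alpha> c_pos by (simp add: g)
    then obtain m n :: int where "(c * s - c * t) / (2 * real q) = m" "(c * s + c * t) / (2 * real p) = n"
      unfolding g_in_L_rational by (auto elim!: Ints_cases)
    then have "c * s - c * t = 2 * real q * m" "c * s + c * t = 2 * real p * n" using pq by (auto simp: field_simps)
    then have "c * s = real q * m + real p * n" "c * t = real p * n - real q * m" by simp_all
    define x y where "x = int q * m + int p * n" and "y = int p * n - int q * m"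
    have st: "s = real_of_int x / c" "t = real_of_int y / c"
      using \<open>c * s = _\<close> \<open>c * t = _\<close> c_pos by (simp_all add: x_def y_def field_simps)
    define i where "i = x mod (2 * int p * int q)"
    have i: "i \<in> {0..<2 * int p * int q}" using pq by (simp add: i_def)
    have xi: "2 * int p * int q dvd x - i" by (simp add: i_def)
    obtain a b k :: int where ab: "a * int p - b * int q = 1" and nn: "n_pq p q = a * int p + b * int q + 2 * int p * int q * k"
      using n_pq_spec[OF pq(1-3)] .
    have "n_pq p q * x - y = 2 * int p * int q * (a * m + b * n + k * x)"
    proof -
      have "n_pq p q * x - y = int q * m * (a * int p + b * int q + 1) + int p * n * (a * int p + b * int q - 1) + 2 * int p * int q * k * x"
        by (simp add: nn x_def y_def algebra_simps)
      also have "a * int p + b * int q + 1 = 2 * a * int p" using ab by simp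
      also have "a * int p + b * int q - 1 = 2 * b * int q" using ab by simp
      finally show ?thesis by (simp add: algebra_simps)
    qed
    then have d1: "2 * int p * int q dvd n_pq p q * x - y" by simp
    have d2: "2 * int p * int q dvd n_pq p q * (x - i)" using xi by (rule dvd_mult)
    have "2 * int p * int q dvd n_pq p q * (x - i) - (n_pq p q * x - y)" using d2 d1 by (rule dvd_diff)
    moreover have "n_pq p q * (x - i) - (n_pq p q * x - y) = y - n_pq p q * i" by (simp add: right_diff_distrib)
    ultimately have "2 * int p * int q dvd y - n_pq p q * i" by simp
    then have "\<alpha> \<in> summand_charges i"
      unfolding summand_charges_def g st using xi mem_charges by blast
    then show "\<alpha> \<in> (\<Union>i\<in>{0..<2 * int p * int q}. summand_charges i)" using i by blast
  qed
qed

lemma disjoint_summands: "disjoint_family_on (\<lambda>i. summand_charges i \<times> (UNIV :: bool monomial set)) {0..<2 * int p * int q}"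
  unfolding disjoint_family_on_def
proof (intro ballI impI)
  fix i j assume ij: "i \<in> {0..<2 * int p * int q}" "j \<in> {0..<2 * int p * int q}" "i \<noteq> j"
  have "summand_charges i \<inter> summand_charges j = {}"
  proof (rule ccontr)
    assume "summand_charges i \<inter> summand_charges j \<noteq> {}"
    then obtain s where "s \<in> charges i" "s \<in> charges j"
      unfolding summand_charges_def by (auto simp: g_inject)
    moreover from this obtain k where s: "s = real_of_int (i + 2 * int p * int q * k) / c" unfolding charges_def charge_of by blast
    ultimately have "2 * int p * int q dvd i + 2 * int p * int q * k - j" using mem_charges by blast
    then obtain l where "i + 2 * int p * int q * k - j = 2 * int p * int q * l" by blast
    then have "i - j = 2 * int p * int q * (l - k)" by (simp add: right_diff_distrib)
    then have "2 * int p * int q dvd i - j" by simp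
    then have "i mod (2 * int p * int q) = j mod (2 * int p * int q)" by (simp add: mod_eq_dvd_iff)
    then show False using ij by simp
  qed
  then show "summand_charges i \<times> (UNIV :: bool monomial set) \<inter> summand_charges j \<times> UNIV = {}" by blast
qed

lemma V_carr: "carr (tens_fva (V_fva (p * q)) (conj_fva (V_fva (p * q)))) = bifock S1 S2"
  "vac (tens_fva (V_fva (p * q)) (conj_fva (V_fva (p * q)))) = tens (r1.ev 0) (r1.ev 0)"
  "Y (tens_fva (V_fva (p * q)) (conj_fva (V_fva (p * q)))) = Y2"
  by (simp_all add: tens_fva_def V_fva_def conj_fva_def fock_sum_eq tens_space_supp_on S2_eq_S1 S1_rational c_def)

lemma V_mod_charges: "tens_space (V_mod (p * q) i) (V_mod (p * q) j) = bifock (charges i) (charges j)"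
  by (simp add: V_mod_def fock_sum_eq tens_space_supp_on charges_def c_def)

text \<open>
  The summand with index $i$ is the part of $C_R$ with charges in the coset of $L'$ through the point
  $(i, n_{p,q} i)/\sqrt{2pq}$.
\<close>

theorem rational_decomposition:
  "\<exists>\<phi>. fva_iso \<phi> (tens_fva (V_fva (p * q)) (conj_fva (V_fva (p * q)))) (ker_tens A) \<and>
    (\<exists>W :: int \<Rightarrow> stateH set.
      direct_sum_decomp (carr A) {0..<2 * int p * int q} W \<and>
      (\<forall>i\<in>{0..<2 * int p * int q}.
        irreducible_module (carr (ker_tens A)) (ker_tens_action A) (W i) \<and>
        (\<exists>\<psi>. module_iso \<psi> (carr (tens_fva (V_fva (p * q)) (conj_fva (V_fva (p * q))))) \<phi> Y2
          (tens_space (V_mod (p * q) i) (V_mod (p * q) (n_pq p q * i))) (ker_tens_action A) (W i))))"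
proof -
  obtain eta where "trivialized R \<epsilon> eta"
    using trivialized_of_lattice[OF c_pos S1_rational] S1_rational S2_eq_S1 by auto
  then interpret trivialized R \<epsilon> eta .
  define W where "W i = supp_on (summand_charges i \<times> (UNIV :: bool monomial set))" for i
  have "direct_sum_decomp (supp_on (\<Union>i\<in>{0..<2 * int p * int q}. summand_charges i \<times> (UNIV :: bool monomial set)))
      {0..<2 * int p * int q} W"
    unfolding W_def by (rule direct_sum_decomp_supp_on[OF _ disjoint_summands]) simp
  moreover have "(\<Union>i\<in>{0..<2 * int p * int q}. summand_charges i \<times> (UNIV :: bool monomial set)) = L \<times> UNIV"
    using L_decomposition by blast
  ultimately have dec: "direct_sum_decomp (carr A) {0..<2 * int p * int q} W"
    by (simp add: A_simps)
  note mod = coset_module[OF base_in_L charges_eq(1) charges_eq(2), folded summand_charges_def, folded W_def]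
  show ?thesis
    unfolding V_carr V_mod_charges
    using fva_iso_phi[OF V_carr] dec mod by blast
qed

end

theorem proposition6p7:
  fixes R :: real and \<epsilon> :: "H \<Rightarrow> H \<Rightarrow> complex"
  assumes "R > 0" and "lattice_cocycle \<epsilon>"
  shows "(R\<^sup>2 \<notin> \<rat> \<longrightarrow> isomorphic_fva (ker_tens (C_fva R \<epsilon>)) (Heis_fva R)) \<and>
    (\<forall>p q :: nat. p > 0 \<and> q > 0 \<and> coprime p q \<and> R\<^sup>2 = real p / real q \<longrightarrow>
      (\<exists>\<phi>. fva_iso \<phi> (tens_fva (V_fva (p * q)) (conj_fva (V_fva (p * q)))) (ker_tens (C_fva R \<epsilon>)) \<and>
        (\<exists>W :: int \<Rightarrow> (H \<times> bool monomial \<Rightarrow>\<^sub>0 complex) set.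
          direct_sum_decomp (carr (C_fva R \<epsilon>)) {0..<2 * int p * int q} W \<and>
          (\<forall>i\<in>{0..<2 * int p * int q}.
            irreducible_module (carr (ker_tens (C_fva R \<epsilon>))) (ker_tens_action (C_fva R \<epsilon>)) (W i) \<and>
            (\<exists>\<psi>. module_iso \<psi>
              (carr (tens_fva (V_fva (p * q)) (conj_fva (V_fva (p * q))))) \<phi>
              (tens_action Y1 (conj_action Y1))
              (tens_space (V_mod (p * q) i) (V_mod (p * q) (n_pq p q * i)))
              (ker_tens_action (C_fva R \<epsilon>)) (W i))))))"
proof (intro conjI impI allI)
  interpret circle_cocycle R \<epsilon> using assms by unfold_locales
  show "isomorphic_fva (ker_tens (C_fva R \<epsilon>)) (Heis_fva R)" if "R\<^sup>2 \<notin> \<rat>"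
    using that by (rule isomorphic_irrational)
  fix p q :: nat assume "p > 0 \<and> q > 0 \<and> coprime p q \<and> R\<^sup>2 = real p / real q"
  then interpret rational_circle R \<epsilon> p q by unfold_locales auto
  show "\<exists>\<phi>. fva_iso \<phi> (tens_fva (V_fva (p * q)) (conj_fva (V_fva (p * q)))) (ker_tens (C_fva R \<epsilon>)) \<and>
        (\<exists>W :: int \<Rightarrow> (H \<times> bool monomial \<Rightarrow>\<^sub>0 complex) set.
          direct_sum_decomp (carr (C_fva R \<epsilon>)) {0..<2 * int p * int q} W \<and>
          (\<forall>i\<in>{0..<2 * int p * int q}.
            irreducible_module (carr (ker_tens (C_fva R \<epsilon>))) (ker_tens_action (C_fva R \<epsilon>)) (W i) \<and>
            (\<exists>\<psi>. module_iso \<psi>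
              (carr (tens_fva (V_fva (p * q)) (conj_fva (V_fva (p * q))))) \<phi>
              (tens_action Y1 (conj_action Y1))
              (tens_space (V_mod (p * q) i) (V_mod (p * q) (n_pq p q * i)))
              (ker_tens_action (C_fva R \<epsilon>)) (W i))))"
    by (rule rational_decomposition)
qed

end
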